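(* Let $A=S(V,N)$ be the $N$-symmetric algebra of $V$, let $M,P$ be $A$-bimodules, and let $q\ge p\ge 0$ be such that $\nu(q-p)\ne\nu(q)-\nu(p)$ (that is, $N>2$, $p$ is odd and $q$ is even). Let $f:\bigwedge^{\nu(p)}V\to P$ be a $k$-linear map and $z=m\otimes(x_1\wedge\cdots\wedge x_{\nu(q)})\in M\otimes\bigwedge^{\nu(q)}V$, where $m\in M$ and $x_1<\cdots<x_{\nu(q)}$ belong to the ordered basis $(e_1,\ldots,e_n)$ of $V$, viewed as a Koszul $p$-cochain and a Koszul $q$-chain via the isomorphisms $\phi_r:\bigwedge^r V\to Ant_r(V^{\otimes r})$. Then the right Koszul cap product, viewed in $(M\otimes_AP)\otimes\bigwedge^{\nu(q-p)}V$, is given by $$\begin{aligned}z\underset{K}{\frown}f=\sum_{0\le i+j\le N-2}\ \sum_{\sigma\in Sh(i,\nu(p),\nu(q-p),j)}\mathrm{sgn}(\sigma)\,\bigl(&x_{\sigma(\nu(q)-j+1)}\ldots x_{\sigma(\nu(q))}\,m\,x_{\sigma(1)}\ldots x_{\sigma(i)}\otimes_A f(x_{\sigma(i+1)}\wedge\cdots\wedge x_{\sigma(i+\nu(p))})\\&x_{\sigma(i+\nu(p)+1)}\ldots x_{\sigma(\nu(p)+N-j-2)}\bigr)\otimes(x_{\sigma(\nu(p)+N-j-1)}\wedge\cdots\wedge x_{\sigma(\nu(q)-j)}),\end{aligned}$$ where the outer sum is over integers $i,j\ge0$.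
   Context: $k$ is a field, $V$ a $k$-vector space of finite dimension $n\ge 2$ with ordered basis $(e_1,\ldots,e_n)$ (with $e_1<\cdots<e_n$), and $N$ is an integer with $2\le N\le n$. Tensor symbols $\otimes$ between elements of $V$ are omitted. For $r\ge1$, $Ant_r:V^{\otimes r}\to V^{\otimes r}$ is the linear map $Ant_r(z)=\sum_{\sigma\in\Sigma_r}\mathrm{sgn}(\sigma)\,\sigma\cdot z$, where $\Sigma_r$ is the group of permutations of $\{1,\ldots,r\}$ and $\sigma\cdot(x_1\ldots x_r)=x_{\sigma^{-1}(1)}\ldots x_{\sigma^{-1}(r)}$; $Ant_0=\mathrm{Id}_k$. There is an isomorphism $\phi_r:\bigwedge^r V\to Ant_r(V^{\otimes r})$, $e_{i_1}\wedge\cdots\wedge e_{i_r}\mapsto Ant_r(e_{i_1}\ldots e_{i_r})$ for $i_1<\cdots<i_r$. The $N$-symmetric algebra is $A=S(V,N)=T(V)/(R)$ with $R=Ant_N(V^{\otimes N})$. Elements of $V$ appearing as factors in bimodules mean their images in $A$. Put $W_r=\bigcap_{i+N+j=r}V^{\otimes i}\otimes R\otimes V^{\otimes j}\subseteq V^{\otimes r}$ (so $W_r=V^{\otimes r}$ for $r<N$). Define $\nu(2p')=Np'$ and $\nu(2p'+1)=Np'+1$. For all $p$ one has $W_{\nu(p)}=Ant_{\nu(p)}(V^{\otimes\nu(p)})$, so Koszul $p$-cochains (linear maps $f:W_{\nu(p)}\to P$) are identified with linear maps $f\circ\phi_{\nu(p)}:\bigwedge^{\nu(p)}V\to P$, denoted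 by the same letter, and Koszul $q$-chains (elements of $M\otimes W_{\nu(q)}$) with elements of $M\otimes\bigwedge^{\nu(q)}V$ via $\mathrm{id}\otimes\phi_{\nu(q)}$. Right Koszul cap product: for a Koszul $p$-cochain $f:W_{\nu(p)}\to P$ and a Koszul $q$-chain written as (a sum of) $z=m\otimes x_1\ldots x_{\nu(q)}\in M\otimes W_{\nu(q)}$ with $q\ge p$, the element $z\underset{K}{\frown}f\in(M\otimes_AP)\otimes W_{\nu(q-p)}$ is defined as follows, $f$ being applied to the indicated tensor positions, using the natural inclusions $W_{\nu(q)}\subseteq V^{\otimes i}\otimes W_{\nu(p)}\otimes V^{\otimes l}\otimes W_{\nu(q-p)}\otimes V^{\otimes j}$. (1) If $p$ and $q-p$ are not both odd (so $\nu(q-p)=\nu(q)-\nu(p)$): $z\underset{K}{\frown}f=(-1)^{pq}(m\otimes_Af(x_1\ldots x_{\nu(p)}))\otimes x_{\nu(p)+1}\ldots x_{\nu(q)}$. (2) If $p$ is odd and $q$ is even (so $\nu(q-p)=\nu(q)-\nu(p)-N+2$): $z\underset{K}{\frown}f=\sum_{0\le i+j\le N-2}\bigl(x_{\nu(q)-j+1}\ldots x_{\nu(q)}\,m\,x_1\ldots x_i\otimes_Af(x_{i+1}\ldots x_{i+\nu(p)})\,x_{i+\nu(p)+1}\ldots x_{\nu(p)+N-j-2}\bigr)\otimes x_{\nu(p)+N-j-1}\ldots x_{\nu(q)-j}$, the sum being over $i,j\ge0$. $Sh(i,\nu(p),\nu(q-p),j)$ denotes the set of permutations $\sigma$ of $\{1,\ldots,\nu(q)\}$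 that are increasing on $\{i+1,\ldots,i+\nu(p)\}$ and increasing on $\{\nu(p)+N-j-1,\ldots,\nu(q)-j\}$ (no condition on the other indices). *)

theory Defs
  imports
    Complex_Main
    "HOL-Algebra.Free_Abelian_Groups"
    "HOL-Algebra.QuotRing"
    "HOL-Algebra.Module"
    "HOL-Combinatorics.Permutations"
begin

section \<open>Tensor algebra of a vector space with an ordered basis\<close>

text \<open>
  The ordered basis of \<open>V\<close> is a family \<open>e :: 'b \<Rightarrow> 'v\<close> indexed by a finite linear order, so
  \<open>n = card (UNIV :: 'b set)\<close>. The tensor algebra \<open>T(V)\<close> is realised as the free algebra on the basis:
  finitely supported functions from words over \<open>'b\<close> to \<open>'k\<close> with the convolution product
  coming from concatenation. The word \<open>[b1, \<dots>, br]\<close> stands for the tensor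
  \<open>e b1 \<otimes> \<dots> \<otimes> e br\<close>, and an arbitrary tensor of vectors is \<open>tens scale e [x1, \<dots>, xr]\<close>
  (multilinear by \<open>vec_add\<close> and \<open>vec_scale\<close> below).
\<close>

instantiation list :: (type) monoid_add
begin
definition zero_list :: "'a list" where "zero_list = []"
definition plus_list :: "'a list \<Rightarrow> 'a list \<Rightarrow> 'a list" where "plus_list = (@)"
instance by standard (simp_all add: zero_list_def plus_list_def)
end

type_synonym ('b, 'k) tensors = "'b list \<Rightarrow>\<^sub>0 'k"

definition scalar :: "'k::field \<Rightarrow> ('b, 'k) tensors" where
  "scalar c = Poly_Mapping.single [] c"

definition tscale :: "'k::field \<Rightarrow> ('b, 'k) tensors \<Rightarrow> ('b, 'k) tensors" where
  "tscale c t = scalar c * t"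

lemma tscale_single: "tscale c (Poly_Mapping.single w d) = Poly_Mapping.single w (c * d)"
  by (simp add: tscale_def scalar_def mult_single plus_list_def)

lemma scalar_add: "scalar (c + d) = scalar c + scalar d"
  by (simp add: scalar_def single_add)

lemma scalar_mult: "scalar (c * d) = scalar c * scalar d"
  by (simp add: scalar_def mult_single plus_list_def)

lemma single_Nil: "Poly_Mapping.single [] 1 = (1 :: ('b, 'k::field) tensors)"
  using single_one[where ?'a = "'b list" and ?'b = 'k] by (simp add: zero_list_def)

lemma scalar_1: "scalar 1 = 1"
  by (simp add: scalar_def single_Nil)

interpretation tensors: vector_space "tscale :: 'k::field \<Rightarrow> ('b, 'k) tensors \<Rightarrow> _"
  by standard
    (simp_all add: tscale_def distrib_left distrib_right scalar_add scalar_mult scalar_1 mult.assoc)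

text \<open>\<open>tpow r\<close> is the homogeneous component \<open>V\<^sup>\<otimes>\<^sup>r\<close>; see \<open>tpow_eq_span\<close>.\<close>

definition tpow :: "nat \<Rightarrow> ('b, 'k::field) tensors set" where
  "tpow r = {t. \<forall>w \<in> Poly_Mapping.keys t. length w = r}"

definition tensor_algebra :: "('b, 'k::field) tensors ring" where
  "tensor_algebra = \<lparr>carrier = UNIV, monoid.mult = (*), one = 1, ring.zero = 0, add = (+)\<rparr>"

definition vec :: "('k::field \<Rightarrow> 'v::ab_group_add \<Rightarrow> 'v) \<Rightarrow> ('b::finite \<Rightarrow> 'v) \<Rightarrow> 'v \<Rightarrow> ('b, 'k) tensors"
  where
  "vec scale e x =
     (\<Sum>b\<in>UNIV. Poly_Mapping.single [b] (module.representation scale (range e) x (e b)))"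

definition tens ::
  "('k::field \<Rightarrow> 'v::ab_group_add \<Rightarrow> 'v) \<Rightarrow> ('b::finite \<Rightarrow> 'v) \<Rightarrow> 'v list \<Rightarrow> ('b, 'k) tensors"
  where "tens scale e xs = prod_list (map (vec scale e) xs)"

text \<open>
  \<open>\<sigma> \<cdot> (x\<^sub>1 \<dots> x\<^sub>r) = x\<^bsub>\<sigma>\<inverse>(1)\<^esub> \<dots> x\<^bsub>\<sigma>\<inverse>(r)\<^esub>\<close> on words, extended linearly. Positions in lists are
  counted from \<open>0\<close>.
\<close>

definition ant :: "nat \<Rightarrow> ('b, 'k::field) tensors \<Rightarrow> ('b, 'k) tensors" where
  "ant r t = (\<Sum>\<sigma> | \<sigma> permutes {..<r}. tscale (of_int (sign \<sigma>))
     (\<Sum>w \<in> Poly_Mapping.keys t.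
        Poly_Mapping.single (permute_list (Hilbert_Choice.inv \<sigma>) w) (Poly_Mapping.lookup t w)))"

lemma ant_add:
  fixes s t :: "('b, 'k::field) tensors"
  shows "ant r (s + t) = ant r s + ant r t"
proof -
  have *: "(\<Sum>w \<in> Poly_Mapping.keys t. Poly_Mapping.single (g w) (Poly_Mapping.lookup t w))
      = (\<Sum>w \<in> A. Poly_Mapping.single (g w) (Poly_Mapping.lookup t w))"
    if "finite A" "Poly_Mapping.keys t \<subseteq> A" for A and t :: "('b, 'k) tensors" and g :: "'b list \<Rightarrow> 'b list"
    using that by (intro sum.mono_neutral_left) (auto simp: in_keys_iff)
  let ?A = "Poly_Mapping.keys s \<union> Poly_Mapping.keys t"
  have "Poly_Mapping.keys (s + t) \<subseteq> ?A" by (rule Poly_Mapping.keys_add)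
  then show ?thesis
    unfolding ant_def
    by (subst (1 2 3) *[of ?A])
      (auto simp: lookup_add single_add sum.distrib tensors.scale_right_distrib)
qed

lemma ant_0: "ant r 0 = 0"
  by (simp add: ant_def)

lemma ant_sum: "ant r (\<Sum>i\<in>I. f i) = (\<Sum>i\<in>I. ant r (f i))"
  by (induction I rule: infinite_finite_induct) (simp_all add: ant_add ant_0)

lemma ant_single:
  "ant r (Poly_Mapping.single w c) =
     (\<Sum>\<sigma> | \<sigma> permutes {..<r}.
        tscale (of_int (sign \<sigma>)) (Poly_Mapping.single (permute_list (Hilbert_Choice.inv \<sigma>) w) c))"
  by (cases "c = 0") (simp_all add: ant_def)

subsection \<open>Consistency with the abstract tensor powers of \<open>V\<close>\<close>

locale based_space = vector_space scale
  for scale :: "'k::field \<Rightarrow> 'v::ab_group_add \<Rightarrow> 'v" +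
  fixes e :: "'b::finite \<Rightarrow> 'v"
  assumes inj_basis: "inj e"
    and indep_basis: "independent (range e)"
    and span_basis: "span (range e) = UNIV"
begin

lemma vec_add: "vec scale e (x + y) = vec scale e x + vec scale e y"
  by (simp add: vec_def representation_add[OF indep_basis] span_basis single_add sum.distrib)

lemma vec_scale: "vec scale e (scale c x) = tscale c (vec scale e x)"
  by (simp add: vec_def representation_scale[OF indep_basis] span_basis tensors.scale_sum_right
      tscale_single)

lemma vec_basis: "vec scale e (e b) = Poly_Mapping.single [b] 1"
proof -
  have "vec scale e (e b) = (\<Sum>a\<in>UNIV. Poly_Mapping.single [a] (if a = b then 1 else 0))"
    unfolding vec_def
    by (intro sum.cong refl)
      (auto simp: representation_basis[OF indep_basis] inj_eq[OF inj_basis])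
  also have "\<dots> = (\<Sum>a\<in>UNIV. if a = b then Poly_Mapping.single [a] 1 else 0)"
    by (intro sum.cong) auto
  finally show ?thesis by simp
qed

lemma tens_basis: "tens scale e (map e w) = Poly_Mapping.single w 1"
  by (induction w) (simp_all add: tens_def vec_basis mult_single plus_list_def single_Nil)


lemma tens_expand:
  "tens scale e xs =
     (\<Sum>w | length w = length xs. Poly_Mapping.single w
        (\<Prod>i<length xs. representation (range e) (xs ! i) (e (w ! i))))"
proof (induction xs)
  case Nil
  show ?case by (simp add: tens_def single_Nil)
next
  case (Cons x xs)
  let ?c = "\<lambda>x b. representation (range e) x (e b)"
  let ?n = "length xs"
  have fin: "finite {w :: 'b list. length w = ?n}"
    using finite_lists_length_eq[of "UNIV :: 'b set"] by simp
  have eq: "{w :: 'b list. length w = length (x # xs)} =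
      (\<lambda>(b, w). b # w) ` (UNIV \<times> {w. length w = ?n})"
    by (auto simp: length_Suc_conv image_iff)
  have "tens scale e (x # xs) = vec scale e x * tens scale e xs"
    by (simp add: tens_def)
  also have "\<dots> = (\<Sum>b\<in>UNIV. \<Sum>w | length w = ?n. Poly_Mapping.single (b # w)
      (?c x b * (\<Prod>i<?n. ?c (xs ! i) (w ! i))))"
    unfolding Cons.IH vec_def sum_product by (simp add: mult_single plus_list_def)
  also have "\<dots> = (\<Sum>(b, w) \<in> UNIV \<times> {w. length w = ?n}. Poly_Mapping.single (b # w)
      (\<Prod>i<Suc ?n. ?c ((x # xs) ! i) ((b # w) ! i)))"
    by (simp add: sum.cartesian_product prod.lessThan_Suc_shift del: prod.lessThan_Suc)
  also have "\<dots> = (\<Sum>w | length w = length (x # xs). Poly_Mapping.single w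
      (\<Prod>i<length (x # xs). ?c ((x # xs) ! i) (w ! i)))"
    unfolding eq by (subst sum.reindex) (auto simp: inj_on_def case_prod_unfold)
  finally show ?case .
qed

lemma tpow_eq_span: "tpow r = tensors.span {tens scale e xs | xs. length xs = r}"
proof (intro equalityI subsetI)
  fix t :: "('b, 'k) tensors"
  assume t: "t \<in> tpow r"
  have "t = (\<Sum>w\<in>Poly_Mapping.keys t. Poly_Mapping.single w (Poly_Mapping.lookup t w))"
    by (rule poly_mapping_eqI)
      (simp add: lookup_sum lookup_single when_def in_keys_iff)
  also have "\<dots> = (\<Sum>w\<in>Poly_Mapping.keys t. tscale (Poly_Mapping.lookup t w) (tens scale e (map e w)))"
    by (simp add: tens_basis tscale_single)
  also have "\<dots> \<in> tensors.span {tens scale e xs | xs. length xs = r}"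
    using t by (intro tensors.span_sum tensors.span_scale tensors.span_base) (auto simp: tpow_def)
  finally show "t \<in> tensors.span {tens scale e xs | xs. length xs = r}" .
next
  fix t :: "('b, 'k) tensors"
  assume "t \<in> tensors.span {tens scale e xs | xs. length xs = r}"
  then show "t \<in> tpow r"
  proof (induction rule: tensors.span_induct_alt)
    case base
    show ?case by (simp add: tpow_def)
  next
    case (step c s t)
    then obtain xs where xs: "s = tens scale e xs" "length xs = r" by auto
    have "Poly_Mapping.keys (tscale c s) \<subseteq> {w. length w = r}"
    proof -
      have "Poly_Mapping.keys (tscale c s) \<subseteq> (\<Union>w\<in>{w :: 'b list. length w = r}. {w})"
        unfolding xs(1) tens_expand tensors.scale_sum_right tscale_single xs(2)
        by (rule order_trans[OF keys_sum]) (auto split: if_splits)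
      then show ?thesis by auto
    qed
    then show ?case
      using step Poly_Mapping.keys_add[of "tscale c s" t] by (auto simp: tpow_def)
  qed
qed

lemma ant_tens:
  assumes "length xs = r"
  shows "ant r (tens scale e xs) =
    (\<Sum>\<sigma> | \<sigma> permutes {..<r}.
       tscale (of_int (sign \<sigma>)) (tens scale e (permute_list (Hilbert_Choice.inv \<sigma>) xs)))"
proof -
  let ?c = "\<lambda>x b. representation (range e) x (e b)"
  let ?L = "{w :: 'b list. length w = r}"
  have fin: "finite ?L"
    using finite_lists_length_eq[of "UNIV :: 'b set"] by simp
  have perm: "(\<Sum>w\<in>?L. Poly_Mapping.single (permute_list (Hilbert_Choice.inv \<sigma>) w) (\<Prod>i<r. ?c (xs ! i) (w ! i)))
      = tens scale e (permute_list (Hilbert_Choice.inv \<sigma>) xs)" if \<sigma>: "\<sigma> permutes {..<r}" for \<sigma>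
  proof -
    have i\<sigma>: "Hilbert_Choice.inv \<sigma> permutes {..<r}" using permutes_inv[OF \<sigma>] .
    have "(\<Sum>w\<in>?L. Poly_Mapping.single (permute_list (Hilbert_Choice.inv \<sigma>) w) (\<Prod>i<r. ?c (xs ! i) (w ! i)))
      = (\<Sum>w\<in>?L. Poly_Mapping.single w (\<Prod>i<r. ?c (permute_list (Hilbert_Choice.inv \<sigma>) xs ! i) (w ! i)))"
    proof (rule sum.reindex_bij_witness[where i = "permute_list \<sigma>" and j = "permute_list (Hilbert_Choice.inv \<sigma>)"])
      fix w assume w: "w \<in> ?L"
      show "permute_list \<sigma> (permute_list (Hilbert_Choice.inv \<sigma>) w) = w"
        using w \<sigma> i\<sigma> permute_list_compose[of \<sigma> w "Hilbert_Choice.inv \<sigma>"]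
        by (simp add: permutes_inv_o permute_list_compose[symmetric])
      show "permute_list (Hilbert_Choice.inv \<sigma>) (permute_list \<sigma> w) = w"
        using w \<sigma> i\<sigma> by (simp add: permutes_inv_o permute_list_compose[symmetric])
      have "(\<Prod>i<r. ?c (permute_list (Hilbert_Choice.inv \<sigma>) xs ! i) (permute_list (Hilbert_Choice.inv \<sigma>) w ! i))
          = (\<Prod>i<r. ?c (xs ! (Hilbert_Choice.inv \<sigma> i)) (w ! (Hilbert_Choice.inv \<sigma> i)))"
        using w assms i\<sigma> by (intro prod.cong) (simp_all add: permute_list_nth)
      also have "\<dots> = (\<Prod>i<r. ?c (xs ! i) (w ! i))"
        using prod.permute[OF i\<sigma>, of "\<lambda>i. ?c (xs ! i) (w ! i)"] by (simp add: o_def)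
      finally show "Poly_Mapping.single (permute_list (Hilbert_Choice.inv \<sigma>) w)
            (\<Prod>i<r. ?c (permute_list (Hilbert_Choice.inv \<sigma>) xs ! i) (permute_list (Hilbert_Choice.inv \<sigma>) w ! i)) =
          Poly_Mapping.single (permute_list (Hilbert_Choice.inv \<sigma>) w) (\<Prod>i<r. ?c (xs ! i) (w ! i))"
        by simp
    qed auto
    also have "\<dots> = tens scale e (permute_list (Hilbert_Choice.inv \<sigma>) xs)"
      using assms by (simp add: tens_expand)
    finally show ?thesis .
  qed
  have "ant r (tens scale e xs) =
    (\<Sum>\<sigma> | \<sigma> permutes {..<r}. tscale (of_int (sign \<sigma>))
      (\<Sum>w\<in>?L. Poly_Mapping.single (permute_list (Hilbert_Choice.inv \<sigma>) w) (\<Prod>i<r. ?c (xs ! i) (w ! i))))"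
    by (simp add: tens_expand assms ant_sum ant_single tensors.scale_sum_right sum.swap[of _ _ ?L])
  also have "\<dots> = (\<Sum>\<sigma> | \<sigma> permutes {..<r}.
       tscale (of_int (sign \<sigma>)) (tens scale e (permute_list (Hilbert_Choice.inv \<sigma>) xs)))"
    by (intro sum.cong refl) (simp add: perm)
  finally show ?thesis .
qed

end


section \<open>The \<open>N\<close>-symmetric algebra\<close>

definition rel_space :: "nat \<Rightarrow> ('b, 'k::field) tensors set" where
  "rel_space N = ant N ` tpow N"

definition sym_ideal :: "nat \<Rightarrow> ('b, 'k::field) tensors set" where
  "sym_ideal N = genideal tensor_algebra (rel_space N)"

definition sym_algebra :: "nat \<Rightarrow> ('b, 'k::field) tensors set ring" where
  "sym_algebra N = tensor_algebra Quot sym_ideal N"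

definition sym_class :: "nat \<Rightarrow> ('b, 'k::field) tensors \<Rightarrow> ('b, 'k) tensors set" where
  "sym_class N t = sym_ideal N +>\<^bsub>tensor_algebra\<^esub> t"

definition W :: "nat \<Rightarrow> nat \<Rightarrow> ('b, 'k::field) tensors set" where
  "W N r = {t \<in> tpow r. \<forall>i j. i + N + j = r \<longrightarrow>
     t \<in> tensors.span {a * \<rho> * b | a \<rho> b. a \<in> tpow i \<and> \<rho> \<in> rel_space N \<and> b \<in> tpow j}}"

definition nu :: "nat \<Rightarrow> nat \<Rightarrow> nat" where
  "nu N p = N * (p div 2) + p mod 2"


section \<open>Modules and bimodules\<close>

text \<open>
  As everywhere in \<open>HOL-Algebra\<close>, the record type of modules extends that of rings; the fields
  \<open>mult\<close> and \<open>one\<close> of a module are irrelevant.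
\<close>

definition tensor_submodule :: "('b, 'k::field) tensors set \<Rightarrow> ('k, ('b, 'k) tensors) module" where
  "tensor_submodule C =
     \<lparr>carrier = C, monoid.mult = (*), one = 1, ring.zero = 0, add = (+), smult = tscale\<rparr>"

definition klinear :: "('k, 'x, 'c) module_scheme \<Rightarrow> ('k, 'y, 'd) module_scheme \<Rightarrow> ('x \<Rightarrow> 'y) \<Rightarrow> bool"
  where
  "klinear X Y f \<longleftrightarrow> f \<in> carrier X \<rightarrow> carrier Y \<and>
     (\<forall>x\<in>carrier X. \<forall>y\<in>carrier X. f (x \<oplus>\<^bsub>X\<^esub> y) = f x \<oplus>\<^bsub>Y\<^esub> f y) \<and>
     (\<forall>c. \<forall>x\<in>carrier X. f (c \<odot>\<^bsub>X\<^esub> x) = c \<odot>\<^bsub>Y\<^esub> f x)"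

record ('a, 'm) bimodule = "('a, 'm) module" +
  rsmult :: "['m, 'a] \<Rightarrow> 'm"

locale bimodule = A?: ring A + M?: abelian_group M
  for A :: "('a, 'c) ring_scheme" (structure) and M :: "('a, 'm, 'd) bimodule_scheme" (structure) +
  assumes l_closed: "\<lbrakk>a \<in> carrier A; x \<in> carrier M\<rbrakk> \<Longrightarrow> a \<odot>\<^bsub>M\<^esub> x \<in> carrier M"
    and l_distrib_scalar: "\<lbrakk>a \<in> carrier A; b \<in> carrier A; x \<in> carrier M\<rbrakk> \<Longrightarrow>
      (a \<oplus> b) \<odot>\<^bsub>M\<^esub> x = a \<odot>\<^bsub>M\<^esub> x \<oplus>\<^bsub>M\<^esub> b \<odot>\<^bsub>M\<^esub> x"
    and l_distrib: "\<lbrakk>a \<in> carrier A; x \<in> carrier M; y \<in> carrier M\<rbrakk> \<Longrightarrow>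
      a \<odot>\<^bsub>M\<^esub> (x \<oplus>\<^bsub>M\<^esub> y) = a \<odot>\<^bsub>M\<^esub> x \<oplus>\<^bsub>M\<^esub> a \<odot>\<^bsub>M\<^esub> y"
    and l_assoc: "\<lbrakk>a \<in> carrier A; b \<in> carrier A; x \<in> carrier M\<rbrakk> \<Longrightarrow>
      (a \<otimes> b) \<odot>\<^bsub>M\<^esub> x = a \<odot>\<^bsub>M\<^esub> (b \<odot>\<^bsub>M\<^esub> x)"
    and l_one: "x \<in> carrier M \<Longrightarrow> \<one> \<odot>\<^bsub>M\<^esub> x = x"
    and r_closed: "\<lbrakk>a \<in> carrier A; x \<in> carrier M\<rbrakk> \<Longrightarrow> rsmult M x a \<in> carrier M"
    and r_distrib_scalar: "\<lbrakk>a \<in> carrier A; b \<in> carrier A; x \<in> carrier M\<rbrakk> \<Longrightarrow>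
      rsmult M x (a \<oplus> b) = rsmult M x a \<oplus>\<^bsub>M\<^esub> rsmult M x b"
    and r_distrib: "\<lbrakk>a \<in> carrier A; x \<in> carrier M; y \<in> carrier M\<rbrakk> \<Longrightarrow>
      rsmult M (x \<oplus>\<^bsub>M\<^esub> y) a = rsmult M x a \<oplus>\<^bsub>M\<^esub> rsmult M y a"
    and r_assoc: "\<lbrakk>a \<in> carrier A; b \<in> carrier A; x \<in> carrier M\<rbrakk> \<Longrightarrow>
      rsmult M x (a \<otimes> b) = rsmult M (rsmult M x a) b"
    and r_one: "x \<in> carrier M \<Longrightarrow> rsmult M x \<one> = x"
    and lr_assoc: "\<lbrakk>a \<in> carrier A; b \<in> carrier A; x \<in> carrier M\<rbrakk> \<Longrightarrow>
      rsmult M (a \<odot>\<^bsub>M\<^esub> x) b = a \<odot>\<^bsub>M\<^esub> rsmult M x b"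

text \<open>Bimodules over the \<open>k\<close>-algebra \<open>S(V,N)\<close>: the field \<open>k\<close> acts in the same way on both sides.\<close>

definition sym_bimodule ::
  "nat \<Rightarrow> (('b, 'k::field) tensors set, 'm, 'd) bimodule_scheme \<Rightarrow> bool" where
  "sym_bimodule N M \<longleftrightarrow> bimodule (sym_algebra N :: ('b, 'k) tensors set ring) M \<and>
     (\<forall>c. \<forall>x\<in>carrier M. sym_class N (scalar c) \<odot>\<^bsub>M\<^esub> x = rsmult M x (sym_class N (scalar c)))"

text \<open>Left and right action of (the class of) a tensor, and the underlying \<open>k\<close>-vector space.\<close>

definition lact :: "nat \<Rightarrow> (('b, 'k::field) tensors set, 'm, 'd) bimodule_scheme
    \<Rightarrow> ('b, 'k) tensors \<Rightarrow> 'm \<Rightarrow> 'm" where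
  "lact N M t x = sym_class N t \<odot>\<^bsub>M\<^esub> x"

definition ract :: "nat \<Rightarrow> (('b, 'k::field) tensors set, 'm, 'd) bimodule_scheme
    \<Rightarrow> 'm \<Rightarrow> ('b, 'k) tensors \<Rightarrow> 'm" where
  "ract N M x t = rsmult M x (sym_class N t)"

definition kspace :: "nat \<Rightarrow> (('b, 'k::field) tensors set, 'm, 'd) bimodule_scheme \<Rightarrow> ('k, 'm) module"
  where
  "kspace N M = \<lparr>carrier = carrier M, monoid.mult = monoid.mult M, one = one M,
     ring.zero = ring.zero M, add = add M, smult = (\<lambda>c. lact N M (scalar c))\<rparr>"


section \<open>Tensor products\<close>

text \<open>
  The tensor product of a right module \<open>X\<close> and a left module \<open>Y\<close> over scalars \<open>S\<close>: the free abelian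
  group on pairs modulo biadditivity and balancedness. \<open>sc\<close> is the action of \<open>k\<close> on \<open>X\<close>.
\<close>

type_synonym ('x, 'y) tprod = "('x \<times> 'y \<Rightarrow>\<^sub>0 int) set"

definition tprod_relations :: "'s set \<Rightarrow> ('x, 'c) ring_scheme \<Rightarrow> ('x \<Rightarrow> 's \<Rightarrow> 'x)
    \<Rightarrow> ('y, 'd) ring_scheme \<Rightarrow> ('s \<Rightarrow> 'y \<Rightarrow> 'y) \<Rightarrow> ('x \<times> 'y \<Rightarrow>\<^sub>0 int) set" where
  "tprod_relations S X r Y l = generate (free_Abelian_group (carrier X \<times> carrier Y))
     ({frag_of (x \<oplus>\<^bsub>X\<^esub> x', y) - frag_of (x, y) - frag_of (x', y) | x x' y.
         x \<in> carrier X \<and> x' \<in> carrier X \<and> y \<in> carrier Y} \<union>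
      {frag_of (x, y \<oplus>\<^bsub>Y\<^esub> y') - frag_of (x, y) - frag_of (x, y') | x y y'.
         x \<in> carrier X \<and> y \<in> carrier Y \<and> y' \<in> carrier Y} \<union>
      {frag_of (r x s, y) - frag_of (x, l s y) | x s y.
         x \<in> carrier X \<and> s \<in> S \<and> y \<in> carrier Y})"

definition pure_tensor :: "'s set \<Rightarrow> ('x, 'c) ring_scheme \<Rightarrow> ('x \<Rightarrow> 's \<Rightarrow> 'x)
    \<Rightarrow> ('y, 'd) ring_scheme \<Rightarrow> ('s \<Rightarrow> 'y \<Rightarrow> 'y) \<Rightarrow> 'x \<Rightarrow> 'y \<Rightarrow> ('x, 'y) tprod" where
  "pure_tensor S X r Y l x y =
     tprod_relations S X r Y l #>\<^bsub>free_Abelian_group (carrier X \<times> carrier Y)\<^esub> frag_of (x, y)"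

definition tprod :: "'s set \<Rightarrow> ('x, 'c) ring_scheme \<Rightarrow> ('x \<Rightarrow> 's \<Rightarrow> 'x)
    \<Rightarrow> ('y, 'd) ring_scheme \<Rightarrow> ('s \<Rightarrow> 'y \<Rightarrow> 'y) \<Rightarrow> ('k \<Rightarrow> 'x \<Rightarrow> 'x) \<Rightarrow> ('k, ('x, 'y) tprod) module" where
  "tprod S X r Y l sc =
     (let F = free_Abelian_group (carrier X \<times> carrier Y);
          H = tprod_relations S X r Y l;
          Q = F Mod H
      in \<lparr>carrier = carrier Q, monoid.mult = undefined, one = undefined,
          ring.zero = \<one>\<^bsub>Q\<^esub>, add = monoid.mult Q,
          smult = (\<lambda>c U. \<Union>u\<in>U. H #>\<^bsub>F\<^esub> frag_extend (\<lambda>(x, y). frag_of (sc c x, y)) u)\<rparr>)"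

text \<open>Tensor product \<open>M \<otimes>\<^sub>A P\<close> over \<open>A = S(V,N)\<close>, as a \<open>k\<close>-vector space.\<close>

definition tensor_A :: "nat \<Rightarrow> (('b, 'k::field) tensors set, 'm, 'c) bimodule_scheme
    \<Rightarrow> (('b, 'k) tensors set, 'p, 'd) bimodule_scheme \<Rightarrow> ('k, ('m, 'p) tprod) module" where
  "tensor_A N M P = tprod (carrier (sym_algebra N)) M (rsmult M) P (smult P)
     (\<lambda>c. lact N M (scalar c))"

definition pure_A :: "nat \<Rightarrow> (('b, 'k::field) tensors set, 'm, 'c) bimodule_scheme
    \<Rightarrow> (('b, 'k) tensors set, 'p, 'd) bimodule_scheme \<Rightarrow> 'm \<Rightarrow> 'p \<Rightarrow> ('m, 'p) tprod" where
  "pure_A N M P = pure_tensor (carrier (sym_algebra N)) M (rsmult M) P (smult P)"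

text \<open>Tensor product of \<open>k\<close>-vector spaces.\<close>

definition tensor_k :: "('k, 'x, 'c) module_scheme \<Rightarrow> ('k, 'y, 'd) module_scheme
    \<Rightarrow> ('k, ('x, 'y) tprod) module" where
  "tensor_k X Y = tprod UNIV X (\<lambda>x c. c \<odot>\<^bsub>X\<^esub> x) Y (smult Y) (smult X)"

definition pure_k :: "('k, 'x, 'c) module_scheme \<Rightarrow> ('k, 'y, 'd) module_scheme
    \<Rightarrow> 'x \<Rightarrow> 'y \<Rightarrow> ('x, 'y) tprod" where
  "pure_k X Y = pure_tensor UNIV X (\<lambda>x c. c \<odot>\<^bsub>X\<^esub> x) Y (smult Y)"

text \<open>Value on \<open>z\<close> of the linear map on \<open>X \<otimes>\<^sub>k Y\<close> induced by a \<open>k\<close>-bilinear map \<open>g\<close> into \<open>G\<close>.\<close>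

definition tensor_k_lift :: "('k, 'x, 'c) module_scheme \<Rightarrow> ('k, 'y, 'd) module_scheme
    \<Rightarrow> ('k, 'g, 'h) module_scheme \<Rightarrow> ('x \<Rightarrow> 'y \<Rightarrow> 'g) \<Rightarrow> ('x, 'y) tprod \<Rightarrow> 'g" where
  "tensor_k_lift X Y G g z = (THE v. \<exists>n xs ys.
     (\<forall>s<(n::nat). xs s \<in> carrier X \<and> ys s \<in> carrier Y) \<and>
     z = (\<Oplus>\<^bsub>tensor_k X Y\<^esub>s\<in>{..<n}. pure_k X Y (xs s) (ys s)) \<and>
     v = (\<Oplus>\<^bsub>G\<^esub>s\<in>{..<n}. g (xs s) (ys s)))"


section \<open>Exterior powers\<close>

definition ext_ideal :: "('b, 'k::field) tensors set" where
  "ext_ideal = genideal tensor_algebra {v * v | v. v \<in> tpow 1}"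

definition ext_class :: "('b, 'k::field) tensors \<Rightarrow> ('b, 'k) tensors set" where
  "ext_class t = ext_ideal +>\<^bsub>tensor_algebra\<^esub> t"

definition ext_power :: "nat \<Rightarrow> ('k::field, ('b, 'k) tensors set) module" where
  "ext_power r = (let E = tensor_algebra Quot ext_ideal in
     \<lparr>carrier = ext_class ` tpow r, monoid.mult = monoid.mult E, one = one E,
      ring.zero = ring.zero E, add = add E, smult = (\<lambda>c \<omega>. ext_class (scalar c) \<otimes>\<^bsub>E\<^esub> \<omega>)\<rparr>)"

definition wedge :: "('k::field \<Rightarrow> 'v::ab_group_add \<Rightarrow> 'v) \<Rightarrow> ('b::finite \<Rightarrow> 'v) \<Rightarrow> 'v list
    \<Rightarrow> ('b, 'k) tensors set" where
  "wedge scale e xs = ext_class (tens scale e xs)"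

text \<open>
  \<open>\<phi>\<^sub>r\<close> is linear and given by \<open>e b1 \<and> \<dots> \<and> e br \<mapsto> ant r (e b1 \<dots> e br)\<close> for \<open>b1 < \<dots> < br\<close>: here \<open>t\<close>
  ranges over the linear combinations of the increasing words.
\<close>

definition phi :: "nat \<Rightarrow> ('b::linorder, 'k::field) tensors set \<Rightarrow> ('b, 'k) tensors" where
  "phi r \<omega> = (THE u. \<exists>t \<in> tpow r. (\<forall>w \<in> Poly_Mapping.keys t. sorted_wrt (<) w) \<and>
     \<omega> = ext_class t \<and> u = ant r t)"


section \<open>The right Koszul cap product\<close>

definition W_module :: "nat \<Rightarrow> nat \<Rightarrow> ('k::field, ('b, 'k) tensors) module" where
  "W_module N r = tensor_submodule (W N r)"

text \<open>
  The \<open>(i,j)\<close> term of the cap product of \<open>m \<otimes> u\<close>, \<open>u \<in> W\<^bsub>\<nu>(q)\<^esub>\<close>: \<open>u\<close> is written as a sum of products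
  \<open>a w b w' c\<close> in \<open>V\<^sup>\<otimes>\<^sup>i \<otimes> W\<^bsub>\<nu>(p)\<^esub> \<otimes> V\<^sup>\<otimes>\<^sup>l \<otimes> W\<^bsub>\<nu>(q-p)\<^esub> \<otimes> V\<^sup>\<otimes>\<^sup>j\<close>, and such a product contributes
  \<open>(c m a \<otimes>\<^sub>A f(w) b) \<otimes> w'\<close>.
\<close>

definition cap_term :: "nat \<Rightarrow> (('b, 'k::field) tensors set, 'm, 'c) bimodule_scheme
    \<Rightarrow> (('b, 'k) tensors set, 'p, 'd) bimodule_scheme \<Rightarrow> nat \<Rightarrow> nat \<Rightarrow> (('b, 'k) tensors \<Rightarrow> 'p)
    \<Rightarrow> nat \<Rightarrow> nat \<Rightarrow> nat \<Rightarrow> 'm \<Rightarrow> ('b, 'k) tensors \<Rightarrow> (('m, 'p) tprod, ('b, 'k) tensors) tprod" where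
  "cap_term N M P p q f i l j m u = (THE v. \<exists>n a w b w' c.
     (\<forall>s<(n::nat). a s \<in> tpow i \<and> w s \<in> W N (nu N p) \<and> b s \<in> tpow l \<and>
        w' s \<in> W N (nu N (q - p)) \<and> c s \<in> tpow j) \<and>
     u = (\<Sum>s<n. a s * w s * b s * w' s * c s) \<and>
     v = (\<Oplus>\<^bsub>tensor_k (tensor_A N M P) (W_module N (nu N (q - p)))\<^esub>s\<in>{..<n}.
            pure_k (tensor_A N M P) (W_module N (nu N (q - p)))
              (pure_A N M P (ract N M (lact N M (c s) m) (a s)) (ract N P (f (w s)) (b s)))
              (w' s)))"

text \<open>For \<open>p \<le> q\<close>, both \<open>p\<close> and \<open>q - p\<close> are odd iff \<open>p\<close> is odd and \<open>q\<close> is even.\<close>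

definition koszul_cap :: "nat \<Rightarrow> (('b, 'k::field) tensors set, 'm, 'c) bimodule_scheme
    \<Rightarrow> (('b, 'k) tensors set, 'p, 'd) bimodule_scheme \<Rightarrow> nat \<Rightarrow> nat
    \<Rightarrow> ('m, ('b, 'k) tensors) tprod \<Rightarrow> (('b, 'k) tensors \<Rightarrow> 'p)
    \<Rightarrow> (('m, 'p) tprod, ('b, 'k) tensors) tprod" where
  "koszul_cap N M P p q z f =
     (let G = tensor_k (tensor_A N M P) (W_module N (nu N (q - p)))
      in tensor_k_lift (kspace N M) (W_module N (nu N q)) G
           (\<lambda>m u. if odd p \<and> odd (q - p)
              then finsum G (\<lambda>(i, j). cap_term N M P p q f i (N - 2 - (i + j)) j m u)
                     {(i, j). i + j \<le> N - 2}
              else ((- 1) ^ (p * q)) \<odot>\<^bsub>G\<^esub> cap_term N M P p q f 0 0 0 m u)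
           z)"

text \<open>
  Translation to exterior powers. \<open>id_phi N X r\<close> is \<open>id \<otimes> \<phi>\<^sub>r : X \<otimes> \<And>\<^sup>rV \<rightarrow> X \<otimes> W\<^sub>r\<close>; a linear map on
  \<open>\<And>\<^bsup>\<nu>(p)\<^esup>V\<close> is turned into a Koszul cochain by composing with the inverse of \<open>\<phi>\<close>, and the result is
  transported back along the inverse of \<open>id \<otimes> \<phi>\<close>.
\<close>

definition id_phi :: "nat \<Rightarrow> ('k::field, 'x) module \<Rightarrow> nat
    \<Rightarrow> ('x, ('b::linorder, 'k) tensors set) tprod \<Rightarrow> ('x, ('b, 'k) tensors) tprod" where
  "id_phi N X r = tensor_k_lift X (ext_power r) (tensor_k X (W_module N r))
     (\<lambda>x \<omega>. pure_k X (W_module N r) x (phi r \<omega>))"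

definition ext_cap :: "nat \<Rightarrow> (('b::linorder, 'k::field) tensors set, 'm, 'c) bimodule_scheme
    \<Rightarrow> (('b, 'k) tensors set, 'p, 'd) bimodule_scheme \<Rightarrow> nat \<Rightarrow> nat
    \<Rightarrow> ('m, ('b, 'k) tensors set) tprod \<Rightarrow> (('b, 'k) tensors set \<Rightarrow> 'p)
    \<Rightarrow> (('m, 'p) tprod, ('b, 'k) tensors set) tprod" where
  "ext_cap N M P p q z f =
     inv_into (carrier (tensor_k (tensor_A N M P) (ext_power (nu N (q - p)))))
       (id_phi N (tensor_A N M P) (nu N (q - p)))
       (koszul_cap N M P p q (id_phi N (kspace N M) (nu N q) z)
          (f \<circ> inv_into (carrier (ext_power (nu N p))) (phi (nu N p))))"


section \<open>Shuffles\<close>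

definition Sh :: "nat \<Rightarrow> nat \<Rightarrow> nat \<Rightarrow> nat \<Rightarrow> nat \<Rightarrow> (nat \<Rightarrow> nat) set" where
  "Sh N p q i j = {\<sigma>. \<sigma> permutes {1..nu N q} \<and>
     strict_mono_on {i + 1..i + nu N p} \<sigma> \<and>
     strict_mono_on {nu N p + N - j - 1..nu N q - j} \<sigma>}"

text \<open>The list \<open>x\<^bsub>\<sigma>(a)\<^esub>, \<dots>, x\<^bsub>\<sigma>(b)\<^esub>\<close>, empty if \<open>b < a\<close>.\<close>

definition block :: "(nat \<Rightarrow> 'v) \<Rightarrow> (nat \<Rightarrow> nat) \<Rightarrow> nat \<Rightarrow> nat \<Rightarrow> 'v list" where
  "block x \<sigma> a b = map (\<lambda>s. x (\<sigma> s)) [a..<Suc b]"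

end

theory Submission
  imports Defs
begin

text \<open>
  A tensor is a linear combination of words in the basis. A word-coefficient function is called
  alternating if it changes sign when adjacent letters are exchanged and vanishes when adjacent letters
  agree. For \<open>r = \<nu>(p)\<close>, the space \<open>W\<^sub>r\<close> consists of the alternating tensors of degree \<open>r\<close>
  (\<open>alternating_imp_W\<close>, \<open>W_imp_alternating\<close>), and an alternating tensor is determined by its coefficients at
  strictly increasing words: \<open>increasing_part\<close> inverts the antisymmetrizer (\<open>alternating_eq_ant\<close>,
  \<open>increasing_part_ant\<close>). So \<open>\<phi>\<^sub>r\<close> is the isomorphism induced by \<open>ant r\<close>, with inverse induced by
  \<open>increasing_part\<close> (\<open>phi_ext_class\<close>, \<open>inv_into_phi\<close>).

  The \<open>(i,j)\<close> term of the cap product applies \<open>f\<close> to one block of an alternating tensor and keeps another one.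
  It is computed from a splitting of the tensor into products \<open>a w b w' c\<close> with \<open>w\<close>, \<open>w'\<close> alternating.
  Splittings exist (\<open>split_two_blocks\<close>) but are not unique. To see that the result does not depend on the
  splitting, \<open>f\<close> and the identity of \<open>W\<close> are extended from alternating tensors to all tensors, by first discarding
  the words that are not increasing. The resulting linear map \<open>cap_map\<close> on the full tensor power takes the prescribed value
  on every product \<open>a w b w' c\<close> (\<open>cap_map_product\<close>, \<open>cap_term_eq_cap_map\<close>).

  The same extension yields the formula. The chain \<open>x\<^sub>1 \<and> \<dots> \<and> x\<^sub>n\<close> corresponds to the sum of the words
  \<open>x\<^bsub>\<sigma>(1)\<^esub> \<dots> x\<^bsub>\<sigma>(n)\<^esub>\<close> with signs over all permutations, and \<open>cap_map\<close> vanishes on such a word unless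
  its second and fourth blocks are increasing. As the \<open>x\<^sub>s\<close> are increasing, the surviving permutations are the
  elements of \<open>Sh\<close> (\<open>cap_map_ant\<close>). It remains to carry the result back through \<open>id \<otimes> \<phi>\<close>, which is
  injective because \<open>\<phi>\<close> has a linear inverse (\<open>inj_on_id_phi\<close>). All maps out of tensor products are handled by
  the universal property (\<open>tensor_k_lift_hom\<close>).
\<close>

section \<open>Tensors as linear combinations of words\<close>

abbreviation coef :: "('b, 'k::field) tensors \<Rightarrow> 'b list \<Rightarrow> 'k" where
  "coef \<equiv> Poly_Mapping.lookup"

abbreviation wmon :: "'b list \<Rightarrow> 'k::field \<Rightarrow> ('b, 'k) tensors" where
  "wmon \<equiv> Poly_Mapping.single"

lemma finite_words [simp]: "finite {w :: 'b::finite list. length w = r}"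
  using finite_lists_length_eq[of "UNIV :: 'b set"] by simp

lemma finite_words_Collect [simp]: "finite {w :: 'b::finite list. length w = r \<and> Q w}"
  by (rule finite_subset[OF _ finite_words[of r]]) auto

lemma mon_mult: "wmon w c * wmon v d = wmon (w @ v) (c * d)"
  by (simp add: mult_single plus_list_def)

lemma sum_mon: "(\<Sum>w\<in>Poly_Mapping.keys t. wmon w (coef t w)) = t"
  by (rule poly_mapping_eqI) (simp add: lookup_sum lookup_single when_def in_keys_iff)

lemma coef_tscale:
  fixes t :: "('b, 'k::field) tensors"
  shows "coef (tscale c t) w = c * coef t w"
proof -
  have "coef (wmon [] c * wmon v d) w = c * coef (wmon v d) w" for v :: "'b list" and d :: 'k
    by (simp add: mon_mult lookup_single when_def)
  then have "coef (wmon [] c * (\<Sum>v\<in>Poly_Mapping.keys t. wmon v (coef t v))) w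
      = c * coef (\<Sum>v\<in>Poly_Mapping.keys t. wmon v (coef t v)) w"
    unfolding sum_distrib_left lookup_sum by simp
  then show ?thesis
    by (simp add: tscale_def scalar_def sum_mon)
qed

lemma tpow_iff_coef: "t \<in> tpow r \<longleftrightarrow> (\<forall>w. length w \<noteq> r \<longrightarrow> coef t w = 0)"
  by (auto simp: tpow_def in_keys_iff)

lemma coef_outside: "t \<in> tpow r \<Longrightarrow> length w \<noteq> r \<Longrightarrow> coef t w = 0"
  by (simp add: tpow_iff_coef)

lemma tpow_0 [simp]: "0 \<in> tpow r"
  by (simp add: tpow_iff_coef)

lemma tpow_add: "s \<in> tpow r \<Longrightarrow> t \<in> tpow r \<Longrightarrow> s + t \<in> tpow r"
  by (simp add: tpow_iff_coef lookup_add)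

lemma tpow_minus: "t \<in> tpow r \<Longrightarrow> - t \<in> tpow r"
  by (simp add: tpow_iff_coef)

lemma tpow_sum: "(\<And>i. i \<in> I \<Longrightarrow> t i \<in> tpow r) \<Longrightarrow> sum t I \<in> tpow r"
  by (induction I rule: infinite_finite_induct) (simp_all add: tpow_add)

lemma tpow_tscale: "t \<in> tpow r \<Longrightarrow> tscale c t \<in> tpow r"
  by (simp add: tpow_iff_coef coef_tscale)

lemma tpow_mon: "length w = r \<Longrightarrow> wmon w c \<in> tpow r"
  by (auto simp: tpow_iff_coef lookup_single when_def)

lemma tpow_expand:
  fixes t :: "('b::finite, 'k::field) tensors"
  assumes "t \<in> tpow r"
  shows "t = (\<Sum>w | length w = r. wmon w (coef t w))"
proof (rule poly_mapping_eqI)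
  fix v
  show "coef t v = coef (\<Sum>w | length w = r. wmon w (coef t w)) v"
    using coef_outside[OF assms] by (simp add: lookup_sum lookup_single when_def)
qed

lemma tpow_induct [consumes 1, case_names zero add wmon]:
  fixes t :: "('b::finite, 'k::field) tensors"
  assumes t: "t \<in> tpow r"
    and "Q 0"
    and "\<And>s t. s \<in> tpow r \<Longrightarrow> t \<in> tpow r \<Longrightarrow> Q s \<Longrightarrow> Q t \<Longrightarrow> Q (s + t)"
    and "\<And>w c. length w = r \<Longrightarrow> Q (wmon w c)"
  shows "Q t"
proof -
  have "(\<Sum>w\<in>X. wmon w (coef t w)) \<in> tpow r \<and> Q (\<Sum>w\<in>X. wmon w (coef t w))"
    if "finite X" "X \<subseteq> {w. length w = r}" for X
    using that
    by (induction X rule: finite_induct) (simp_all add: assms tpow_add tpow_mon)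
  then show ?thesis
    using tpow_expand[OF t] by (metis finite_words subset_refl)
qed

lemma tpow_mult:
  fixes s t :: "('b::finite, 'k::field) tensors"
  assumes "s \<in> tpow i" "t \<in> tpow j"
  shows "s * t \<in> tpow (i + j)"
  using assms(1)
proof (induction s rule: tpow_induct)
  case (wmon w c)
  from assms(2) show ?case
    by (induction t rule: tpow_induct)
      (use wmon in \<open>simp_all add: distrib_left tpow_add mon_mult tpow_mon\<close>)
qed (simp_all add: distrib_right tpow_add)

lemma coef_mult:
  fixes s t :: "('b::finite, 'k::field) tensors"
  assumes "s \<in> tpow (length w)"
  shows "coef (s * t) (w @ v) = coef s w * coef t v"
  using assms
proof (induction s rule: tpow_induct)
  case (wmon w' c)
  have "coef (wmon w' c * wmon v' d) (w @ v) = coef (wmon w' c) w * coef (wmon v' d) v" for v' d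
    using wmon by (auto simp: mon_mult lookup_single when_def)
  then have "coef (wmon w' c * (\<Sum>v\<in>Poly_Mapping.keys t. wmon v (coef t v))) (w @ v)
      = coef (wmon w' c) w * coef (\<Sum>v\<in>Poly_Mapping.keys t. wmon v (coef t v)) v"
    unfolding sum_distrib_left lookup_sum by simp
  then show ?case
    by (simp add: sum_mon)
qed (simp_all add: distrib_right lookup_add)


section \<open>Alternating functions of words\<close>

text \<open>
  Only exchanges of two adjacent letters are mentioned, so that no sign of a permutation occurs. The
  function is arbitrary, because the condition is needed for the coefficients of a tensor, for
  functionals on words, and for the coefficients of the antisymmetrizer in either argument. The
  vanishing on repeated letters is a separate condition on account of characteristic 2.
\<close>

definition alternating :: "('b list \<Rightarrow> 'a::ab_group_add) \<Rightarrow> bool" where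
  "alternating g \<longleftrightarrow> (\<forall>u x y v. g (u @ x # y # v) = - g (u @ y # x # v)) \<and>
     (\<forall>u x v. g (u @ x # x # v) = 0)"

lemma alternatingI:
  assumes "\<And>u x y v. g (u @ x # y # v) = - g (u @ y # x # v)"
    and "\<And>u x v. g (u @ x # x # v) = 0"
  shows "alternating g"
  unfolding alternating_def using assms by blast

lemma alternating_swap: "alternating g \<Longrightarrow> g (u @ x # y # v) = - g (u @ y # x # v)"
  and alternating_repeat: "alternating g \<Longrightarrow> g (u @ x # x # v) = 0"
  unfolding alternating_def by blast+

lemma sorted_not_increasingE:
  fixes w :: "'b::linorder list"
  assumes "sorted w" "\<not> sorted_wrt (<) w"
  obtains u x v where "w = u @ x # x # v"
  using assms
proof (induction w arbitrary: thesis)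
  case (Cons a w)
  show ?case
  proof (cases "sorted_wrt (<) w")
    case False
    then show ?thesis
      using Cons.IH Cons.prems by (metis append_Cons sorted_simps(2))
  next
    case True
    show ?thesis
    proof (cases w)
      case Nil
      then show ?thesis using Cons.prems by simp
    next
      case (Cons b w')
      then have "a = b"
        using Cons.prems True by (auto simp: order_le_less)
      then show ?thesis
        using Cons.prems(1)[of "[]" a w'] Cons by simp
    qed
  qed
qed simp

text \<open>
  Insertion sort: adjacent exchanges turn every word into a sorted one, and a sorted word that is not
  strictly increasing contains two equal neighbours.
\<close>

lemma increasing_word_induct:
  fixes Q :: "'b::linorder list \<Rightarrow> bool"
  assumes swap: "\<And>u x y v. Q (u @ y # x # v) \<Longrightarrow> Q (u @ x # y # v)"
    and repeat: "\<And>u x v. Q (u @ x # x # v)"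
    and increasing: "\<And>w. sorted_wrt (<) w \<Longrightarrow> mset w = mset w0 \<Longrightarrow> Q w"
  shows "Q w0"
proof -
  have insort: "Q (u @ x # xs)" if "Q (u @ insort x xs)" for u x xs
    using that
  proof (induction xs arbitrary: u)
    case (Cons y ys)
    show ?case
    proof (cases "x \<le> y")
      case False
      then have "Q ((u @ [y]) @ x # ys)"
        using Cons.prems by (intro Cons.IH) simp
      then show ?thesis using swap by simp
    qed (use Cons.prems in simp)
  qed simp
  have "Q (u @ w)" if "Q (u @ sort w)" for u w
    using that
  proof (induction w arbitrary: u)
    case (Cons x xs)
    then have "Q ((u @ [x]) @ sort xs)"
      using insort by simp
    then show ?case using Cons.IH[of "u @ [x]"] by simp
  qed simp
  moreover have "Q (sort w0)"
  proof (cases "sorted_wrt (<) (sort w0)")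
    case True
    then show ?thesis by (rule increasing) simp
  next
    case False
    then obtain u x v where "sort w0 = u @ x # x # v"
      using sorted_not_increasingE sorted_sort by blast
    then show ?thesis using repeat by simp
  qed
  ultimately show ?thesis by (metis append_Nil)
qed

lemma alternating_eq_0:
  fixes g :: "'b::linorder list \<Rightarrow> 'a::ab_group_add"
  assumes "alternating g" and "\<And>w. sorted_wrt (<) w \<Longrightarrow> g w = 0"
  shows "g w = 0"
proof (rule increasing_word_induct[where Q = "\<lambda>w. g w = 0"])
  show "g (u @ x # y # v) = 0" if "g (u @ y # x # v) = 0" for u x y v
    using alternating_swap[OF assms(1), of u x y v] that by simp
qed (simp_all add: assms alternating_repeat)

lemma alternating_diff:
  assumes "alternating g" "alternating h"
  shows "alternating (\<lambda>w. g w - h w)"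
proof (rule alternatingI)
  show "g (u @ x # y # v) - h (u @ x # y # v) = - (g (u @ y # x # v) - h (u @ y # x # v))" for u x y v
    by (simp add: alternating_swap[OF assms(1), of u x y v] alternating_swap[OF assms(2), of u x y v])
qed (simp add: assms alternating_repeat)

lemma alternating_sum:
  assumes "\<And>i. i \<in> I \<Longrightarrow> alternating (g i)"
  shows "alternating (\<lambda>w. \<Sum>i\<in>I. g i w)"
proof (rule alternatingI)
  show "(\<Sum>i\<in>I. g i (u @ x # y # v)) = - (\<Sum>i\<in>I. g i (u @ y # x # v))" for u x y v
    unfolding sum_negf[symmetric] by (intro sum.cong refl alternating_swap assms)
qed (simp add: assms alternating_repeat)

lemma alternating_scale:
  fixes g :: "'b list \<Rightarrow> 'k::field"
  assumes "alternating g"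
  shows "alternating (\<lambda>w. c * g w)"
proof (rule alternatingI)
  show "c * g (u @ x # y # v) = - (c * g (u @ y # x # v))" for u x y v
    by (simp add: alternating_swap[OF assms(1), of u x y v])
qed (simp add: assms alternating_repeat)

lemma alternating_slice:
  assumes "alternating g"
  shows "alternating (\<lambda>w. g (a @ w @ b))"
proof (rule alternatingI)
  show "g (a @ (u @ x # y # v) @ b) = - g (a @ (u @ y # x # v) @ b)" for u x y v
    using alternating_swap[OF assms(1), of "a @ u" x y "v @ b"] by simp
  show "g (a @ (u @ x # x # v) @ b) = 0" for u x v
    using alternating_repeat[OF assms(1), of "a @ u" x "v @ b"] by simp
qed


section \<open>The coefficients of the antisymmetrizer\<close>

text \<open>
  The coefficient of the word \<open>v\<close> in the antisymmetrization of the word \<open>w\<close>; the inverse in the action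
  of permutations is absorbed by the summation.
\<close>

definition ant_coef :: "'b list \<Rightarrow> 'b list \<Rightarrow> 'k::field" where
  "ant_coef w v = (\<Sum>\<sigma> | \<sigma> permutes {..<length w}.
     if permute_list \<sigma> w = v then of_int (sign \<sigma>) else 0)"

lemma ant_coef_length: "length w \<noteq> length v \<Longrightarrow> ant_coef w v = 0"
  by (auto simp: ant_coef_def intro!: sum.neutral)

lemma permute_list_inv:
  assumes "\<sigma> permutes {..<length w}"
  shows "permute_list \<sigma> (permute_list (Hilbert_Choice.inv \<sigma>) w) = w"
    "permute_list (Hilbert_Choice.inv \<sigma>) (permute_list \<sigma> w) = w"
  using assms permutes_inv[OF assms] permutes_inv_o[OF assms]
  by (simp_all add: permute_list_compose[symmetric])

lemma sign_inv: "\<sigma> permutes {..<n::nat} \<Longrightarrow> sign (Hilbert_Choice.inv \<sigma>) = sign \<sigma>"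
  by (metis finite_lessThan permutation_permutes sign_inverse)

text \<open>
  The symmetry transfers the alternating property from the second argument, where it says that
  antisymmetrized tensors are alternating, to the first, where it says that the antisymmetrizer
  factors through the exterior power.
\<close>

lemma ant_coef_commute: "ant_coef w v = ant_coef v w"
proof (cases "length w = length v")
  case True
  have "ant_coef w v = (\<Sum>\<sigma> | \<sigma> permutes {..<length w}.
     if permute_list (Hilbert_Choice.inv \<sigma>) w = v then of_int (sign (Hilbert_Choice.inv \<sigma>)) else 0)"
    unfolding ant_coef_def by (rule sum_permutations_inverse)
  also have "\<dots> = ant_coef v w"
    unfolding ant_coef_def True[symmetric]
  proof (intro sum.cong refl)
    fix \<sigma> assume "\<sigma> \<in> {\<sigma>. \<sigma> permutes {..<length w}}"
    then have \<sigma>: "\<sigma> permutes {..<length w}" by simp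
    have "permute_list (Hilbert_Choice.inv \<sigma>) w = v \<longleftrightarrow> permute_list \<sigma> v = w"
      using permute_list_inv[OF \<sigma>] permute_list_inv[of \<sigma> v] \<sigma> True by auto
    then show "(if permute_list (Hilbert_Choice.inv \<sigma>) w = v
        then of_int (sign (Hilbert_Choice.inv \<sigma>)) else 0) =
      (if permute_list \<sigma> v = w then of_int (sign \<sigma>) else 0)"
      by (simp add: sign_inv[OF \<sigma>])
  qed
  finally show ?thesis .
qed (simp add: ant_coef_length)

lemma permute_list_adjacent:
  "permute_list (transpose (length u) (Suc (length u))) (u @ x # y # v) = u @ y # x # v"
proof (rule nth_equalityI)
  fix i
  assume i: "i < length (permute_list (transpose (length u) (Suc (length u))) (u @ x # y # v))"
  have "transpose (length u) (Suc (length u)) permutes {..<length (u @ x # y # v)}"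
    by (rule permutes_swap_id) auto
  then have "permute_list (transpose (length u) (Suc (length u))) (u @ x # y # v) ! i =
      (u @ x # y # v) ! transpose (length u) (Suc (length u)) i"
    using i by (intro permute_list_nth) auto
  also have "\<dots> = (u @ y # x # v) ! i"
    using i by (auto simp: transpose_def nth_append nth_Cons' not_less_eq less_Suc_eq)
  finally show "permute_list (transpose (length u) (Suc (length u))) (u @ x # y # v) ! i
      = (u @ y # x # v) ! i" .
qed simp

text \<open>
  Composing with the transposition of two adjacent positions is a sign-reversing involution without
  fixed points on the permutations; splitting off the even permutations gives the vanishing in
  characteristic 2 as well.
\<close>

lemma alternating_ant_coef: "alternating (ant_coef w :: _ \<Rightarrow> 'k::field)"
proof (rule alternatingI)
  fix u v :: "'a list" and x y :: 'a
  define \<tau> where "\<tau> = transpose (length u) (Suc (length u))"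
  let ?P = "{\<sigma>. \<sigma> permutes {..<length w}}"
  have \<tau>: "\<tau> permutes {..<length w}" if "length w = length (u @ x # y # v)" for x y
    using that by (auto simp: \<tau>_def intro: permutes_swap_id)
  have swap: "permute_list (\<sigma> \<circ> \<tau>) w = u @ x # y # v \<longleftrightarrow> permute_list \<sigma> w = u @ y # x # v"
    if "\<sigma> \<in> ?P" "length w = length (u @ x # y # v)" for \<sigma> x y
  proof -
    have "permute_list (\<sigma> \<circ> \<tau>) w = permute_list \<tau> (permute_list \<sigma> w)"
      using \<tau>[OF that(2)] by (simp add: permute_list_compose)
    moreover have "permute_list \<tau> (permute_list \<tau> z) = z" if "length z = length w" for z :: "'a list"
      using \<tau>[OF \<open>length w = _\<close>] that permute_list_inv(1)[of \<tau> z]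
      by (simp add: \<tau>_def)
    moreover have "permute_list \<tau> (u @ x # y # v) = u @ y # x # v"
      "permute_list \<tau> (u @ y # x # v) = u @ x # y # v"
      unfolding \<tau>_def by (rule permute_list_adjacent)+
    ultimately show ?thesis by (metis length_permute_list)
  qed
  have sign: "sign (\<sigma> \<circ> \<tau>) = - sign \<sigma>" if "\<sigma> \<in> ?P" for \<sigma>
    using that by (subst sign_compose)
      (auto simp: \<tau>_def sign_swap_id permutation_swap_id intro: permutation_permutes[THEN iffD2])
  show "(ant_coef w (u @ x # y # v) :: 'k) = - ant_coef w (u @ y # x # v)"
  proof (cases "length w = length (u @ x # y # v)")
    case True
    have "(ant_coef w (u @ x # y # v) :: 'k) = (\<Sum>\<sigma>\<in>?P.
        if permute_list (\<sigma> \<circ> \<tau>) w = u @ x # y # v then of_int (sign (\<sigma> \<circ> \<tau>)) else 0)"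
      unfolding ant_coef_def by (rule sum_permutations_compose_right) (rule \<tau>[OF True])
    also have "\<dots> = (\<Sum>\<sigma>\<in>?P. - (if permute_list \<sigma> w = u @ y # x # v then of_int (sign \<sigma>) else 0))"
      by (intro sum.cong refl) (auto simp: swap True sign)
    finally show ?thesis by (simp add: ant_coef_def sum_negf)
  qed (simp add: ant_coef_length)
  show "(ant_coef w (u @ x # x # v) :: 'k) = 0"
  proof (cases "length w = length (u @ x # x # v)")
    case True
    let ?g = "\<lambda>\<sigma>. if permute_list \<sigma> w = u @ x # x # v then of_int (sign \<sigma>) else (0 :: 'k)"
    have comp: "\<sigma> \<circ> \<tau> \<in> ?P" "\<sigma> \<circ> \<tau> \<circ> \<tau> = \<sigma>" if "\<sigma> \<in> ?P" for \<sigma>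
      using that permutes_compose[OF \<tau>[OF True]] by (auto simp: \<tau>_def o_assoc[symmetric])
    have "sum ?g {\<sigma> \<in> ?P. sign \<sigma> \<noteq> 1} = (\<Sum>\<sigma> | \<sigma> \<in> ?P \<and> sign \<sigma> = 1. - ?g \<sigma>)"
      by (rule sum.reindex_bij_witness[where i = "\<lambda>\<sigma>. \<sigma> \<circ> \<tau>" and j = "\<lambda>\<sigma>. \<sigma> \<circ> \<tau>"])
        (use comp sign sign_cases swap[OF _ True] in \<open>auto simp: sign_def split: if_splits\<close>)
    moreover have "sum ?g ?P = sum ?g {\<sigma> \<in> ?P. sign \<sigma> = 1} + sum ?g {\<sigma> \<in> ?P. sign \<sigma> \<noteq> 1}"
      by (subst sum.union_disjoint[symmetric]) (auto simp: finite_permutations intro: sum.cong)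
    ultimately show ?thesis by (simp add: ant_coef_def sum_negf)
  qed (simp add: ant_coef_length)
qed

text \<open>
  Two increasing words with the same letters are equal, and only the identity permutation fixes a word
  without repetitions. So the antisymmetrizer has the coefficients of the identity matrix between increasing
  words, and the coordinates of an alternating tensor with respect to the antisymmetrized increasing
  words are its own coefficients.
\<close>

lemma ant_coef_increasing:
  fixes w v :: "'b::linorder list"
  assumes "sorted_wrt (<) w" "sorted_wrt (<) v"
  shows "ant_coef w v = (if w = v then 1 else 0)"
proof -
  have *: "permute_list \<sigma> w = v \<longleftrightarrow> w = v \<and> \<sigma> = id" if \<sigma>: "\<sigma> permutes {..<length w}" for \<sigma>
  proof
    assume eq: "permute_list \<sigma> w = v"
    then have "set w = set v" using set_permute_list[OF \<sigma>] by simp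
    then have "w = v"
      using assms by (simp add: strict_sorted_equal)
    moreover have "\<sigma> i = i" for i
    proof (cases "i < length w")
      case True
      then have "w ! \<sigma> i = w ! i"
        using eq \<sigma> \<open>w = v\<close> by (metis permute_list_nth)
      then show ?thesis
        using assms(1) \<sigma> True permutes_in_image[OF \<sigma>, of i]
        by (metis lessThan_iff nth_eq_iff_index_eq strict_sorted_iff)
    qed (use \<sigma> in \<open>auto simp: permutes_def\<close>)
    ultimately show "w = v \<and> \<sigma> = id" by auto
  qed auto
  have "ant_coef w v = (\<Sum>\<sigma> | \<sigma> permutes {..<length w}. if \<sigma> = id then (if w = v then 1 else 0) else 0)"
    unfolding ant_coef_def by (intro sum.cong refl) (auto simp: *)
  also have "\<dots> = (if w = v then 1 else 0)"
    by (subst sum.delta) (auto simp: finite_permutations permutes_id)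
  finally show ?thesis .
qed

lemma ant_mon:
  "ant (length w) (wmon w c) =
     (\<Sum>\<sigma> | \<sigma> permutes {..<length w}. wmon (permute_list \<sigma> w) (of_int (sign \<sigma>) * c))"
  unfolding ant_single
  by (subst sum_permutations_inverse) (auto simp: tscale_single inv_inv_eq permutes_bij sign_inv intro!: sum.cong)

lemma coef_ant:
  fixes t :: "('b::finite, 'k::field) tensors"
  assumes "t \<in> tpow r"
  shows "coef (ant r t) v = (\<Sum>w | length w = r. coef t w * ant_coef w v)"
proof -
  have "coef (ant r (wmon w c)) v = c * ant_coef w v" if "length w = r" for w and c :: 'k
    using that ant_mon[of w c]
    by (auto simp: lookup_sum lookup_single when_def ant_coef_def sum_distrib_left intro!: sum.cong)
  then have "coef (ant r (\<Sum>w | length w = r. wmon w (coef t w))) v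
      = (\<Sum>w | length w = r. coef t w * ant_coef w v)"
    by (simp add: ant_sum lookup_sum)
  then show ?thesis using tpow_expand[OF assms] by simp
qed

lemma ant_tpow:
  fixes t :: "('b::finite, 'k::field) tensors"
  shows "t \<in> tpow r \<Longrightarrow> ant r t \<in> tpow r"
  by (auto simp: tpow_iff_coef[of "ant r t"] coef_ant ant_coef_length intro!: sum.neutral)

lemma alternating_coef_ant:
  fixes t :: "('b::finite, 'k::field) tensors"
  assumes "t \<in> tpow r"
  shows "alternating (coef (ant r t))"
proof -
  have "coef (ant r t) = (\<lambda>v. \<Sum>w | length w = r. coef t w * ant_coef w v)"
    using coef_ant[OF assms] by auto
  then show ?thesis
    by (simp add: alternating_sum alternating_scale alternating_ant_coef)
qed

text \<open>
  Restricted to the alternating tensors of degree \<open>r\<close>, this is the inverse of \<open>ant r\<close> on the span of the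
  increasing words. As a linear map it is defined on all tensors, which makes it possible to extend maps given on alternating tensors only.
\<close>

definition increasing_part :: "nat \<Rightarrow> ('b::linorder, 'k::field) tensors \<Rightarrow> ('b, 'k) tensors" where
  "increasing_part r t = (\<Sum>w | length w = r \<and> sorted_wrt (<) w. wmon w (coef t w))"

lemma coef_increasing_part:
  fixes t :: "('b::{finite,linorder}, 'k::field) tensors"
  shows "coef (increasing_part r t) w = (if length w = r \<and> sorted_wrt (<) w then coef t w else 0)"
  by (simp add: increasing_part_def lookup_sum lookup_single when_def)

lemma increasing_part_tpow [simp]:
  fixes t :: "('b::{finite,linorder}, 'k::field) tensors"
  shows "increasing_part r t \<in> tpow r"
  by (simp add: tpow_iff_coef coef_increasing_part)

lemma increasing_part_add:
  fixes s t :: "('b::{finite,linorder}, 'k::field) tensors"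
  shows "increasing_part r (s + t) = increasing_part r s + increasing_part r t"
  by (rule poly_mapping_eqI) (simp add: coef_increasing_part lookup_add)

lemma increasing_part_tscale:
  fixes t :: "('b::{finite,linorder}, 'k::field) tensors"
  shows "increasing_part r (tscale c t) = tscale c (increasing_part r t)"
  by (rule poly_mapping_eqI) (simp add: coef_increasing_part coef_tscale)

lemma increasing_part_mon:
  fixes w :: "'b::{finite,linorder} list"
  assumes "length w = r"
  shows "increasing_part r (wmon w c) = (if sorted_wrt (<) w then wmon w c else 0)"
  by (rule poly_mapping_eqI) (use assms in \<open>auto simp: coef_increasing_part lookup_single when_def\<close>)

lemma increasing_part_ant:
  fixes t :: "('b::{finite,linorder}, 'k::field) tensors"
  assumes t: "t \<in> tpow r" "\<forall>w\<in>Poly_Mapping.keys t. sorted_wrt (<) w"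
  shows "increasing_part r (ant r t) = t"
proof (rule poly_mapping_eqI)
  fix v
  show "coef (increasing_part r (ant r t)) v = coef t v"
  proof (cases "length v = r \<and> sorted_wrt (<) v")
    case True
    have "coef t w * ant_coef w v = (if w = v then coef t w else 0)" for w
      using t True by (cases "w \<in> Poly_Mapping.keys t") (auto simp: ant_coef_increasing in_keys_iff)
    then show ?thesis
      using True by (simp add: coef_increasing_part coef_ant[OF t(1)])
  next
    case False
    then have "coef t v = 0" using t by (auto simp: tpow_def in_keys_iff)
    then show ?thesis using False by (auto simp: coef_increasing_part)
  qed
qed

text \<open>
  The difference of the two sides is alternating and vanishes on increasing words, hence vanishes.
\<close>

lemma alternating_eq_ant:
  fixes t :: "('b::{finite,linorder}, 'k::field) tensors"
  assumes t: "t \<in> tpow r" "alternating (coef t)"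
  shows "ant r (increasing_part r t) = t"
proof (rule poly_mapping_eqI)
  fix v
  let ?s = "ant r (increasing_part r t)"
  have "alternating (\<lambda>w. coef ?s w - coef t w)"
    using t by (intro alternating_diff alternating_coef_ant) auto
  moreover have "coef ?s w - coef t w = 0" if "sorted_wrt (<) w" for w
  proof (cases "length w = r")
    case True
    have "increasing_part r ?s = increasing_part r t"
      by (rule increasing_part_ant) (auto simp: in_keys_iff coef_increasing_part split: if_splits)
    then have "coef (increasing_part r ?s) w = coef (increasing_part r t) w" by simp
    then show ?thesis using that True by (simp add: coef_increasing_part)
  qed (simp add: coef_outside[OF t(1)] coef_outside[OF ant_tpow[OF increasing_part_tpow]])
  ultimately show "coef ?s v = coef t v"
    using alternating_eq_0[of "\<lambda>w. coef ?s w - coef t w" v] by simp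
qed

section \<open>The spaces \<open>W\<close> consist of alternating tensors\<close>

text \<open>
  The tensor of degree \<open>r\<close> obtained from \<open>u\<close> by contracting with the dual words of \<open>a\<close> on the left and
  of \<open>b\<close> on the right.
\<close>

definition slice :: "('b, 'k::field) tensors \<Rightarrow> 'b list \<Rightarrow> nat \<Rightarrow> 'b list \<Rightarrow> ('b, 'k) tensors" where
  "slice u a r b = (\<Sum>w | length w = r. wmon w (coef u (a @ w @ b)))"

lemma coef_slice:
  fixes u :: "('b::finite, 'k::field) tensors"
  shows "coef (slice u a r b) w = (if length w = r then coef u (a @ w @ b) else 0)"
  by (simp add: slice_def lookup_sum lookup_single when_def)

lemma slice_tpow [simp]:
  fixes u :: "('b::finite, 'k::field) tensors"
  shows "slice u a r b \<in> tpow r"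
  by (simp add: tpow_iff_coef coef_slice)

lemma alternating_coef_slice:
  fixes u :: "('b::finite, 'k::field) tensors"
  assumes "alternating (coef u)"
  shows "alternating (coef (slice u a r b))"
proof (rule alternatingI)
  fix v w x y
  show "coef (slice u a r b) (v @ x # y # w) = - coef (slice u a r b) (v @ y # x # w)"
    using alternating_swap[OF alternating_slice[OF assms, of a b], of v x y w]
    by (simp add: coef_slice)
  show "coef (slice u a r b) (v @ x # x # w) = 0"
    using alternating_repeat[OF alternating_slice[OF assms, of a b], of v x w]
    by (simp add: coef_slice)
qed

lemma slice_expand:
  fixes u :: "('b::finite, 'k::field) tensors"
  assumes "u \<in> tpow (i + r + j)"
  shows "u = (\<Sum>a | length a = i. \<Sum>b | length b = j. wmon a 1 * slice u a r b * wmon b 1)" (is "u = ?s")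
proof (rule poly_mapping_eqI)
  fix v
  have s: "?s \<in> tpow (i + r + j)"
    by (intro tpow_sum tpow_mult) (auto intro: tpow_mon)
  show "coef u v = coef ?s v"
  proof (cases "length v = i + r + j")
    case True
    define v1 v2 v3 where "v1 = take i v" and "v2 = take r (drop i v)" and "v3 = drop (i + r) v"
    have v: "v = v1 @ v2 @ v3" "length v1 = i" "length v2 = r" "length v3 = j"
      using True by (simp_all add: v1_def v2_def v3_def) (metis append_take_drop_id drop_drop add.commute)
    have "coef (wmon a 1 * slice u a r b * wmon b 1) v =
        (if b = v3 then if a = v1 then coef u v else 0 else 0)"
      if "length a = i" "length b = j" for a b
    proof -
      have "coef (wmon a 1 * slice u a r b * wmon b 1) v =
          coef (wmon a 1) v1 * (coef (slice u a r b) v2 * coef (wmon b 1) v3)"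
        unfolding mult.assoc v(1)
        by (subst coef_mult, simp add: v that tpow_mon, subst coef_mult) (simp_all add: v that)
      then show ?thesis by (simp add: lookup_single when_def coef_slice v)
    qed
    then have "coef ?s v = (\<Sum>a | length a = i. \<Sum>b | length b = j.
        if b = v3 then if a = v1 then coef u v else 0 else 0)"
      unfolding lookup_sum by (intro sum.cong refl) simp
    also have "\<dots> = coef u v" using v(2,4) by simp
    finally show ?thesis by simp
  qed (use coef_outside[OF assms] coef_outside[OF s] in simp)
qed

text \<open>
  Slices of an alternating tensor are alternating, so they lie in the image of \<open>ant N\<close>.
\<close>

lemma alternating_imp_W:
  fixes t :: "('b::{finite,linorder}, 'k::field) tensors"
  assumes "t \<in> tpow r" "alternating (coef t)"
  shows "t \<in> W N r"
proof -
  have "t \<in> tensors.span {a * \<rho> * b | a \<rho> b. a \<in> tpow i \<and> \<rho> \<in> rel_space N \<and> b \<in> tpow j}"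
    if "i + N + j = r" for i j
  proof -
    have "slice t a N b \<in> rel_space N" for a b
      unfolding rel_space_def
      using alternating_eq_ant[OF slice_tpow[of t a N b] alternating_coef_slice[OF assms(2)]]
      by (metis image_eqI increasing_part_tpow)
    then have "(\<Sum>a | length a = i. \<Sum>b | length b = j. wmon a 1 * slice t a N b * wmon b 1)
        \<in> tensors.span {a * \<rho> * b | a \<rho> b. a \<in> tpow i \<and> \<rho> \<in> rel_space N \<and> b \<in> tpow j}"
      by (intro tensors.span_sum tensors.span_base) (blast intro: tpow_mon)
    then show ?thesis
      using slice_expand[of t i N j] assms that by simp
  qed
  then show ?thesis using assms by (simp add: W_def)
qed

text \<open>
  Two adjacent positions always fit into one window of length \<open>N \<ge> 2\<close>, and a relation is alternating
  in its window. In degrees 0 and 1 there is nothing to exchange; for \<open>2 \<le> r < N\<close> there are no windows, and the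
  conclusion fails.
\<close>

lemma W_imp_alternating:
  fixes t :: "('b::finite, 'k::field) tensors"
  assumes "2 \<le> N" "r < 2 \<or> N \<le> r" and t: "t \<in> W N r"
  shows "alternating (coef t)"
proof -
  have tr: "t \<in> tpow r" using t by (simp add: W_def)
  have "coef t (u @ x # y # v) = - coef t (u @ y # x # v) \<and> coef t (u @ x # x # v) = 0" for u x y v
  proof (cases "length u + 2 + length v = r")
    case True
    define i where "i = min (length u) (r - N)"
    define j where "j = r - N - i"
    \<comment> \<open>The window of length \<open>N\<close> starting at \<open>i\<close> contains both exchanged positions.\<close>
    have ij: "i + N + j = r" "i \<le> length u" "length u + 2 \<le> i + N"
      using assms(1,2) True by (auto simp: i_def j_def)
    define u1 u2 where "u1 = take i u" and "u2 = drop i u"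
    define v1 v2 where "v1 = take (i + N - length u - 2) v" and "v2 = drop (i + N - length u - 2) v"
    have len: "length u1 = i" "length v2 = j" "length u2 + 2 + length v1 = N"
      and uv: "u = u1 @ u2" "v = v1 @ v2"
      using ij True by (simp_all add: u1_def u2_def v1_def v2_def)
    have eq: "u @ x # y # v = u1 @ (u2 @ x # y # v1) @ v2" for x y
      by (simp add: uv)
    have "t \<in> tensors.span {a * \<rho> * b | a \<rho> b. a \<in> tpow i \<and> \<rho> \<in> rel_space N \<and> b \<in> tpow j}"
      using t ij(1) by (simp add: W_def)
    then show ?thesis
    proof (induction rule: tensors.span_induct_alt)
      case (step c s t)
      then obtain a \<rho> b where s: "s = a * (\<rho> * b)" "a \<in> tpow i" "\<rho> \<in> rel_space N" "b \<in> tpow j"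
        by (auto simp: mult.assoc)
      then have \<rho>: "\<rho> \<in> tpow N" "alternating (coef \<rho>)"
        by (auto simp: rel_space_def ant_tpow alternating_coef_ant)
      have "coef s (u @ x # y # v) = coef a u1 * (coef \<rho> (u2 @ x # y # v1) * coef b v2)" for x y
      proof -
        have "coef (\<rho> * b) ((u2 @ x # y # v1) @ v2) = coef \<rho> (u2 @ x # y # v1) * coef b v2"
          by (rule coef_mult) (use \<rho>(1) len in simp)
        then show ?thesis
          unfolding s(1) eq using s len by (subst coef_mult) simp_all
      qed
      then have "coef s (u @ x # y # v) = - coef s (u @ y # x # v)" "coef s (u @ x # x # v) = 0"
        using alternating_swap[OF \<rho>(2), of u2 x y v1] alternating_repeat[OF \<rho>(2), of u2 x v1] by simp_all
      then show ?case using step.IH by (simp add: lookup_add coef_tscale)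
    qed simp
  qed (simp add: coef_outside[OF tr])
  then show ?thesis by (intro alternatingI) blast+
qed

lemma W_add: "s \<in> W N r \<Longrightarrow> t \<in> W N r \<Longrightarrow> s + t \<in> W N r"
  by (simp add: W_def tpow_add tensors.span_add)

lemma W_0: "0 \<in> W N r"
  by (simp add: W_def tensors.span_zero)

lemma W_minus: "t \<in> W N r \<Longrightarrow> - t \<in> W N r"
  by (simp add: W_def tpow_minus tensors.span_neg)

lemma W_tscale: "t \<in> W N r \<Longrightarrow> tscale c t \<in> W N r"
  by (simp add: W_def tpow_tscale tensors.span_scale)

lemma W_tpow: "t \<in> W N r \<Longrightarrow> t \<in> tpow r"
  by (simp add: W_def)


section \<open>The exterior power as the space of alternating tensors\<close>

lemma tensor_algebra_simps [simp]:
  "carrier tensor_algebra = UNIV"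
  "s \<otimes>\<^bsub>tensor_algebra\<^esub> t = s * t" "\<one>\<^bsub>tensor_algebra\<^esub> = 1"
  "s \<oplus>\<^bsub>tensor_algebra\<^esub> t = s + t" "\<zero>\<^bsub>tensor_algebra\<^esub> = 0"
  by (simp_all add: tensor_algebra_def)

lemma ring_tensor_algebra: "ring (tensor_algebra :: ('b, 'k::field) tensors ring)"
proof (rule ringI)
  show "abelian_group (tensor_algebra :: ('b, 'k) tensors ring)"
    by (rule abelian_groupI) (auto simp: algebra_simps intro: exI[of _ "- _"])
  show "monoid (tensor_algebra :: ('b, 'k) tensors ring)"
    by (rule monoidI) (auto simp: algebra_simps)
qed (auto simp: algebra_simps)

lemma minus_tensor_algebra [simp]:
  "s \<ominus>\<^bsub>tensor_algebra\<^esub> t = s - (t :: ('b, 'k::field) tensors)"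
proof -
  interpret ring "tensor_algebra :: ('b, 'k) tensors ring" by (rule ring_tensor_algebra)
  have "\<ominus>\<^bsub>tensor_algebra\<^esub> t = - t"
    by (rule minus_equality) auto
  then show ?thesis by (simp add: a_minus_def)
qed

lemma ideal_ext_ideal: "ideal (ext_ideal :: ('b, 'k::field) tensors set) tensor_algebra"
  unfolding ext_ideal_def by (rule ring.genideal_ideal[OF ring_tensor_algebra]) simp

lemma ext_class_eq_iff: "ext_class s = ext_class t \<longleftrightarrow> s - t \<in> ext_ideal"
  unfolding ext_class_def
  using ring.quotient_eq_iff_same_a_r_cos[OF ring_tensor_algebra ideal_ext_ideal, of s t] by simp

text \<open>
  The functional on tensors of degree \<open>r\<close> with the given values on words.
\<close>

definition pairing :: "nat \<Rightarrow> ('b list \<Rightarrow> 'k) \<Rightarrow> ('b, 'k::field) tensors \<Rightarrow> 'k" where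
  "pairing r g t = (\<Sum>w | length w = r. coef t w * g w)"

lemma pairing_add: "pairing r g (s + t) = pairing r g s + pairing r g t"
  by (simp add: pairing_def lookup_add distrib_right sum.distrib)

lemma pairing_0: "pairing r g 0 = 0"
  by (simp add: pairing_def)

lemma pairing_sum: "pairing r g (sum f I) = (\<Sum>i\<in>I. pairing r g (f i))"
  by (induction I rule: infinite_finite_induct) (simp_all add: pairing_add pairing_0)

lemma pairing_minus: "pairing r g (- t) = - pairing r g t"
  by (simp add: pairing_def sum_negf)

lemma pairing_mon:
  fixes w :: "'b::finite list"
  shows "pairing r g (wmon w c) = (if length w = r then c * g w else 0)"
proof -
  have "pairing r g (wmon w c) = (\<Sum>v | length v = r. if v = w then c * g w else 0)"
    unfolding pairing_def by (intro sum.cong) (auto simp: lookup_single when_def)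
  then show ?thesis by simp
qed

text \<open>
  The sum is split into the two triangles off the diagonal, since \<open>2 S = 0\<close> says nothing in
  characteristic 2.
\<close>

lemma antisymmetric_sum:
  fixes h :: "'b::{finite,linorder} \<Rightarrow> 'b \<Rightarrow> 'k::ab_group_add"
  assumes "\<And>x y. h x y = - h y x" "\<And>x. h x x = 0"
  shows "(\<Sum>x\<in>UNIV. \<Sum>y\<in>UNIV. h x y) = 0"
proof -
  let ?h = "case_prod h"
  have "(\<Sum>z | fst z > snd z. ?h z) = (\<Sum>z | fst z < snd z. - ?h z)"
    by (rule sum.reindex_bij_witness[where i = prod.swap and j = prod.swap])
      (auto simp: assms(1)[symmetric] split_beta)
  moreover have "(\<Sum>z\<in>UNIV. ?h z) = (\<Sum>z\<in>{z. fst z < snd z} \<union> {z. fst z > snd z}. ?h z)"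
    by (rule sum.mono_neutral_right) (auto simp: not_less, metis assms(2) order_le_less)
  moreover have "\<dots> = (\<Sum>z | fst z < snd z. ?h z) + (\<Sum>z | fst z > snd z. ?h z)"
    by (rule sum.union_disjoint) auto
  moreover have "(\<Sum>x\<in>UNIV. \<Sum>y\<in>UNIV. h x y) = (\<Sum>z\<in>UNIV. ?h z)"
    unfolding sum.cartesian_product UNIV_Times_UNIV ..
  ultimately show ?thesis
    unfolding sum_negf by simp
qed

lemma pairing_square:
  fixes v :: "('b::{finite,linorder}, 'k::field) tensors"
  assumes "v \<in> tpow 1" "alternating g"
  shows "pairing r g (a * (v * v) * b) = 0"
proof -
  have words: "{w :: 'b list. length w = 1} = range (\<lambda>x. [x])"
    by (auto simp: length_Suc_conv)
  have v: "v = (\<Sum>x\<in>UNIV. wmon [x] (coef v [x]))"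
    using tpow_expand[OF assms(1)] unfolding words by (simp add: sum.reindex inj_on_def)
  have vv: "v * v = (\<Sum>x\<in>UNIV. \<Sum>y\<in>UNIV. wmon [x, y] (coef v [x] * coef v [y]))"
    by (subst (1 2) v) (simp add: sum_product mon_mult)
  have "pairing r g (wmon a c * (v * v) * wmon b d) = 0" for a b c d
  proof -
    have "wmon a c * (v * v) * wmon b d =
        (\<Sum>x\<in>UNIV. \<Sum>y\<in>UNIV. wmon (a @ x # y # b) (c * (coef v [x] * coef v [y]) * d))"
      unfolding vv by (simp add: sum_distrib_left sum_distrib_right mon_mult)
    then have "pairing r g (wmon a c * (v * v) * wmon b d) = (\<Sum>x\<in>UNIV. \<Sum>y\<in>UNIV.
        if length a + 2 + length b = r then c * (coef v [x] * coef v [y]) * d * g (a @ x # y # b) else 0)"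
      by (simp add: pairing_sum pairing_mon)
    also have "\<dots> = 0"
    proof (rule antisymmetric_sum, goal_cases)
      case (1 x y)
      show ?case
        using alternating_swap[OF assms(2), of a x y b] by simp
    qed (simp add: alternating_repeat[OF assms(2)])
    finally show ?thesis .
  qed
  then have "pairing r g ((\<Sum>w\<in>Poly_Mapping.keys a. wmon w (coef a w)) * (v * v) *
      (\<Sum>w\<in>Poly_Mapping.keys b. wmon w (coef b w))) = 0"
    unfolding sum_distrib_left sum_distrib_right pairing_sum by simp
  then show ?thesis by (simp only: sum_mon)
qed

text \<open>
  The tensors \<open>t\<close> all of whose multiples \<open>a t b\<close> are annihilated form an ideal, and this ideal contains the
  squares of vectors.
\<close>

lemma pairing_ext_ideal:
  fixes t :: "('b::{finite,linorder}, 'k::field) tensors"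
  assumes "t \<in> ext_ideal" "alternating g"
  shows "pairing r g t = 0"
proof -
  let ?I = "{t :: ('b, 'k) tensors. \<forall>a b. pairing r g (a * t * b) = 0}"
  have "ideal ?I tensor_algebra"
  proof (rule idealI[OF ring_tensor_algebra])
    show "subgroup ?I (add_monoid tensor_algebra)"
    proof
      fix t assume t: "t \<in> ?I"
      have "inv\<^bsub>add_monoid tensor_algebra\<^esub> t = - t"
        using minus_tensor_algebra[of 0 t] by (simp add: a_minus_def a_inv_def)
      then show "inv\<^bsub>add_monoid tensor_algebra\<^esub> t \<in> ?I"
        using t by (simp add: pairing_minus)
    qed (simp_all add: distrib_left distrib_right pairing_add pairing_0)
  next
    fix s t :: "('b, 'k) tensors" assume t: "t \<in> ?I"
    have "a * (s * t) * b = (a * s) * t * b" "a * (t * s) * b = a * t * (s * b)" for a b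
      by (simp_all add: mult.assoc)
    then show "s \<otimes>\<^bsub>tensor_algebra\<^esub> t \<in> ?I" "t \<otimes>\<^bsub>tensor_algebra\<^esub> s \<in> ?I"
      using t by auto
  qed
  moreover have "{v * v | v. v \<in> tpow 1} \<subseteq> ?I"
    using pairing_square[OF _ assms(2)] by auto
  ultimately have "ext_ideal \<subseteq> ?I"
    unfolding ext_ideal_def by (intro ring.genideal_minimal[OF ring_tensor_algebra])
  then have "pairing r g (1 * t * 1) = 0" using assms(1) by blast
  then show ?thesis by simp
qed

lemma ext_ideal_closed:
  shows "s \<in> ext_ideal \<Longrightarrow> t \<in> ext_ideal \<Longrightarrow> s + t \<in> ext_ideal"
    and "t \<in> ext_ideal \<Longrightarrow> a * t * b \<in> ext_ideal"
    and "t \<in> ext_ideal \<Longrightarrow> - t \<in> ext_ideal"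
proof -
  interpret ideal ext_ideal "tensor_algebra :: ('a, 'b) tensors ring" by (rule ideal_ext_ideal)
  show "s + t \<in> ext_ideal" if "s \<in> ext_ideal" "t \<in> ext_ideal"
    using additive_subgroup.a_closed[OF is_additive_subgroup that] by simp
  show *: "a * t * b \<in> ext_ideal" if "t \<in> ext_ideal" for a b
    using I_r_closed[of "a * t" b] I_l_closed[OF that, of a] by simp
  show "- t \<in> ext_ideal" if "t \<in> ext_ideal"
    using *[OF that, of "-1" 1] by simp
qed

lemma square_ext_ideal: "v \<in> tpow 1 \<Longrightarrow> v * v \<in> ext_ideal"
  unfolding ext_ideal_def
  by (rule subsetD[OF ring.genideal_self[OF ring_tensor_algebra]]) auto

lemma mon_repeat_ext_ideal: "wmon (u @ x # x # v) 1 \<in> ext_ideal"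
proof -
  have "wmon u 1 * (wmon [x] 1 * wmon [x] 1) * wmon v 1 \<in> ext_ideal"
    by (intro ext_ideal_closed(2) square_ext_ideal tpow_mon) simp
  then show ?thesis by (simp add: mon_mult)
qed

lemma mon_swap_ext_ideal: "wmon (u @ x # y # v) 1 + wmon (u @ y # x # v) 1 \<in> ext_ideal"
proof -
  have sq: "(wmon [x] 1 + wmon [y] 1) * (wmon [x] 1 + wmon [y] 1) - wmon [x] 1 * wmon [x] 1 - wmon [y] 1 * wmon [y] 1
      = wmon [x, y] 1 + wmon [y, x] 1"
    by (simp add: algebra_simps mon_mult)
  have "wmon u 1 * ((wmon [x] 1 + wmon [y] 1) * (wmon [x] 1 + wmon [y] 1) - wmon [x] 1 * wmon [x] 1 - wmon [y] 1 * wmon [y] 1)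
      * wmon v 1 \<in> ext_ideal"
    unfolding diff_conv_add_uminus
    by (intro ext_ideal_closed(1,2,3) square_ext_ideal tpow_add tpow_mon) simp_all
  then show ?thesis by (simp add: sq mon_mult distrib_left distrib_right add.commute)
qed

lemma ext_class_tscale_cong: "ext_class s = ext_class t \<Longrightarrow> ext_class (tscale c s) = ext_class (tscale c t)"
  using ext_ideal_closed(2)[of "s - t" "scalar c" 1]
  by (simp add: ext_class_eq_iff tscale_def right_diff_distrib)

lemma ext_class_add_cong:
  "ext_class s = ext_class s' \<Longrightarrow> ext_class t = ext_class t' \<Longrightarrow> ext_class (s + t) = ext_class (s' + t')"
  using ext_ideal_closed(1)[of "s - s'" "t - t'"]
  by (simp add: ext_class_eq_iff algebra_simps)

text \<open>
  Modulo squares, adjacent letters anticommute and equal neighbours give 0, so words can be sorted.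
\<close>

lemma ext_class_increasing_mon:
  fixes w :: "'b::{finite,linorder} list"
  shows "\<exists>t \<in> tpow (length w). (\<forall>v\<in>Poly_Mapping.keys t. sorted_wrt (<) v) \<and>
    ext_class (wmon w 1 :: ('b, 'k::field) tensors) = ext_class t"
proof (rule increasing_word_induct[where Q = "\<lambda>w. \<exists>t \<in> tpow (length w).
    (\<forall>v\<in>Poly_Mapping.keys t. sorted_wrt (<) v) \<and> ext_class (wmon w 1) = ext_class t"])
  fix u x y and v :: "'b list"
  assume "\<exists>t \<in> tpow (length (u @ y # x # v)). (\<forall>v\<in>Poly_Mapping.keys t. sorted_wrt (<) v) \<and>
    ext_class (wmon (u @ y # x # v) 1 :: ('b, 'k) tensors) = ext_class t"
  then obtain t :: "('b, 'k) tensors" where t: "t \<in> tpow (length (u @ y # x # v))" "\<forall>v\<in>Poly_Mapping.keys t. sorted_wrt (<) v"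
    "wmon (u @ y # x # v) 1 - t \<in> ext_ideal"
    by (auto simp: ext_class_eq_iff)
  have "wmon (u @ x # y # v) 1 - - t \<in> ext_ideal"
    using ext_ideal_closed(1)[OF mon_swap_ext_ideal ext_ideal_closed(3)[OF t(3)], of u x y v]
    by (simp add: algebra_simps)
  then show "\<exists>t \<in> tpow (length (u @ x # y # v)). (\<forall>v\<in>Poly_Mapping.keys t. sorted_wrt (<) v) \<and>
    ext_class (wmon (u @ x # y # v) 1 :: ('b, 'k) tensors) = ext_class t"
    using t(1,2) by (intro bexI[of _ "- t"]) (auto simp: ext_class_eq_iff tpow_minus)
next
  fix u x and v :: "'b list"
  show "\<exists>t \<in> tpow (length (u @ x # x # v)). (\<forall>v\<in>Poly_Mapping.keys t. sorted_wrt (<) v) \<and>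
    ext_class (wmon (u @ x # x # v) 1 :: ('b, 'k) tensors) = ext_class t"
    by (intro bexI[of _ 0]) (auto simp: ext_class_eq_iff mon_repeat_ext_ideal)
next
  fix w :: "'b list"
  assume "sorted_wrt (<) w"
  then show "\<exists>t \<in> tpow (length w). (\<forall>v\<in>Poly_Mapping.keys t. sorted_wrt (<) v) \<and>
    ext_class (wmon w 1 :: ('b, 'k) tensors) = ext_class t"
    by (intro bexI[of _ "wmon w 1"]) (auto simp: tpow_mon)
qed

lemma ext_class_increasing:
  fixes t :: "('b::{finite,linorder}, 'k::field) tensors"
  assumes "t \<in> tpow r"
  obtains s where "s \<in> tpow r" "\<forall>v\<in>Poly_Mapping.keys s. sorted_wrt (<) v" "ext_class t = ext_class s"
proof -
  have "\<exists>s\<in>tpow r. (\<forall>v\<in>Poly_Mapping.keys s. sorted_wrt (<) v) \<and> ext_class t = ext_class s"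
    using assms
  proof (induction t rule: tpow_induct)
    case zero
    show ?case by (intro bexI[of _ 0]) auto
  next
    case (add t t')
    then obtain s s' where "s \<in> tpow r" "\<forall>v\<in>Poly_Mapping.keys s. sorted_wrt (<) v" "ext_class t = ext_class s"
      "s' \<in> tpow r" "\<forall>v\<in>Poly_Mapping.keys s'. sorted_wrt (<) v" "ext_class t' = ext_class s'"
      by blast
    then show ?case
      using Poly_Mapping.keys_add[of s s'] ext_class_add_cong[of t s t' s']
      by (intro bexI[of _ "s + s'"] conjI) (auto intro: tpow_add)
  next
    case (wmon w c)
    obtain s :: "('b, 'k) tensors" where s: "s \<in> tpow r" "\<forall>v\<in>Poly_Mapping.keys s. sorted_wrt (<) v"
      "ext_class (wmon w 1) = ext_class s"
      using ext_class_increasing_mon[of w] wmon by auto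
    then have "ext_class (wmon w c) = ext_class (tscale c s)"
      using ext_class_tscale_cong[OF s(3), of c] by (simp add: tscale_single)
    moreover have "\<forall>v\<in>Poly_Mapping.keys (tscale c s). sorted_wrt (<) v"
      using s(2) by (auto simp: in_keys_iff coef_tscale)
    ultimately show ?case
      using s(1) by (intro bexI[of _ "tscale c s"]) (auto simp: tpow_tscale)
  qed
  then show ?thesis using that by blast
qed

lemma ant_eq_of_ext_class_eq:
  fixes s t :: "('b::{finite,linorder}, 'k::field) tensors"
  assumes "s \<in> tpow r" "t \<in> tpow r" "ext_class s = ext_class t"
  shows "ant r s = ant r t"
proof (rule poly_mapping_eqI)
  fix v :: "'b list"
  have "alternating (\<lambda>w. ant_coef w v :: 'k)"
    using alternating_ant_coef[of v] by (simp add: ant_coef_commute[of _ v])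
  then have "pairing r (\<lambda>w. ant_coef w v) (s + - t) = 0"
    using assms(3) by (intro pairing_ext_ideal) (simp_all add: ext_class_eq_iff)
  then have "pairing r (\<lambda>w. ant_coef w v) s = pairing r (\<lambda>w. ant_coef w v) t"
    by (simp only: pairing_add pairing_minus eq_neg_iff_add_eq_0 [symmetric] minus_minus)
  then show "coef (ant r s) v = coef (ant r t) v"
    using assms by (simp add: coef_ant pairing_def)
qed

text \<open>
  The definition of \<open>phi\<close> only mentions representatives built from increasing words. Since \<open>ant r\<close> depends only on
  the class in the exterior power, every homogeneous representative gives the same value.
\<close>

lemma phi_ext_class:
  fixes t :: "('b::{finite,linorder}, 'k::field) tensors"
  assumes "t \<in> tpow r"
  shows "phi r (ext_class t) = ant r t"
  unfolding phi_def
proof (rule the_equality)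
  show "\<exists>s \<in> tpow r. (\<forall>w\<in>Poly_Mapping.keys s. sorted_wrt (<) w) \<and> ext_class t = ext_class s \<and> ant r t = ant r s"
    using ext_class_increasing[OF assms] ant_eq_of_ext_class_eq[OF assms] by metis
qed (use ant_eq_of_ext_class_eq[OF assms] in metis)

lemma ext_class_increasing_part_ant:
  fixes t :: "('b::{finite,linorder}, 'k::field) tensors"
  assumes "t \<in> tpow r"
  shows "ext_class (increasing_part r (ant r t)) = ext_class t"
  using ext_class_increasing[OF assms] ant_eq_of_ext_class_eq[OF assms] increasing_part_ant by metis

lemma carrier_ext_power: "carrier (ext_power r) = ext_class ` tpow r"
  by (simp add: ext_power_def Let_def)

lemma inv_into_phi:
  fixes u :: "('b::{finite,linorder}, 'k::field) tensors"
  assumes "u \<in> tpow r" "alternating (coef u)"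
  shows "inv_into (carrier (ext_power r)) (phi r) u = ext_class (increasing_part r u)"
proof -
  have "inj_on (phi r) (carrier (ext_power r) :: ('b, 'k) tensors set set)"
    by (rule inj_on_inverseI[where g = "\<lambda>u. ext_class (increasing_part r u)"])
      (auto simp: carrier_ext_power phi_ext_class ext_class_increasing_part_ant)
  moreover have "phi r (ext_class (increasing_part r u)) = u"
    using assms by (simp add: phi_ext_class alternating_eq_ant)
  ultimately show ?thesis
    by (metis carrier_ext_power image_eqI increasing_part_tpow inv_into_f_f)
qed

lemma ext_class_ring_ops:
  fixes s t :: "('b, 'k::field) tensors"
  shows "ext_class s \<oplus>\<^bsub>tensor_algebra Quot ext_ideal\<^esub> ext_class t = ext_class (s + t)"
  "ext_class s \<otimes>\<^bsub>tensor_algebra Quot ext_ideal\<^esub> ext_class t = ext_class (s * t)"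
  "\<zero>\<^bsub>tensor_algebra Quot ext_ideal\<^esub> = ext_class (0 :: ('b, 'k) tensors)"
proof -
  interpret ideal ext_ideal "tensor_algebra :: ('b, 'k) tensors ring" by (rule ideal_ext_ideal)
  interpret h: ring_hom_ring "tensor_algebra :: ('b, 'k) tensors ring" "tensor_algebra Quot ext_ideal"
    "(+>\<^bsub>tensor_algebra\<^esub>) ext_ideal"
    by (rule rcos_ring_hom_ring)
  show "ext_class s \<oplus>\<^bsub>tensor_algebra Quot ext_ideal\<^esub> ext_class t = ext_class (s + t)"
    "ext_class s \<otimes>\<^bsub>tensor_algebra Quot ext_ideal\<^esub> ext_class t = ext_class (s * t)"
    "\<zero>\<^bsub>tensor_algebra Quot ext_ideal\<^esub> = ext_class (0 :: ('b, 'k) tensors)"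
    using h.hom_add[of s t] h.hom_mult[of s t] h.hom_zero by (simp_all add: ext_class_def)
qed

lemma ext_power_ops:
  "ext_class s \<oplus>\<^bsub>ext_power r\<^esub> ext_class t = ext_class (s + t)"
  "c \<odot>\<^bsub>ext_power r\<^esub> ext_class t = ext_class (tscale c t)"
  "\<zero>\<^bsub>ext_power r\<^esub> = ext_class 0"
  by (simp_all add: ext_power_def Let_def ext_class_ring_ops tscale_def)

section \<open>Tensor products\<close>

lemma hom_finsum:
  assumes "abelian_group G" "abelian_group K" "h \<in> hom (add_monoid G) (add_monoid K)"
    and "finite A" "f \<in> A \<rightarrow> carrier G"
  shows "h (finsum G f A) = finsum K (\<lambda>i. h (f i)) A"
proof -
  interpret G: abelian_group G by fact
  interpret K: abelian_group K by fact
  interpret h: group_hom "add_monoid G" "add_monoid K" h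
    using assms(3) by (simp add: group_hom_def group_hom_axioms_def G.a_group K.a_group)
  show ?thesis
    using assms(4,5)
  proof (induction A rule: finite_induct)
    case empty
    then show ?case using h.hom_one by simp
  next
    case (insert i A)
    have "h (f j) \<in> carrier K" if "j \<in> insert i A" for j
      using h.hom_closed[of "f j"] insert.prems that by auto
    then show ?case
      using insert h.hom_mult[of "f i" "finsum G f A"]
      by (simp add: G.finsum_closed Pi_def)
  qed
qed

text \<open>
  Vector spaces over \<open>'k\<close> as records with a carrier, which is how the tensor products and exterior powers
  are given.
\<close>

locale kmodule = abelian_group X
  for X :: "('k::field, 'x, 'c) module_scheme" (structure) +
  assumes smult_closed [simp]: "x \<in> carrier X \<Longrightarrow> c \<odot> x \<in> carrier X"
    and smult_r_distr: "\<lbrakk>x \<in> carrier X; y \<in> carrier X\<rbrakk> \<Longrightarrow> c \<odot> (x \<oplus> y) = c \<odot> x \<oplus> c \<odot> y"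
    and smult_l_distr: "x \<in> carrier X \<Longrightarrow> (c + d) \<odot> x = c \<odot> x \<oplus> d \<odot> x"
    and smult_assoc: "x \<in> carrier X \<Longrightarrow> c \<odot> (d \<odot> x) = (c * d) \<odot> x"
    and smult_one: "x \<in> carrier X \<Longrightarrow> 1 \<odot> x = x"

text \<open>
  The common setting of the tensor products over \<open>k\<close> and over the \<open>N\<close>-symmetric algebra: \<open>r\<close> and \<open>l\<close> are
  the actions that get balanced, and \<open>sc\<close> is the action of \<open>k\<close> on the first factor, which must commute with \<open>r\<close> in
  order to descend.
\<close>

locale tensor_product = X: abelian_group X + Y: abelian_group Y
  for S :: "'s set" and X :: "('x, 'c) ring_scheme" and r :: "'x \<Rightarrow> 's \<Rightarrow> 'x"
    and Y :: "('y, 'd) ring_scheme" and l :: "'s \<Rightarrow> 'y \<Rightarrow> 'y" and sc :: "'k::field \<Rightarrow> 'x \<Rightarrow> 'x" +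
  assumes r_closed: "\<lbrakk>x \<in> carrier X; s \<in> S\<rbrakk> \<Longrightarrow> r x s \<in> carrier X"
    and l_closed: "\<lbrakk>y \<in> carrier Y; s \<in> S\<rbrakk> \<Longrightarrow> l s y \<in> carrier Y"
    and sc_closed: "x \<in> carrier X \<Longrightarrow> sc c x \<in> carrier X"
    and sc_add: "\<lbrakk>x \<in> carrier X; x' \<in> carrier X\<rbrakk> \<Longrightarrow> sc c (x \<oplus>\<^bsub>X\<^esub> x') = sc c x \<oplus>\<^bsub>X\<^esub> sc c x'"
    and sc_r: "\<lbrakk>x \<in> carrier X; s \<in> S\<rbrakk> \<Longrightarrow> sc c (r x s) = r (sc c x) s"
begin

abbreviation "F \<equiv> free_Abelian_group (carrier X \<times> carrier Y)"
abbreviation "H \<equiv> tprod_relations S X r Y l"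
abbreviation "T \<equiv> tprod S X r Y l sc"
abbreviation "pt \<equiv> pure_tensor S X r Y l"
abbreviation "cls u \<equiv> H #>\<^bsub>F\<^esub> u"

definition "gens = {frag_of (x \<oplus>\<^bsub>X\<^esub> x', y) - frag_of (x, y) - frag_of (x', y) | x x' y.
         x \<in> carrier X \<and> x' \<in> carrier X \<and> y \<in> carrier Y} \<union>
      {frag_of (x, y \<oplus>\<^bsub>Y\<^esub> y') - frag_of (x, y) - frag_of (x, y') | x y y'.
         x \<in> carrier X \<and> y \<in> carrier Y \<and> y' \<in> carrier Y} \<union>
      {frag_of (r x s, y) - frag_of (x, l s y) | x s y.
         x \<in> carrier X \<and> s \<in> S \<and> y \<in> carrier Y}"

lemma H_eq: "H = generate F gens"
  by (simp add: tprod_relations_def gens_def)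

sublocale F: comm_group F
  by (rule abelian_free_Abelian_group)

lemma frag_carrier: "\<lbrakk>x \<in> carrier X; y \<in> carrier Y\<rbrakk> \<Longrightarrow> frag_of (x, y) \<in> carrier F"
  by simp

lemma diff_carrier: "\<lbrakk>u \<in> carrier F; v \<in> carrier F\<rbrakk> \<Longrightarrow> u - v \<in> carrier F"
  using keys_diff[of u v] by auto

lemma gens_carrier: "gens \<subseteq> carrier F"
  unfolding gens_def
  by (safe; intro diff_carrier frag_carrier; simp add: r_closed l_closed)

lemma subgroup_H: "subgroup H F"
  unfolding H_eq by (rule F.generate_is_subgroup[OF gens_carrier])

lemma normal_H: "H \<lhd> F"
  using subgroup_H by (simp add: F.normal_iff_subgroup)

lemma gens_H: "u \<in> gens \<Longrightarrow> u \<in> H"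
  unfolding H_eq by (rule generate.incl)

lemma T_simps:
  "carrier T = carrier (F Mod H)" "add T = monoid.mult (F Mod H)" "\<zero>\<^bsub>T\<^esub> = \<one>\<^bsub>F Mod H\<^esub>"
  by (simp_all add: tprod_def Let_def)

lemma carrier_T: "carrier T = cls ` carrier F"
  by (simp add: tprod_def Let_def carrier_FactGroup)

lemma abelian_group_T: "abelian_group T"
proof -
  interpret Q: comm_group "F Mod H" by (rule F.abelian_FactGroup[OF subgroup_H])
  show ?thesis
    by (rule abelian_groupI; unfold T_simps;
        (rule Q.m_closed | rule Q.one_closed | rule Q.m_assoc | rule Q.m_comm | rule Q.l_one | rule Q.l_inv_ex);
        assumption)
qed

sublocale T: abelian_group T
  by (rule abelian_group_T)

lemma cls_add: "\<lbrakk>u \<in> carrier F; v \<in> carrier F\<rbrakk> \<Longrightarrow> cls u \<oplus>\<^bsub>T\<^esub> cls v = cls (u + v)"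
  using normal.rcos_sum[OF normal_H, of u v] by (simp add: tprod_def Let_def)

lemma zero_T: "\<zero>\<^bsub>T\<^esub> = cls 0"
  using F.coset_mult_one[of H] subgroup.subset[OF subgroup_H] by (simp add: tprod_def Let_def)

lemma cls_eqI:
  assumes "u \<in> carrier F" "v \<in> carrier F" "u - v \<in> H"
  shows "cls u = cls v"
proof -
  have "u \<in> cls v"
    using assms(3) by (auto simp: r_coset_def intro!: bexI[of _ "u - v"])
  then show ?thesis
    using F.repr_independence[OF _ assms(2) subgroup_H] by simp
qed

lemma pt_eq: "pt x y = cls (frag_of (x, y))"
  by (simp add: pure_tensor_def)

lemma pt_closed [simp]: "\<lbrakk>x \<in> carrier X; y \<in> carrier Y\<rbrakk> \<Longrightarrow> pt x y \<in> carrier T"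
  by (auto simp: carrier_T pt_eq)

lemma add_carrier: "\<lbrakk>u \<in> carrier F; v \<in> carrier F\<rbrakk> \<Longrightarrow> u + v \<in> carrier F"
  using F.m_closed[of u v] by simp

lemma pt_add_left:
  assumes "x \<in> carrier X" "x' \<in> carrier X" "y \<in> carrier Y"
  shows "pt (x \<oplus>\<^bsub>X\<^esub> x') y = pt x y \<oplus>\<^bsub>T\<^esub> pt x' y"
proof -
  have "frag_of (x \<oplus>\<^bsub>X\<^esub> x', y) - frag_of (x, y) - frag_of (x', y) \<in> H"
    using assms by (intro gens_H) (auto simp: gens_def)
  then have "cls (frag_of (x \<oplus>\<^bsub>X\<^esub> x', y)) = cls (frag_of (x, y) + frag_of (x', y))"
    using assms by (intro cls_eqI add_carrier frag_carrier) (auto simp: algebra_simps)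
  then show ?thesis
    using assms by (simp only: pt_eq cls_add[OF frag_carrier frag_carrier])
qed

lemma pt_add_right:
  assumes "x \<in> carrier X" "y \<in> carrier Y" "y' \<in> carrier Y"
  shows "pt x (y \<oplus>\<^bsub>Y\<^esub> y') = pt x y \<oplus>\<^bsub>T\<^esub> pt x y'"
proof -
  have "frag_of (x, y \<oplus>\<^bsub>Y\<^esub> y') - frag_of (x, y) - frag_of (x, y') \<in> H"
    using assms by (intro gens_H) (auto simp: gens_def)
  then have "cls (frag_of (x, y \<oplus>\<^bsub>Y\<^esub> y')) = cls (frag_of (x, y) + frag_of (x, y'))"
    using assms by (intro cls_eqI add_carrier frag_carrier) (auto simp: algebra_simps)
  then show ?thesis
    using assms by (simp only: pt_eq cls_add[OF frag_carrier frag_carrier])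
qed

lemma pt_balanced:
  assumes "x \<in> carrier X" "s \<in> S" "y \<in> carrier Y"
  shows "pt (r x s) y = pt x (l s y)"
  unfolding pt_eq using assms
  by (intro cls_eqI frag_carrier gens_H r_closed l_closed) (auto simp: gens_def)

lemma pt_zero_left:
  assumes "y \<in> carrier Y"
  shows "pt \<zero>\<^bsub>X\<^esub> y = \<zero>\<^bsub>T\<^esub>"
  using pt_add_left[of "\<zero>\<^bsub>X\<^esub>" "\<zero>\<^bsub>X\<^esub>" y] assms by simp

text \<open>
  Negatives of pure tensors are pure tensors, so sums of them reach every element.
\<close>

lemma tprod_induct [consumes 1, case_names zero add pure]:
  assumes z: "z \<in> carrier T"
    and zero: "Q \<zero>\<^bsub>T\<^esub>"
    and add: "\<And>u v. \<lbrakk>u \<in> carrier T; v \<in> carrier T; Q u; Q v\<rbrakk> \<Longrightarrow> Q (u \<oplus>\<^bsub>T\<^esub> v)"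
    and pure: "\<And>x y. \<lbrakk>x \<in> carrier X; y \<in> carrier Y\<rbrakk> \<Longrightarrow> Q (pt x y)"
  shows "Q z"
proof -
  have cls: "cls u \<in> carrier T" if "Poly_Mapping.keys u \<subseteq> carrier X \<times> carrier Y" for u
    using that by (simp add: carrier_T)
  have "Q (cls u) \<and> Q (cls (- u))" if "Poly_Mapping.keys u \<subseteq> carrier X \<times> carrier Y" for u
  proof (rule free_Abelian_group_induct[OF that, where P = "\<lambda>u. Q (cls u) \<and> Q (cls (- u))"], goal_cases)
    case 1
    show ?case using zero by (simp add: zero_T)
  next
    case (2 u v)
    have "cls (u - v) = cls u \<oplus>\<^bsub>T\<^esub> cls (- v)" "cls (- (u - v)) = cls (- u) \<oplus>\<^bsub>T\<^esub> cls v"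
      using 2(1,2) by (simp_all add: cls_add)
    then show ?case using 2 by (simp add: add cls)
  next
    case (3 a)
    obtain x y where a: "a = (x, y)" "x \<in> carrier X" "y \<in> carrier Y" using 3 by auto
    have "cls (- frag_of (x, y)) = cls (- frag_of (x, y)) \<oplus>\<^bsub>T\<^esub> (pt x y \<oplus>\<^bsub>T\<^esub> pt (\<ominus>\<^bsub>X\<^esub> x) y)"
      using a cls[of "- frag_of (x, y)"]
      by (simp add: pt_add_left[symmetric] X.r_neg pt_zero_left)
    also have "\<dots> = (cls (- frag_of (x, y)) \<oplus>\<^bsub>T\<^esub> pt x y) \<oplus>\<^bsub>T\<^esub> pt (\<ominus>\<^bsub>X\<^esub> x) y"
      using a cls[of "- frag_of (x, y)"] by (simp add: T.a_assoc)
    also have "\<dots> = pt (\<ominus>\<^bsub>X\<^esub> x) y"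
      using a by (simp add: pt_eq[of x] cls_add zero_T[symmetric])
    finally show ?case using a pure by (simp add: pt_eq[symmetric])
  qed
  then show ?thesis using z by (auto simp: carrier_T)
qed

lemma tprod_universal:
  assumes "abelian_group G"
    and closed: "\<And>x y. \<lbrakk>x \<in> carrier X; y \<in> carrier Y\<rbrakk> \<Longrightarrow> g x y \<in> carrier G"
    and add_left: "\<And>x x' y. \<lbrakk>x \<in> carrier X; x' \<in> carrier X; y \<in> carrier Y\<rbrakk> \<Longrightarrow>
      g (x \<oplus>\<^bsub>X\<^esub> x') y = g x y \<oplus>\<^bsub>G\<^esub> g x' y"
    and add_right: "\<And>x y y'. \<lbrakk>x \<in> carrier X; y \<in> carrier Y; y' \<in> carrier Y\<rbrakk> \<Longrightarrow>
      g x (y \<oplus>\<^bsub>Y\<^esub> y') = g x y \<oplus>\<^bsub>G\<^esub> g x y'"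
    and balanced: "\<And>x s y. \<lbrakk>x \<in> carrier X; s \<in> S; y \<in> carrier Y\<rbrakk> \<Longrightarrow> g (r x s) y = g x (l s y)"
  obtains h where "h \<in> hom (add_monoid T) (add_monoid G)"
    and "\<And>x y. \<lbrakk>x \<in> carrier X; y \<in> carrier Y\<rbrakk> \<Longrightarrow> h (pt x y) = g x y"
proof -
  interpret G: abelian_group G by fact
  obtain k where k: "k \<in> hom F (add_monoid G)"
    "\<And>z. z \<in> carrier X \<times> carrier Y \<Longrightarrow> k (frag_of z) = case_prod g z"
    using comm_group.free_Abelian_group_universal[OF G.a_comm_group, of "case_prod g" "carrier X \<times> carrier Y"]
      closed by (auto simp: image_subset_iff)
  interpret k: group_hom F "add_monoid G" k
    using k(1) by (simp add: group_hom_def group_hom_axioms_def G.a_group)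
  have k_diff: "k (u - v) = k u \<ominus>\<^bsub>G\<^esub> k v" if "u \<in> carrier F" "v \<in> carrier F" for u v
    using k.hom_mult[of u "- v"] k.hom_inv[of v] that
    by (simp add: a_minus_def a_inv_def)
  have cancel: "a \<oplus>\<^bsub>G\<^esub> (b \<oplus>\<^bsub>G\<^esub> (\<ominus>\<^bsub>G\<^esub> a \<oplus>\<^bsub>G\<^esub> \<ominus>\<^bsub>G\<^esub> b)) = \<zero>\<^bsub>G\<^esub>"
    if "a \<in> carrier G" "b \<in> carrier G" for a b
    using that by (simp add: G.minus_add[symmetric] G.a_assoc[symmetric] G.r_neg)
  have "gens \<subseteq> kernel F (add_monoid G) k"
  proof
    fix u assume u: "u \<in> gens"
    then have "k u = \<zero>\<^bsub>G\<^esub>"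
      unfolding gens_def
      by (auto simp: k_diff diff_carrier k(2) closed add_left add_right balanced r_closed l_closed
          G.minus_eq G.r_neg G.a_assoc cancel
          simp del: carrier_free_Abelian_group_iff intro!: frag_carrier)
    then show "u \<in> kernel F (add_monoid G) k"
      using u gens_carrier unfolding kernel_def by (simp del: carrier_free_Abelian_group_iff) blast
  qed
  then have "H \<subseteq> kernel F (add_monoid G) k"
    unfolding H_eq by (rule F.generate_subgroup_incl[OF _ k.subgroup_kernel])
  then obtain h where h: "h \<in> hom (F Mod H) (add_monoid G)" "\<And>u. u \<in> carrier F \<Longrightarrow> h (cls u) = k u"
    using k.FactGroup_universal_kernel[OF normal_H] by blast
  show thesis
  proof (rule that)
    show "h \<in> hom (add_monoid T) (add_monoid G)" using h(1) by (simp add: hom_def T_simps)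
    show "h (pt x y) = g x y" if "x \<in> carrier X" "y \<in> carrier Y" for x y
      using h(2)[OF frag_carrier[OF that]] k(2)[of "(x, y)"] that by (simp add: pt_eq)
  qed
qed

abbreviation "sc_frag c \<equiv> frag_extend (\<lambda>(x, y). frag_of (sc c x, y))"

lemma sc_frag_carrier: "u \<in> carrier F \<Longrightarrow> sc_frag c u \<in> carrier F"
  using keys_frag_extend[of "\<lambda>(x, y). frag_of (sc c x, y)" u] by (fastforce simp: sc_closed)

lemma sc_frag_H: "u \<in> H \<Longrightarrow> sc_frag c u \<in> H"
proof -
  have "subgroup {u \<in> carrier F. sc_frag c u \<in> H} F"
  proof
    show "{u \<in> carrier F. sc_frag c u \<in> H} \<subseteq> carrier F" by blast
  next
    fix u v assume "u \<in> {u \<in> carrier F. sc_frag c u \<in> H}" "v \<in> {u \<in> carrier F. sc_frag c u \<in> H}"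
    then show "u \<otimes>\<^bsub>F\<^esub> v \<in> {u \<in> carrier F. sc_frag c u \<in> H}"
      using subgroup.m_closed[OF subgroup_H] add_carrier[of u v] by (auto simp: frag_extend_add)
  next
    show "\<one>\<^bsub>F\<^esub> \<in> {u \<in> carrier F. sc_frag c u \<in> H}"
      using subgroup.one_closed[OF subgroup_H] by simp
  next
    fix u assume u: "u \<in> {u \<in> carrier F. sc_frag c u \<in> H}"
    then have "- sc_frag c u \<in> H"
      using subgroup.m_inv_closed[OF subgroup_H] sc_frag_carrier[of u c] by force
    then show "inv\<^bsub>F\<^esub> u \<in> {u \<in> carrier F. sc_frag c u \<in> H}"
      using u by (simp add: frag_extend_minus)
  qed
  moreover have "gens \<subseteq> {u \<in> carrier F. sc_frag c u \<in> H}"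
  proof
    fix u assume u: "u \<in> gens"
    then have "sc_frag c u \<in> gens"
      unfolding gens_def
      apply (elim UnE)
        apply (rule UnI1, rule UnI1, force simp: frag_extend_diff sc_add intro: sc_closed)
       apply (rule UnI1, rule UnI2, force simp: frag_extend_diff intro: sc_closed)
      apply (rule UnI2, force simp: frag_extend_diff sc_r intro: sc_closed)
      done
    then show "u \<in> {u \<in> carrier F. sc_frag c u \<in> H}" using u gens_carrier gens_H by blast
  qed
  ultimately have "H \<subseteq> {u \<in> carrier F. sc_frag c u \<in> H}"
    using F.generate_subgroup_incl[of gens "{u \<in> carrier F. sc_frag c u \<in> H}"]
    by (simp add: H_eq del: carrier_free_Abelian_group_iff)
  then show "u \<in> H \<Longrightarrow> sc_frag c u \<in> H" by blast
qed

lemma smult_cls: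
  assumes u: "u \<in> carrier F"
  shows "c \<odot>\<^bsub>T\<^esub> cls u = cls (sc_frag c u)"
proof -
  have "cls (sc_frag c v) = cls (sc_frag c u)" if v: "v \<in> cls u" for v
  proof -
    obtain h where h: "h \<in> H" "v = h + u" using v by (auto simp: r_coset_def)
    have "h \<in> carrier F" using subgroup.subset[OF subgroup_H] h by blast
    then have "v \<in> carrier F" using h u add_carrier by blast
    then show ?thesis
      using sc_frag_H[OF h(1), of c] u h(2)
      by (intro cls_eqI sc_frag_carrier) (simp_all add: frag_extend_add)
  qed
  moreover have "u \<in> cls u"
    by (rule F.rcos_self[OF u subgroup_H])
  ultimately have "(\<Union>v\<in>cls u. cls (sc_frag c v)) = cls (sc_frag c u)"
    by (intro SUP_eq_const) blast+
  then show ?thesis by (simp add: tprod_def Let_def)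
qed

lemma smult_pt: "\<lbrakk>x \<in> carrier X; y \<in> carrier Y\<rbrakk> \<Longrightarrow> c \<odot>\<^bsub>T\<^esub> pt x y = pt (sc c x) y"
  unfolding pt_eq by (subst smult_cls) simp_all

lemma smult_T_closed: "z \<in> carrier T \<Longrightarrow> c \<odot>\<^bsub>T\<^esub> z \<in> carrier T"
  using sc_frag_carrier by (force simp: carrier_T smult_cls)

lemma smult_T_add:
  assumes "z \<in> carrier T" "z' \<in> carrier T"
  shows "c \<odot>\<^bsub>T\<^esub> (z \<oplus>\<^bsub>T\<^esub> z') = c \<odot>\<^bsub>T\<^esub> z \<oplus>\<^bsub>T\<^esub> c \<odot>\<^bsub>T\<^esub> z'"
proof -
  obtain u u' where u: "u \<in> carrier F" "u' \<in> carrier F" "z = cls u" "z' = cls u'"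
    using assms by (auto simp: carrier_T)
  show ?thesis
    unfolding u(3,4) using u(1,2)
    by (simp add: cls_add smult_cls add_carrier sc_frag_carrier frag_extend_add
        del: carrier_free_Abelian_group_iff)
qed

end

lemma (in tensor_product) kmodule_T:
  assumes "sc = smult X'" "carrier X' = carrier X" "add X' = add X" "kmodule X'"
  shows "kmodule T"
proof -
  interpret X': kmodule X' by fact
  have zero: "c \<odot>\<^bsub>T\<^esub> \<zero>\<^bsub>T\<^esub> = \<zero>\<^bsub>T\<^esub>" for c
    by (simp add: zero_T smult_cls)
  show ?thesis
  proof unfold_locales
    fix z c d assume z: "z \<in> carrier T"
    show "(c + d) \<odot>\<^bsub>T\<^esub> z = c \<odot>\<^bsub>T\<^esub> z \<oplus>\<^bsub>T\<^esub> d \<odot>\<^bsub>T\<^esub> z"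
      using z
    proof (induction rule: tprod_induct)
      case (pure x y)
      then have "sc (c + d) x = sc c x \<oplus>\<^bsub>X\<^esub> sc d x"
        using X'.smult_l_distr[of x c d] assms by simp
      then show ?case using pure by (simp add: smult_pt sc_closed pt_add_left)
    qed (simp_all add: zero smult_T_add smult_T_closed T.a_ac)
    show "c \<odot>\<^bsub>T\<^esub> (d \<odot>\<^bsub>T\<^esub> z) = (c * d) \<odot>\<^bsub>T\<^esub> z"
      using z
    proof (induction rule: tprod_induct)
      case (pure x y)
      then have "sc (c * d) x = sc c (sc d x)"
        using X'.smult_assoc[of x c d] assms by simp
      then show ?case using pure by (simp add: smult_pt sc_closed)
    qed (simp_all add: zero smult_T_add smult_T_closed)
    show "1 \<odot>\<^bsub>T\<^esub> z = z"
      using z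
    proof (induction rule: tprod_induct)
      case (pure x y)
      then have "sc 1 x = x"
        using X'.smult_one[of x] assms by simp
      then show ?case using pure by (simp add: smult_pt)
    qed (simp_all add: zero smult_T_add smult_T_closed)
  qed (simp_all add: smult_T_add smult_T_closed)
qed

locale kmodule_pair = X: kmodule X + Y: kmodule Y
  for X :: "('k::field, 'x, 'c) module_scheme" and Y :: "('k, 'y, 'd) module_scheme"
begin

sublocale tensor_product UNIV X "\<lambda>x c. c \<odot>\<^bsub>X\<^esub> x" Y "smult Y" "smult X"
  by unfold_locales (simp_all add: X.smult_r_distr X.smult_assoc mult.commute)

lemma tensor_k_eq: "tensor_k X Y = T" and pure_k_eq: "pure_k X Y = pt"
  by (simp_all add: tensor_k_def pure_k_def)

lemma kmodule_tensor_k: "kmodule (tensor_k X Y)"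
  unfolding tensor_k_eq by (rule kmodule_T[of X]) (simp_all add: X.kmodule_axioms)

lemma pure_k_smult_right:
  "\<lbrakk>x \<in> carrier X; y \<in> carrier Y\<rbrakk> \<Longrightarrow> c \<odot>\<^bsub>tensor_k X Y\<^esub> pure_k X Y x y = pure_k X Y x (c \<odot>\<^bsub>Y\<^esub> y)"
  unfolding tensor_k_eq pure_k_eq by (simp add: smult_pt pt_balanced)

text \<open>
  This is what makes \<open>tensor_k_lift\<close> defined on the whole tensor product. The induction hypothesis is
  that adding \<open>z\<close> preserves representability, so that only one pure tensor has to be appended at a time.
\<close>

lemma sum_of_pure_tensors:
  assumes "z \<in> carrier (tensor_k X Y)"
  obtains n xs ys where "\<forall>s<(n::nat). xs s \<in> carrier X \<and> ys s \<in> carrier Y"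
    "z = (\<Oplus>\<^bsub>tensor_k X Y\<^esub>s\<in>{..<n}. pure_k X Y (xs s) (ys s))"
proof -
  define rep where "rep z \<longleftrightarrow> (\<exists>n xs ys. (\<forall>s<(n::nat). xs s \<in> carrier X \<and> ys s \<in> carrier Y) \<and>
     z = (\<Oplus>\<^bsub>T\<^esub>s\<in>{..<n}. pt (xs s) (ys s)))" for z
  have rep_closed: "u \<in> carrier T" if "rep u" for u
    using that by (auto simp: rep_def intro!: T.finsum_closed)
  have "\<forall>u. rep u \<longrightarrow> rep (u \<oplus>\<^bsub>T\<^esub> z)"
    using assms unfolding tensor_k_eq
  proof (induction rule: tprod_induct)
    case zero
    then show ?case using rep_closed by simp
  next
    case (add v w)
    then show ?case using rep_closed by (metis T.a_assoc)
  next
    case (pure x y)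
    show ?case
    proof (intro allI impI)
      fix u assume "rep u"
      then obtain n xs ys where u: "\<forall>s<(n::nat). xs s \<in> carrier X \<and> ys s \<in> carrier Y"
        "u = (\<Oplus>\<^bsub>T\<^esub>s\<in>{..<n}. pt (xs s) (ys s))" by (auto simp: rep_def)
      have "u = (\<Oplus>\<^bsub>T\<^esub>s\<in>{..<n}. pt ((xs(n := x)) s) ((ys(n := y)) s))"
        unfolding u(2) using u(1) by (intro T.finsum_cong') auto
      then have "u \<oplus>\<^bsub>T\<^esub> pt x y = (\<Oplus>\<^bsub>T\<^esub>s\<in>{..<Suc n}. pt ((xs(n := x)) s) ((ys(n := y)) s))"
        using u(1) pure rep_closed[OF \<open>rep u\<close>]
        by (simp add: lessThan_Suc T.finsum_insert T.a_comm Pi_def del: fun_upd_apply)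
           (simp add: T.a_comm)
      then show "rep (u \<oplus>\<^bsub>T\<^esub> pt x y)"
        unfolding rep_def using u(1) pure
        by (intro exI[of _ "Suc n"] exI[of _ "xs(n := x)"] exI[of _ "ys(n := y)"]) (auto simp: less_Suc_eq)
    qed
  qed
  moreover have "rep \<zero>\<^bsub>T\<^esub>"
    unfolding rep_def by (intro exI[of _ 0]) simp
  ultimately have "rep z" using assms by (metis T.l_zero tensor_k_eq)
  then show thesis using that unfolding rep_def tensor_k_eq pure_k_eq by blast
qed

text \<open>
  The value of \<open>tensor_k_lift\<close> is independent of the chosen representation as a sum of pure tensors
  because the induced homomorphism computes it.
\<close>

lemma tensor_k_lift_hom:
  assumes G: "abelian_group G"
    and "\<And>x y. \<lbrakk>x \<in> carrier X; y \<in> carrier Y\<rbrakk> \<Longrightarrow> g x y \<in> carrier G"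
    and "\<And>x x' y. \<lbrakk>x \<in> carrier X; x' \<in> carrier X; y \<in> carrier Y\<rbrakk> \<Longrightarrow>
      g (x \<oplus>\<^bsub>X\<^esub> x') y = g x y \<oplus>\<^bsub>G\<^esub> g x' y"
    and "\<And>x y y'. \<lbrakk>x \<in> carrier X; y \<in> carrier Y; y' \<in> carrier Y\<rbrakk> \<Longrightarrow>
      g x (y \<oplus>\<^bsub>Y\<^esub> y') = g x y \<oplus>\<^bsub>G\<^esub> g x y'"
    and "\<And>x s y. \<lbrakk>x \<in> carrier X; y \<in> carrier Y\<rbrakk> \<Longrightarrow> g (s \<odot>\<^bsub>X\<^esub> x) y = g x (s \<odot>\<^bsub>Y\<^esub> y)"
  obtains h where "h \<in> hom (add_monoid (tensor_k X Y)) (add_monoid G)"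
    and "\<And>x y. \<lbrakk>x \<in> carrier X; y \<in> carrier Y\<rbrakk> \<Longrightarrow> h (pure_k X Y x y) = g x y"
    and "\<And>z. z \<in> carrier (tensor_k X Y) \<Longrightarrow> tensor_k_lift X Y G g z = h z"
proof -
  interpret G: abelian_group G by fact
  obtain h where h: "h \<in> hom (add_monoid (tensor_k X Y)) (add_monoid G)"
    "\<And>x y. \<lbrakk>x \<in> carrier X; y \<in> carrier Y\<rbrakk> \<Longrightarrow> h (pure_k X Y x y) = g x y"
    unfolding tensor_k_eq pure_k_eq using tprod_universal[of G g, OF assms] by blast
  have sum: "h (\<Oplus>\<^bsub>tensor_k X Y\<^esub>s\<in>{..<n}. pure_k X Y (xs s) (ys s)) = (\<Oplus>\<^bsub>G\<^esub>s\<in>{..<n}. g (xs s) (ys s))"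
    if "\<forall>s<(n::nat). xs s \<in> carrier X \<and> ys s \<in> carrier Y" for n xs ys
  proof -
    have "h (\<Oplus>\<^bsub>tensor_k X Y\<^esub>s\<in>{..<n}. pure_k X Y (xs s) (ys s))
        = (\<Oplus>\<^bsub>G\<^esub>s\<in>{..<n}. h (pure_k X Y (xs s) (ys s)))"
      using that by (intro hom_finsum[OF _ G h(1)]) (auto simp: tensor_k_eq pure_k_eq abelian_group_T)
    also have "\<dots> = (\<Oplus>\<^bsub>G\<^esub>s\<in>{..<n}. g (xs s) (ys s))"
      using that assms(2) by (intro G.finsum_cong') (auto simp: h(2))
    finally show ?thesis .
  qed
  have "tensor_k_lift X Y G g z = h z" if z: "z \<in> carrier (tensor_k X Y)" for z
    unfolding tensor_k_lift_def
  proof (rule the_equality)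
    obtain n xs ys where "\<forall>s<(n::nat). xs s \<in> carrier X \<and> ys s \<in> carrier Y"
      "z = (\<Oplus>\<^bsub>tensor_k X Y\<^esub>s\<in>{..<n}. pure_k X Y (xs s) (ys s))"
      using sum_of_pure_tensors[OF z] .
    then show "\<exists>n xs ys. (\<forall>s<(n::nat). xs s \<in> carrier X \<and> ys s \<in> carrier Y) \<and>
     z = (\<Oplus>\<^bsub>tensor_k X Y\<^esub>s\<in>{..<n}. pure_k X Y (xs s) (ys s)) \<and>
     h z = (\<Oplus>\<^bsub>G\<^esub>s\<in>{..<n}. g (xs s) (ys s))"
      using sum by blast
  qed (use sum in auto)
  then show thesis using that h by blast
qed

end

section \<open>The isomorphism between exterior powers and alternating tensors, with coefficients\<close>

lemma kmodule_ext_power: "kmodule (ext_power r :: ('k::field, ('b, 'k) tensors set) module)"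
proof -
  have "abelian_group (ext_power r :: ('k, ('b, 'k) tensors set) module)"
  proof (rule abelian_groupI)
    fix x assume "x \<in> carrier (ext_power r :: ('k, ('b, 'k) tensors set) module)"
    then obtain t :: "('b, 'k) tensors" where "t \<in> tpow r" "x = ext_class t" by (auto simp: carrier_ext_power)
    then show "\<exists>y\<in>carrier (ext_power r). y \<oplus>\<^bsub>ext_power r\<^esub> x = \<zero>\<^bsub>ext_power r\<^esub>"
      by (intro bexI[of _ "ext_class (- t)"]) (auto simp: carrier_ext_power ext_power_ops tpow_minus)
  qed (auto simp: carrier_ext_power ext_power_ops tpow_add algebra_simps)
  then show ?thesis
    unfolding kmodule_def kmodule_axioms_def
    by (auto simp: carrier_ext_power ext_power_ops tpow_tscale tensors.scale_right_distrib
        tensors.scale_left_distrib)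
qed

lemma W_module_simps:
  "carrier (W_module N r) = W N r" "s \<oplus>\<^bsub>W_module N r\<^esub> t = s + t" "\<zero>\<^bsub>W_module N r\<^esub> = 0"
  "c \<odot>\<^bsub>W_module N r\<^esub> t = tscale c t"
  by (simp_all add: W_module_def tensor_submodule_def)

lemma kmodule_W_module: "kmodule (W_module N r :: ('k::field, ('b, 'k) tensors) module)"
proof -
  have "abelian_group (W_module N r :: ('k, ('b, 'k) tensors) module)"
  proof (rule abelian_groupI)
    fix t assume "t \<in> carrier (W_module N r :: ('k, ('b, 'k) tensors) module)"
    then show "\<exists>y\<in>carrier (W_module N r). y \<oplus>\<^bsub>W_module N r\<^esub> t = \<zero>\<^bsub>W_module N r\<^esub>"
      by (intro bexI[of _ "- t"]) (auto simp: W_module_simps W_minus)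
  qed (auto simp: W_module_simps W_add W_0 algebra_simps)
  then show ?thesis
    unfolding kmodule_def kmodule_axioms_def
    by (auto simp: W_module_simps W_tscale tensors.scale_right_distrib tensors.scale_left_distrib)
qed

lemma ant_tscale:
  fixes t :: "('b::finite, 'k::field) tensors"
  assumes "t \<in> tpow r"
  shows "ant r (tscale c t) = tscale c (ant r t)"
  by (rule poly_mapping_eqI)
    (simp add: coef_ant[OF assms] coef_ant[OF tpow_tscale[OF assms]] coef_tscale sum_distrib_left mult.assoc)

lemma ant_W:
  fixes t :: "('b::{finite,linorder}, 'k::field) tensors"
  shows "t \<in> tpow r \<Longrightarrow> ant r t \<in> W N r"
  by (intro alternating_imp_W ant_tpow alternating_coef_ant)

text \<open>
  The last parameter only fixes the type of the basis, which does not occur in \<open>X\<close>.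
\<close>

locale id_phi_setting = kmodule X for X :: "('k::field, 'x) module" +
  fixes N r :: nat and basis_type :: "'b::{finite,linorder} itself"
begin

abbreviation "E \<equiv> ext_power r :: ('k, ('b, 'k) tensors set) module"
abbreviation "V \<equiv> W_module N r :: ('k, ('b, 'k) tensors) module"

sublocale E: kmodule_pair X E
  by (intro kmodule_pair.intro kmodule_axioms kmodule_ext_power)

sublocale V: kmodule_pair X V
  by (intro kmodule_pair.intro kmodule_axioms kmodule_W_module)

lemma id_phi_hom: "id_phi N X r \<in> hom (add_monoid (tensor_k X E)) (add_monoid (tensor_k X V))" (is ?hom)
  and id_phi_pure: "\<lbrakk>x \<in> carrier X; t \<in> tpow r\<rbrakk> \<Longrightarrow>
    id_phi N X r (pure_k X E x (ext_class t)) = pure_k X V x (ant r t)"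
proof -
  interpret V': kmodule "tensor_k X V" by (rule V.kmodule_tensor_k)
  have ph: "phi r \<omega> \<in> carrier V" if "\<omega> \<in> carrier E" for \<omega> :: "('b, 'k) tensors set"
    using that by (auto simp: carrier_ext_power phi_ext_class W_module_simps ant_W)
  obtain h where h: "h \<in> hom (add_monoid (tensor_k X E)) (add_monoid (tensor_k X V))"
    "\<And>x y. \<lbrakk>x \<in> carrier X; y \<in> carrier E\<rbrakk> \<Longrightarrow> h (pure_k X E x y) = pure_k X V x (phi r y)"
    "\<And>z. z \<in> carrier (tensor_k X E) \<Longrightarrow>
      tensor_k_lift X E (tensor_k X V) (\<lambda>x \<omega>. pure_k X V x (phi r \<omega>)) z = h z"
  proof (rule E.tensor_k_lift_hom[of "tensor_k X V" "\<lambda>x \<omega>. pure_k X V x (phi r \<omega>)"])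
    show "abelian_group (tensor_k X V)" by (rule V'.abelian_group_axioms)
    fix x x' s and y y' :: "('b, 'k) tensors set" assume x: "x \<in> carrier X" and y: "y \<in> carrier E"
    show "pure_k X V x (phi r y) \<in> carrier (tensor_k X V)"
      using x ph[OF y] by (simp add: V.pure_k_eq V.tensor_k_eq)
    show "pure_k X V (x \<oplus>\<^bsub>X\<^esub> x') (phi r y) =
        pure_k X V x (phi r y) \<oplus>\<^bsub>tensor_k X V\<^esub> pure_k X V x' (phi r y)" if "x' \<in> carrier X"
      using x ph[OF y] that by (simp add: V.pure_k_eq V.tensor_k_eq V.pt_add_left)
    show "pure_k X V x (phi r (y \<oplus>\<^bsub>E\<^esub> y')) =
        pure_k X V x (phi r y) \<oplus>\<^bsub>tensor_k X V\<^esub> pure_k X V x (phi r y')" if "y' \<in> carrier E"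
    proof -
      have "phi r (y \<oplus>\<^bsub>E\<^esub> y') = phi r y \<oplus>\<^bsub>V\<^esub> phi r y'"
        using y that
        by (auto simp: carrier_ext_power ext_power_ops phi_ext_class tpow_add W_module_simps ant_add)
      then show ?thesis
        using x ph[OF y] ph[OF that] by (simp add: V.pure_k_eq V.tensor_k_eq V.pt_add_right)
    qed
    show "pure_k X V (s \<odot>\<^bsub>X\<^esub> x) (phi r y) = pure_k X V x (phi r (s \<odot>\<^bsub>E\<^esub> y))"
    proof -
      have "phi r (s \<odot>\<^bsub>E\<^esub> y) = s \<odot>\<^bsub>V\<^esub> phi r y"
        using y by (auto simp: carrier_ext_power ext_power_ops phi_ext_class tpow_tscale ant_tscale W_module_simps)
      then show ?thesis
        using x ph[OF y] by (simp add: V.pure_k_eq V.pt_balanced)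
    qed
  qed blast
  have id_phi: "id_phi N X r z = h z" if "z \<in> carrier (tensor_k X E)" for z
    using h(3)[OF that] by (simp add: id_phi_def)
  show ?hom
    using h(1) E.T.a_closed by (auto simp: hom_def id_phi Pi_def E.tensor_k_eq)
  show "id_phi N X r (pure_k X E x (ext_class t)) = pure_k X V x (ant r t)"
    if "x \<in> carrier X" "t \<in> tpow r"
  proof -
    have "ext_class t \<in> carrier E" using that by (simp add: carrier_ext_power)
    then show ?thesis
      using that h(2)[of x "ext_class t"]
      by (subst id_phi) (simp_all add: E.pure_k_eq E.tensor_k_eq phi_ext_class)
  qed
qed

text \<open>
  The inverse is induced by \<open>increasing_part\<close>, which inverts \<open>phi\<close>.
\<close>

lemma inj_on_id_phi:
  assumes "2 \<le> N" "r < 2 \<or> N \<le> r"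
  shows "inj_on (id_phi N X r) (carrier (tensor_k X E))"
proof -
  interpret E': kmodule "tensor_k X E" by (rule E.kmodule_tensor_k)
  interpret V': kmodule "tensor_k X V" by (rule V.kmodule_tensor_k)
  let ?\<psi> = "\<lambda>u :: ('b, 'k) tensors. ext_class (increasing_part r u)"
  have cl: "?\<psi> u \<in> carrier E" for u
    by (simp add: carrier_ext_power)
  obtain k where k: "k \<in> hom (add_monoid (tensor_k X V)) (add_monoid (tensor_k X E))"
    "\<And>x y. \<lbrakk>x \<in> carrier X; y \<in> carrier V\<rbrakk> \<Longrightarrow> k (pure_k X V x y) = pure_k X E x (?\<psi> y)"
  proof (rule V.tensor_k_lift_hom[of "tensor_k X E" "\<lambda>x u. pure_k X E x (?\<psi> u)"])
    show "abelian_group (tensor_k X E)" by (rule E'.abelian_group_axioms)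
    fix x x' s and y y' :: "('b, 'k) tensors" assume x: "x \<in> carrier X" and y: "y \<in> carrier V"
    show "pure_k X E x (?\<psi> y) \<in> carrier (tensor_k X E)"
      using x cl[of y] by (simp add: E.pure_k_eq E.tensor_k_eq)
    show "pure_k X E (x \<oplus>\<^bsub>X\<^esub> x') (?\<psi> y) =
        pure_k X E x (?\<psi> y) \<oplus>\<^bsub>tensor_k X E\<^esub> pure_k X E x' (?\<psi> y)" if "x' \<in> carrier X"
      using x cl[of y] that by (simp add: E.pure_k_eq E.tensor_k_eq E.pt_add_left)
    show "pure_k X E x (?\<psi> (y \<oplus>\<^bsub>V\<^esub> y')) =
        pure_k X E x (?\<psi> y) \<oplus>\<^bsub>tensor_k X E\<^esub> pure_k X E x (?\<psi> y')" if "y' \<in> carrier V"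
    proof -
      have "?\<psi> (y \<oplus>\<^bsub>V\<^esub> y') = ?\<psi> y \<oplus>\<^bsub>E\<^esub> ?\<psi> y'"
        by (simp add: W_module_simps increasing_part_add ext_power_ops)
      then show ?thesis
        using x cl by (simp add: E.pure_k_eq E.tensor_k_eq E.pt_add_right)
    qed
    show "pure_k X E (s \<odot>\<^bsub>X\<^esub> x) (?\<psi> y) = pure_k X E x (?\<psi> (s \<odot>\<^bsub>V\<^esub> y))"
    proof -
      have "?\<psi> (s \<odot>\<^bsub>V\<^esub> y) = s \<odot>\<^bsub>E\<^esub> ?\<psi> y"
        by (simp add: W_module_simps increasing_part_tscale ext_power_ops)
      then show ?thesis
        using x cl by (simp add: E.pure_k_eq E.pt_balanced)
    qed
  qed blast
  interpret h: group_hom "add_monoid (tensor_k X E)" "add_monoid (tensor_k X V)" "id_phi N X r"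
    by (simp add: group_hom_def group_hom_axioms_def id_phi_hom E'.a_group V'.a_group)
  interpret k: group_hom "add_monoid (tensor_k X V)" "add_monoid (tensor_k X E)" k
    by (simp add: group_hom_def group_hom_axioms_def k E'.a_group V'.a_group)
  have "k (id_phi N X r z) = z" if "z \<in> carrier (tensor_k X E)" for z
    using that unfolding E.tensor_k_eq
  proof (induction rule: E.tprod_induct)
    case zero
    then show ?case using h.hom_one k.hom_one by (simp add: E.tensor_k_eq)
  next
    case (add u v)
    then show ?case
      using h.hom_mult[of u v] k.hom_mult[of "id_phi N X r u" "id_phi N X r v"] h.hom_closed
      by (simp add: E.tensor_k_eq)
  next
    case (pure x y)
    then obtain t :: "('b, 'k) tensors" where t: "t \<in> tpow r" "y = ext_class t"
      by (auto simp: carrier_ext_power)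
    have "ant r t \<in> carrier V" using t by (simp add: W_module_simps ant_W)
    then show ?case
      using pure t id_phi_pure[of x t] k(2)[of x "ant r t"]
      by (simp add: E.pure_k_eq ext_class_increasing_part_ant)
  qed
  then show ?thesis by (rule inj_on_inverseI)
qed

end


section \<open>Bimodules over the \<open>N\<close>-symmetric algebra\<close>

lemma ideal_sym_ideal: "ideal (sym_ideal N :: ('b, 'k::field) tensors set) tensor_algebra"
  unfolding sym_ideal_def by (rule ring.genideal_ideal[OF ring_tensor_algebra]) simp

lemma
  fixes s t :: "('b, 'k::field) tensors"
  shows sym_class_closed: "sym_class N t \<in> carrier (sym_algebra N)"
  and sym_class_add: "sym_class N (s + t) = sym_class N s \<oplus>\<^bsub>sym_algebra N\<^esub> sym_class N t"
  and sym_class_mult: "sym_class N (s * t) = sym_class N s \<otimes>\<^bsub>sym_algebra N\<^esub> sym_class N t"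
  and sym_class_one: "sym_class N (1 :: ('b, 'k) tensors) = \<one>\<^bsub>sym_algebra N\<^esub>"
proof -
  interpret h: ring_hom_ring "tensor_algebra :: ('b, 'k::field) tensors ring" "sym_algebra N"
    "(+>\<^bsub>tensor_algebra\<^esub>) (sym_ideal N)"
    unfolding sym_algebra_def by (rule ideal.rcos_ring_hom_ring[OF ideal_sym_ideal])
  show "sym_class N t \<in> carrier (sym_algebra N)"
    and "sym_class N (s + t) = sym_class N s \<oplus>\<^bsub>sym_algebra N\<^esub> sym_class N t"
    and "sym_class N (s * t) = sym_class N s \<otimes>\<^bsub>sym_algebra N\<^esub> sym_class N t"
    and "sym_class N (1 :: ('b, 'k) tensors) = \<one>\<^bsub>sym_algebra N\<^esub>"
    using h.hom_add[of s t] h.hom_mult[of s t] h.hom_one h.hom_closed[of t] by (simp_all add: sym_class_def)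
qed

lemma scalar_commute: "scalar c * t = t * scalar c"
proof -
  have "scalar c * (\<Sum>w\<in>Poly_Mapping.keys t. wmon w (coef t w)) = (\<Sum>w\<in>Poly_Mapping.keys t. wmon w (coef t w)) * scalar c"
    unfolding sum_distrib_left sum_distrib_right scalar_def by (simp add: mon_mult mult.commute)
  then show ?thesis by (simp only: sum_mon)
qed

locale sym_bimod =
  fixes N :: nat and M :: "(('b, 'k::field) tensors set, 'm, 'd) bimodule_scheme"
  assumes sym: "sym_bimodule N M"
begin

sublocale bimodule "sym_algebra N" M
  using sym by (simp add: sym_bimodule_def)

lemma lact_closed [simp]: "m \<in> carrier M \<Longrightarrow> lact N M t m \<in> carrier M"
  and ract_closed [simp]: "m \<in> carrier M \<Longrightarrow> ract N M m t \<in> carrier M"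
  by (simp_all add: lact_def ract_def l_closed r_closed sym_class_closed)

lemma lact_add: "m \<in> carrier M \<Longrightarrow> lact N M (s + t) m = lact N M s m \<oplus>\<^bsub>M\<^esub> lact N M t m"
  and ract_add: "m \<in> carrier M \<Longrightarrow> ract N M m (s + t) = ract N M m s \<oplus>\<^bsub>M\<^esub> ract N M m t"
  by (simp_all add: lact_def ract_def sym_class_add l_distrib_scalar r_distrib_scalar sym_class_closed)

lemma lact_distrib: "\<lbrakk>m \<in> carrier M; m' \<in> carrier M\<rbrakk> \<Longrightarrow>
    lact N M t (m \<oplus>\<^bsub>M\<^esub> m') = lact N M t m \<oplus>\<^bsub>M\<^esub> lact N M t m'"
  and ract_distrib: "\<lbrakk>m \<in> carrier M; m' \<in> carrier M\<rbrakk> \<Longrightarrow>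
    ract N M (m \<oplus>\<^bsub>M\<^esub> m') t = ract N M m t \<oplus>\<^bsub>M\<^esub> ract N M m' t"
  by (simp_all add: lact_def ract_def l_distrib r_distrib sym_class_closed)

lemma lact_mult: "m \<in> carrier M \<Longrightarrow> lact N M (s * t) m = lact N M s (lact N M t m)"
  and ract_mult: "m \<in> carrier M \<Longrightarrow> ract N M m (s * t) = ract N M (ract N M m s) t"
  by (simp_all add: lact_def ract_def sym_class_mult l_assoc r_assoc sym_class_closed)

lemma ract_lact: "m \<in> carrier M \<Longrightarrow> ract N M (lact N M s m) t = lact N M s (ract N M m t)"
  by (simp add: lact_def ract_def lr_assoc sym_class_closed)

lemma lact_scalar: "m \<in> carrier M \<Longrightarrow> lact N M (scalar c) m = ract N M m (scalar c)"
  using sym by (simp add: sym_bimodule_def lact_def ract_def)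

lemma lact_1: "m \<in> carrier M \<Longrightarrow> lact N M 1 m = m"
  by (simp add: lact_def sym_class_one l_one)

lemma lact_tscale: "m \<in> carrier M \<Longrightarrow> lact N M (tscale c t) m = lact N M (scalar c) (lact N M t m)"
  by (simp add: tscale_def lact_mult)

lemma lact_lact_scalar:
  "m \<in> carrier M \<Longrightarrow> lact N M t (lact N M (scalar c) m) = lact N M (scalar c) (lact N M t m)"
  by (simp add: lact_mult[symmetric] scalar_commute)

lemma ract_tscale: "m \<in> carrier M \<Longrightarrow> ract N M m (tscale c t) = lact N M (scalar c) (ract N M m t)"
  by (simp add: tscale_def ract_mult lact_scalar[symmetric] ract_lact)

lemma kspace_simps:
  "carrier (kspace N M) = carrier M" "add (kspace N M) = add M" "\<zero>\<^bsub>kspace N M\<^esub> = \<zero>\<^bsub>M\<^esub>"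
  "c \<odot>\<^bsub>kspace N M\<^esub> m = lact N M (scalar c) m"
  by (simp_all add: kspace_def)

lemma kmodule_kspace: "kmodule (kspace N M)"
proof -
  have "abelian_group (kspace N M)"
    by (rule abelian_groupI; unfold kspace_simps;
        (rule M.a_closed | rule M.zero_closed | rule M.a_assoc | rule M.a_comm | rule M.l_zero
          | (rule bexI, rule M.l_neg, assumption, rule M.a_inv_closed));
        assumption)
  then show ?thesis
    unfolding kmodule_def kmodule_axioms_def
    by (auto simp: kspace_simps lact_distrib lact_mult[symmetric] scalar_mult scalar_add lact_add scalar_1 lact_1)
qed

end

text \<open>
  The middle tensor product over the algebra inherits its \<open>k\<close>-action from the left action on \<open>M\<close>.
\<close>

locale bimod_pair = M: sym_bimod N M + P: sym_bimod N P
  for N :: nat and M :: "(('b, 'k::field) tensors set, 'm, 'c) bimodule_scheme"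
    and P :: "(('b, 'k) tensors set, 'p, 'd) bimodule_scheme"
begin

sublocale A: tensor_product "carrier (sym_algebra N)" M "rsmult M" P "smult P" "\<lambda>c. lact N M (scalar c)"
proof (intro tensor_product.intro tensor_product_axioms.intro)
  fix x c and s :: "('b, 'k) tensors set" assume "x \<in> carrier M" "s \<in> carrier (sym_algebra N)"
  then show "lact N M (scalar c) (rsmult M x s) = rsmult M (lact N M (scalar c) x) s"
    by (simp add: lact_def M.lr_assoc sym_class_closed)
qed (simp_all add: M.M.abelian_group_axioms P.M.abelian_group_axioms M.r_closed P.l_closed M.lact_distrib)

lemma tensor_A_eq: "tensor_A N M P = A.T" and pure_A_eq: "pure_A N M P = A.pt"
  by (simp_all add: tensor_A_def pure_A_def)

lemma kmodule_tensor_A: "kmodule (tensor_A N M P)"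
  unfolding tensor_A_eq
  by (rule A.kmodule_T[of "kspace N M"]) (simp_all add: M.kmodule_kspace M.kspace_simps fun_eq_iff)

lemma pure_A_closed [simp]:
  "\<lbrakk>x \<in> carrier M; y \<in> carrier P\<rbrakk> \<Longrightarrow> pure_A N M P x y \<in> carrier (tensor_A N M P)"
  by (simp add: tensor_A_eq pure_A_eq)

lemma pure_A_add_left: "\<lbrakk>x \<in> carrier M; x' \<in> carrier M; y \<in> carrier P\<rbrakk> \<Longrightarrow>
    pure_A N M P (x \<oplus>\<^bsub>M\<^esub> x') y = pure_A N M P x y \<oplus>\<^bsub>tensor_A N M P\<^esub> pure_A N M P x' y"
  and pure_A_add_right: "\<lbrakk>x \<in> carrier M; y \<in> carrier P; y' \<in> carrier P\<rbrakk> \<Longrightarrow>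
    pure_A N M P x (y \<oplus>\<^bsub>P\<^esub> y') = pure_A N M P x y \<oplus>\<^bsub>tensor_A N M P\<^esub> pure_A N M P x y'"
  by (simp_all add: tensor_A_eq pure_A_eq A.pt_add_left A.pt_add_right)

lemma pure_A_smult_left: "\<lbrakk>x \<in> carrier M; y \<in> carrier P\<rbrakk> \<Longrightarrow>
    pure_A N M P (lact N M (scalar c) x) y = c \<odot>\<^bsub>tensor_A N M P\<^esub> pure_A N M P x y"
  by (simp add: tensor_A_eq pure_A_eq A.smult_pt)

text \<open>
  A scalar moves from \<open>P\<close> to \<open>M\<close> through the right action on \<open>M\<close>, where it agrees with the left action.
\<close>

lemma pure_A_smult_right:
  assumes "x \<in> carrier M" "y \<in> carrier P"
  shows "pure_A N M P x (lact N P (scalar c) y) = c \<odot>\<^bsub>tensor_A N M P\<^esub> pure_A N M P x y"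
proof -
  have "pure_A N M P (ract N M x (scalar c)) y = pure_A N M P x (lact N P (scalar c) y)"
    unfolding ract_def lact_def pure_A_eq using assms by (intro A.pt_balanced sym_class_closed)
  then show ?thesis
    using assms by (simp add: M.lact_scalar[symmetric] pure_A_smult_left)
qed

end

section \<open>Splitting alternating tensors\<close>

lemma ant_increasing_sum:
  fixes t :: "('b::{finite,linorder}, 'k::field) tensors"
  assumes "t \<in> tpow r" "alternating (coef t)"
  shows "t = (\<Sum>w | length w = r \<and> sorted_wrt (<) w. tscale (coef t w) (ant r (wmon w 1)))"
proof -
  have "t = ant r (increasing_part r t)"
    using alternating_eq_ant[OF assms] by simp
  also have "\<dots> = (\<Sum>w | length w = r \<and> sorted_wrt (<) w. ant r (wmon w (coef t w)))"
    by (simp add: increasing_part_def ant_sum)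
  also have "\<dots> = (\<Sum>w | length w = r \<and> sorted_wrt (<) w. tscale (coef t w) (ant r (wmon w 1)))"
    by (intro sum.cong refl) (simp add: ant_tscale[symmetric] tpow_mon tscale_single)
  finally show ?thesis .
qed

lemma tscale_mult_left: "tscale c s * t = tscale c (s * t)"
  by (simp add: tscale_def mult.assoc)

lemma tscale_mult_right: "s * tscale c t = tscale c (s * t)"
  unfolding tscale_def by (metis mult.assoc scalar_commute)

text \<open>
  The coefficient tensor of a fixed prefix \<open>a\<close> and suffix \<open>d\<close> is alternating, hence a combination of
  antisymmetrized increasing words \<open>I\<close>; collecting the suffixes gives a slice again.
\<close>

lemma split_first_block:
  fixes u :: "('b::{finite,linorder}, 'k::field) tensors"
  assumes u: "u \<in> tpow (i + r + k)" "alternating (coef u)"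
  shows "u = (\<Sum>a | length a = i. \<Sum>I | length I = r \<and> sorted_wrt (<) I.
    wmon a 1 * ant r (wmon I 1) * slice u (a @ I) k [])"
proof -
  let ?R = "{I :: 'b list. length I = r \<and> sorted_wrt (<) I}"
  have "(\<Sum>d | length d = k. wmon a 1 * slice u a r d * wmon d 1) =
      (\<Sum>I\<in>?R. wmon a 1 * ant r (wmon I 1) * slice u (a @ I) k [])" for a
  proof -
    have "wmon a 1 * slice u a r d * wmon d 1 =
        (\<Sum>I\<in>?R. wmon a 1 * ant r (wmon I 1) * wmon d (coef u (a @ I @ d)))" for d
    proof -
      have "slice u a r d = (\<Sum>I\<in>?R. tscale (coef u (a @ I @ d)) (ant r (wmon I 1)))"
        by (subst ant_increasing_sum[OF slice_tpow alternating_coef_slice[OF u(2)]])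
          (auto simp: coef_slice intro: sum.cong)
      moreover have "wmon d (coef u (a @ I @ d)) = tscale (coef u (a @ I @ d)) (wmon d 1)" for I
        by (simp add: tscale_single)
      ultimately show ?thesis
        by (simp add: sum_distrib_left sum_distrib_right tscale_mult_left tscale_mult_right)
    qed
    then have "(\<Sum>d | length d = k. wmon a 1 * slice u a r d * wmon d 1) =
        (\<Sum>d | length d = k. \<Sum>I\<in>?R. wmon a 1 * ant r (wmon I 1) * wmon d (coef u (a @ I @ d)))"
      by simp
    also have "\<dots> = (\<Sum>I\<in>?R. \<Sum>d | length d = k. wmon a 1 * ant r (wmon I 1) * wmon d (coef u (a @ I @ d)))"
      by (rule sum.swap)
    also have "\<dots> = (\<Sum>I\<in>?R. wmon a 1 * ant r (wmon I 1) * slice u (a @ I) k [])"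
      by (simp add: slice_def sum_distrib_left)
    finally show ?thesis .
  qed
  then show ?thesis using slice_expand[OF u(1)] by simp
qed

text \<open>
  The decomposition in the definition of the cap product exists: the slice that remains after
  splitting off the first alternating block is alternating, and so are its own slices.
\<close>

lemma split_two_blocks:
  fixes u :: "('b::{finite,linorder}, 'k::field) tensors"
  assumes u: "u \<in> tpow (i + r + l + r' + j)" "alternating (coef u)"
  obtains n a w b w' c where
    "\<forall>s<(n::nat). a s \<in> tpow i \<and> w s \<in> W N r \<and> b s \<in> tpow l \<and> w' s \<in> W N' r' \<and> c s \<in> tpow j"
    "u = (\<Sum>s<n. a s * w s * b s * w' s * c s)"
proof -
  let ?L = "\<lambda>n. {v :: 'b list. length v = n}"
  let ?R = "{I :: 'b list. length I = r \<and> sorted_wrt (<) I}"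
  let ?A = "?L i \<times> ?R \<times> ?L l \<times> ?L j"
  define t where "t = (\<lambda>(a, I, b, c). wmon a 1 * ant r (wmon I 1) * wmon b 1 * slice u (a @ I @ b) r' c * wmon c 1)"
  have "slice u (a @ I) (l + r' + j) [] =
      (\<Sum>b\<in>?L l. \<Sum>c\<in>?L j. wmon b 1 * slice u (a @ I @ b) r' c * wmon c 1)" for a I
  proof -
    have "slice (slice u (a @ I) (l + r' + j) []) b r' c = slice u (a @ I @ b) r' c"
      if "length b = l" "length c = j" for b c
      by (rule poly_mapping_eqI) (use that in \<open>simp add: coef_slice\<close>)
    then show ?thesis
      by (subst slice_expand[OF slice_tpow]) (auto intro!: sum.cong)
  qed
  then have "u = (\<Sum>a\<in>?L i. \<Sum>I\<in>?R. \<Sum>b\<in>?L l. \<Sum>c\<in>?L j. t (a, I, b, c))"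
    using split_first_block[of u i r "l + r' + j"] u
    by (simp add: t_def sum_distrib_left mult.assoc add.assoc)
  also have "\<dots> = sum t ?A"
    by (simp add: sum.cartesian_product)
  finally have u_sum: "u = sum t ?A" .
  have "finite ?A" by simp
  then obtain g where g: "bij_betw g {..<card ?A} ?A"
    using ex_bij_betw_nat_finite[of ?A] by (auto simp: atLeast0LessThan)
  have mem: "g s \<in> ?A" if "s < card ?A" for s
    using bij_betwE[OF g] that by auto
  show thesis
  proof (rule that)
    show "\<forall>s<card ?A. wmon (fst (g s)) 1 \<in> tpow i \<and> ant r (wmon (fst (snd (g s))) 1) \<in> W N r \<and>
        wmon (fst (snd (snd (g s)))) 1 \<in> tpow l \<and>
        slice u (fst (g s) @ fst (snd (g s)) @ fst (snd (snd (g s)))) r' (snd (snd (snd (g s)))) \<in> W N' r' \<and>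
        wmon (snd (snd (snd (g s)))) 1 \<in> tpow j"
      using mem by (auto simp: mem_Times_iff intro!: tpow_mon ant_W alternating_imp_W alternating_coef_slice u)
    show "u = (\<Sum>s<card ?A. wmon (fst (g s)) 1 * ant r (wmon (fst (snd (g s))) 1) *
        wmon (fst (snd (snd (g s)))) 1 *
        slice u (fst (g s) @ fst (snd (g s)) @ fst (snd (snd (g s)))) r' (snd (snd (snd (g s)))) *
        wmon (snd (snd (snd (g s)))) 1)"
      using u_sum sum.reindex_bij_betw[OF g, of t] by (simp add: t_def case_prod_unfold)
  qed
qed


section \<open>The cap product\<close>

lemma additive_eq_on_tpow:
  fixes \<phi> \<psi> :: "('b::finite, 'k::field) tensors \<Rightarrow> 'g"
  assumes "abelian_group G"
    and closed: "\<And>s. \<phi> s \<in> carrier G" "\<And>s. \<psi> s \<in> carrier G"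
    and add: "\<And>s t. \<phi> (s + t) = \<phi> s \<oplus>\<^bsub>G\<^esub> \<phi> t" "\<And>s t. \<psi> (s + t) = \<psi> s \<oplus>\<^bsub>G\<^esub> \<psi> t"
    and wmon: "\<And>w c. length w = r \<Longrightarrow> \<phi> (wmon w c) = \<psi> (wmon w c)"
    and t: "t \<in> tpow r"
  shows "\<phi> t = \<psi> t"
proof -
  interpret G: abelian_group G by fact
  have "\<phi> 0 = \<zero>\<^bsub>G\<^esub>" "\<psi> 0 = \<zero>\<^bsub>G\<^esub>"
    using add(1)[of 0 0] add(2)[of 0 0] closed by simp_all
  with t show ?thesis
    by (induction rule: tpow_induct) (simp_all add: add wmon)
qed

lemma nu_cases: "nu N p < 2 \<or> N \<le> nu N p"
  by (cases "p div 2") (auto simp: nu_def)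

text \<open>
  Here \<open>r\<close> and \<open>r'\<close> stand for \<open>\<nu>(p)\<close> and \<open>\<nu>(q-p)\<close>.
\<close>

locale cap_setting = bimod_pair N M P
  for N :: nat and M :: "(('b::{finite,linorder}, 'k::field) tensors set, 'm, 'c) bimodule_scheme"
    and P :: "(('b, 'k) tensors set, 'p, 'd) bimodule_scheme" +
  fixes r r' :: nat and f :: "('b, 'k) tensors set \<Rightarrow> 'p"
  assumes f: "klinear (ext_power r) (kspace N P) f"
begin

abbreviation "TA \<equiv> tensor_A N M P"
abbreviation "V \<equiv> W_module N r' :: ('k, ('b, 'k) tensors) module"
abbreviation "G \<equiv> tensor_k TA V"

sublocale TA: kmodule TA by (rule kmodule_tensor_A)
sublocale V: kmodule V by (rule kmodule_W_module)
sublocale TV: kmodule_pair TA V ..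
sublocale G: kmodule G by (rule TV.kmodule_tensor_k)

text \<open>
  The linear extension to all tensors of the Koszul cochain belonging to \<open>f\<close>, which is only given on
  \<open>W\<close>.
\<close>

definition cochain :: "('b, 'k) tensors \<Rightarrow> 'p" where
  "cochain w = f (ext_class (increasing_part r w))"

text \<open>
  A linear projection of the tensor algebra onto the alternating tensors of degree \<open>r'\<close>. Unlike the
  antisymmetrizer divided by a factorial, it exists in every characteristic, and it kills the words that
  are not increasing.
\<close>

definition to_W :: "('b, 'k) tensors \<Rightarrow> ('b, 'k) tensors" where
  "to_W w = ant r' (increasing_part r' w)"

text \<open>
  The contribution of the product \<open>a w b w' c\<close> to the cap product, made multilinear on the whole tensor
  algebra.
\<close>

definition summand where
  "summand m a w b w' c = pure_k TA V
     (pure_A N M P (ract N M (lact N M c m) a) (ract N P (cochain w) b)) (to_W w')"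

lemma cochain_closed [simp]: "cochain w \<in> carrier P"
  using f by (auto simp: cochain_def klinear_def P.kspace_simps carrier_ext_power Pi_def)

lemma cochain_add: "cochain (s + t) = cochain s \<oplus>\<^bsub>P\<^esub> cochain t"
  using f by (simp add: cochain_def klinear_def P.kspace_simps carrier_ext_power increasing_part_add
      ext_power_ops(1)[symmetric, where r = r])

lemma cochain_tscale: "cochain (tscale c t) = lact N P (scalar c) (cochain t)"
  using f by (simp add: cochain_def klinear_def P.kspace_simps carrier_ext_power increasing_part_tscale
      ext_power_ops(2)[symmetric, where r = r])

lemma to_W_closed [simp]: "to_W w \<in> carrier V"
  by (simp add: to_W_def W_module_simps ant_W)

lemma to_W_add: "to_W (s + t) = to_W s \<oplus>\<^bsub>V\<^esub> to_W t"
  by (simp add: to_W_def increasing_part_add ant_add W_module_simps)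

lemma to_W_tscale: "to_W (tscale c t) = c \<odot>\<^bsub>V\<^esub> to_W t"
  by (simp add: to_W_def increasing_part_tscale ant_tscale W_module_simps)

lemma pure_k_closed [simp]: "\<lbrakk>x \<in> carrier TA; y \<in> carrier V\<rbrakk> \<Longrightarrow> pure_k TA V x y \<in> carrier G"
  by (simp add: TV.pure_k_eq TV.tensor_k_eq)

lemma pure_k_add:
  "\<lbrakk>x \<in> carrier TA; x' \<in> carrier TA; y \<in> carrier V\<rbrakk> \<Longrightarrow>
    pure_k TA V (x \<oplus>\<^bsub>TA\<^esub> x') y = pure_k TA V x y \<oplus>\<^bsub>G\<^esub> pure_k TA V x' y"
  "\<lbrakk>x \<in> carrier TA; y \<in> carrier V; y' \<in> carrier V\<rbrakk> \<Longrightarrow>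
    pure_k TA V x (y \<oplus>\<^bsub>V\<^esub> y') = pure_k TA V x y \<oplus>\<^bsub>G\<^esub> pure_k TA V x y'"
  by (simp_all add: TV.pure_k_eq TV.tensor_k_eq TV.pt_add_left TV.pt_add_right)

lemma pure_k_smult_left:
  "\<lbrakk>x \<in> carrier TA; y \<in> carrier V\<rbrakk> \<Longrightarrow> pure_k TA V (c \<odot>\<^bsub>TA\<^esub> x) y = c \<odot>\<^bsub>G\<^esub> pure_k TA V x y"
  by (simp add: TV.pure_k_eq TV.tensor_k_eq TV.smult_pt)

lemmas pure_k_smult = pure_k_smult_left TV.pure_k_smult_right[symmetric]

lemma summand_closed [simp]: "m \<in> carrier M \<Longrightarrow> summand m a w b w' c \<in> carrier G"
  by (simp add: summand_def)

lemma summand_add: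
  assumes [simp]: "m \<in> carrier M"
  shows "summand m (a1 + a2) w b w' c = summand m a1 w b w' c \<oplus>\<^bsub>G\<^esub> summand m a2 w b w' c"
    "summand m a (w1 + w2) b w' c = summand m a w1 b w' c \<oplus>\<^bsub>G\<^esub> summand m a w2 b w' c"
    "summand m a w (b1 + b2) w' c = summand m a w b1 w' c \<oplus>\<^bsub>G\<^esub> summand m a w b2 w' c"
    "summand m a w b (v1 + v2) c = summand m a w b v1 c \<oplus>\<^bsub>G\<^esub> summand m a w b v2 c"
    "summand m a w b w' (c1 + c2) = summand m a w b w' c1 \<oplus>\<^bsub>G\<^esub> summand m a w b w' c2"
    "m' \<in> carrier M \<Longrightarrow>
      summand (m \<oplus>\<^bsub>M\<^esub> m') a w b w' c = summand m a w b w' c \<oplus>\<^bsub>G\<^esub> summand m' a w b w' c"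
  by (simp_all add: summand_def M.ract_add M.lact_add M.ract_distrib M.lact_distrib P.ract_add
      P.ract_distrib cochain_add to_W_add pure_A_add_left pure_A_add_right pure_k_add)

lemma summand_tscale:
  assumes [simp]: "m \<in> carrier M"
  shows "summand m (tscale d a) w b w' c = d \<odot>\<^bsub>G\<^esub> summand m a w b w' c"
    "summand m a (tscale d w) b w' c = d \<odot>\<^bsub>G\<^esub> summand m a w b w' c"
    "summand m a w (tscale d b) w' c = d \<odot>\<^bsub>G\<^esub> summand m a w b w' c"
    "summand m a w b (tscale d w') c = d \<odot>\<^bsub>G\<^esub> summand m a w b w' c"
    "summand m a w b w' (tscale d c) = d \<odot>\<^bsub>G\<^esub> summand m a w b w' c"
    "summand (lact N M (scalar d) m) a w b w' c = d \<odot>\<^bsub>G\<^esub> summand m a w b w' c"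
  by (simp_all add: summand_def M.ract_tscale M.lact_tscale M.ract_lact M.lact_lact_scalar P.ract_tscale
      P.ract_lact cochain_tscale to_W_tscale pure_A_smult_left pure_A_smult_right pure_k_smult)

definition word_summand :: "nat \<Rightarrow> nat \<Rightarrow> 'm \<Rightarrow> 'b list \<Rightarrow> _" where
  "word_summand i l m s = summand m (wmon (take i s) 1) (wmon (take r (drop i s)) 1)
     (wmon (take l (drop (i + r) s)) 1) (wmon (take r' (drop (i + r + l) s)) 1)
     (wmon (drop (i + r + l + r') s) 1)"

text \<open>
  The linear map on tensors that takes the value \<open>summand\<close> on each word cut into blocks of lengths
  \<open>i\<close>, \<open>r\<close>, \<open>l\<close>, \<open>r'\<close>, \<open>j\<close>.
\<close>

definition cap_map :: "nat \<Rightarrow> nat \<Rightarrow> nat \<Rightarrow> 'm \<Rightarrow> ('b, 'k) tensors \<Rightarrow> _" where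
  "cap_map i l j m u = (\<Oplus>\<^bsub>G\<^esub>s\<in>{s. length s = i + r + l + r' + j}. coef u s \<odot>\<^bsub>G\<^esub> word_summand i l m s)"

lemma word_summand_closed [simp]: "m \<in> carrier M \<Longrightarrow> word_summand i l m s \<in> carrier G"
  by (simp add: word_summand_def)

lemma cap_map_closed [simp]: "m \<in> carrier M \<Longrightarrow> cap_map i l j m u \<in> carrier G"
  by (auto simp: cap_map_def intro!: G.finsum_closed)

lemma cap_map_add:
  assumes "m \<in> carrier M"
  shows "cap_map i l j m (u + v) = cap_map i l j m u \<oplus>\<^bsub>G\<^esub> cap_map i l j m v"
  unfolding cap_map_def using assms
  by (subst G.finsum_addf[symmetric]) (auto simp: lookup_add G.smult_l_distr intro!: G.finsum_cong')

lemma finsum_smult: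
  assumes "finite A" "g \<in> A \<rightarrow> carrier G"
  shows "c \<odot>\<^bsub>G\<^esub> finsum G g A = (\<Oplus>\<^bsub>G\<^esub>i\<in>A. c \<odot>\<^bsub>G\<^esub> g i)"
  by (rule hom_finsum[OF G.abelian_group_axioms G.abelian_group_axioms _ assms])
    (auto simp: hom_def G.smult_r_distr)

lemma cap_map_tscale:
  assumes "m \<in> carrier M"
  shows "cap_map i l j m (tscale d u) = d \<odot>\<^bsub>G\<^esub> cap_map i l j m u"
  unfolding cap_map_def using assms
  by (subst finsum_smult) (auto simp: coef_tscale G.smult_assoc intro!: G.finsum_cong')

lemma cap_map_add_left:
  assumes "m \<in> carrier M" "m' \<in> carrier M"
  shows "cap_map i l j (m \<oplus>\<^bsub>M\<^esub> m') u = cap_map i l j m u \<oplus>\<^bsub>G\<^esub> cap_map i l j m' u"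
  unfolding cap_map_def using assms
  by (subst G.finsum_addf[symmetric])
    (auto simp: word_summand_def summand_add(6) G.smult_r_distr intro!: G.finsum_cong')

lemma cap_map_smult_left:
  assumes "m \<in> carrier M"
  shows "cap_map i l j (lact N M (scalar d) m) u = d \<odot>\<^bsub>G\<^esub> cap_map i l j m u"
  unfolding cap_map_def using assms
  by (subst finsum_smult)
    (auto simp: word_summand_def summand_tscale(6) G.smult_assoc mult.commute intro!: G.finsum_cong')

lemma cap_map_0: "m \<in> carrier M \<Longrightarrow> cap_map i l j m 0 = \<zero>\<^bsub>G\<^esub>"
  using cap_map_add[of m i l j 0 0] by simp

lemma cap_map_sum:
  assumes "m \<in> carrier M" "finite A"
  shows "cap_map i l j m (sum u A) = (\<Oplus>\<^bsub>G\<^esub>s\<in>A. cap_map i l j m (u s))"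
  using assms(2) by (induction rule: finite_induct) (simp_all add: assms(1) cap_map_0 cap_map_add)

lemma cap_map_mon:
  assumes "m \<in> carrier M" "length s = i + r + l + r' + j"
  shows "cap_map i l j m (wmon s d) = d \<odot>\<^bsub>G\<^esub> word_summand i l m s"
proof -
  have "0 \<odot>\<^bsub>G\<^esub> z = \<zero>\<^bsub>G\<^esub>" if "z \<in> carrier G" for z
    using G.smult_l_distr[OF that, of 0 0] that by simp
  then have "cap_map i l j m (wmon s d) = (\<Oplus>\<^bsub>G\<^esub>v\<in>{v. length v = i + r + l + r' + j}.
      if s = v then d \<odot>\<^bsub>G\<^esub> word_summand i l m v else \<zero>\<^bsub>G\<^esub>)"
    unfolding cap_map_def using assms(1)
    by (intro G.finsum_cong') (auto simp: lookup_single when_def)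
  also have "\<dots> = d \<odot>\<^bsub>G\<^esub> word_summand i l m s"
    using assms by (subst G.finsum_singleton[of s]) auto
  finally show ?thesis .
qed

text \<open>
  Both sides are additive in each of the five factors, so words with coefficients suffice, one factor at
  a time.
\<close>

lemma cap_map_product:
  assumes m: "m \<in> carrier M"
    and t: "a \<in> tpow i" "w \<in> tpow r" "b \<in> tpow l" "w' \<in> tpow r'" "c \<in> tpow j"
  shows "cap_map i l j m (a * w * b * w' * c) = summand m a w b w' c"
proof -
  have mon_tscale: "wmon s d = tscale d (wmon s 1)" for s :: "'b list" and d :: 'k
    by (simp add: tscale_single)
  have 0: "cap_map i l j m (wmon s1 d1 * wmon s2 d2 * wmon s3 d3 * wmon s4 d4 * wmon s5 d5) =
      summand m (wmon s1 d1) (wmon s2 d2) (wmon s3 d3) (wmon s4 d4) (wmon s5 d5)"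
    if len: "length s1 = i" "length s2 = r" "length s3 = l" "length s4 = r'" "length s5 = j"
    for s1 s2 s3 s4 s5 d1 d2 d3 d4 d5
  proof -
    have "word_summand i l m (s1 @ s2 @ s3 @ s4 @ s5) =
        summand m (wmon s1 1) (wmon s2 1) (wmon s3 1) (wmon s4 1) (wmon s5 1)"
      using len by (simp add: word_summand_def)
    then have "cap_map i l j m (wmon s1 d1 * wmon s2 d2 * wmon s3 d3 * wmon s4 d4 * wmon s5 d5) =
        (d1 * d2 * d3 * d4 * d5) \<odot>\<^bsub>G\<^esub> summand m (wmon s1 1) (wmon s2 1) (wmon s3 1) (wmon s4 1) (wmon s5 1)"
      using len by (simp add: mon_mult cap_map_mon[OF m])
    also have "\<dots> = summand m (wmon s1 d1) (wmon s2 d2) (wmon s3 d3) (wmon s4 d4) (wmon s5 d5)"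
      by (subst mon_tscale[of s1 d1], subst mon_tscale[of s2 d2], subst mon_tscale[of s3 d3],
          subst mon_tscale[of s4 d4], subst mon_tscale[of s5 d5])
        (simp add: summand_tscale m G.smult_assoc mult.assoc mult.commute mult.left_commute)
    finally show ?thesis .
  qed
  note rule = additive_eq_on_tpow[OF G.abelian_group_axioms]
  have 1: "cap_map i l j m (wmon s1 d1 * wmon s2 d2 * wmon s3 d3 * wmon s4 d4 * c) =
      summand m (wmon s1 d1) (wmon s2 d2) (wmon s3 d3) (wmon s4 d4) c"
    if len: "length s1 = i" "length s2 = r" "length s3 = l" "length s4 = r'"
    for s1 s2 s3 s4 d1 d2 d3 d4
    by (rule rule[OF _ _ _ _ _ t(5)]) (use len in \<open>simp_all add: m t distrib_left cap_map_add summand_add 0\<close>)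
  have 2: "cap_map i l j m (wmon s1 d1 * wmon s2 d2 * wmon s3 d3 * w' * c) =
      summand m (wmon s1 d1) (wmon s2 d2) (wmon s3 d3) w' c"
    if len: "length s1 = i" "length s2 = r" "length s3 = l"
    for s1 s2 s3 d1 d2 d3
    by (rule rule[OF _ _ _ _ _ t(4)])
      (use len in \<open>simp_all add: m t distrib_left distrib_right cap_map_add summand_add 1\<close>)
  have 3: "cap_map i l j m (wmon s1 d1 * wmon s2 d2 * b * w' * c) =
      summand m (wmon s1 d1) (wmon s2 d2) b w' c"
    if len: "length s1 = i" "length s2 = r"
    for s1 s2 d1 d2
    by (rule rule[OF _ _ _ _ _ t(3)])
      (use len in \<open>simp_all add: m t distrib_left distrib_right cap_map_add summand_add 2\<close>)
  have 4: "cap_map i l j m (wmon s1 d1 * w * b * w' * c) = summand m (wmon s1 d1) w b w' c"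
    if len: "length s1 = i"
    for s1 d1
    by (rule rule[OF _ _ _ _ _ t(2)])
      (use len in \<open>simp_all add: m t distrib_left distrib_right cap_map_add summand_add 3\<close>)
  show ?thesis
    by (rule rule[OF _ _ _ _ _ t(1)])
      (simp_all add: m t distrib_left distrib_right cap_map_add summand_add 4)
qed

lemma cochain_W:
  assumes "2 \<le> N" "r < 2 \<or> N \<le> r" "w \<in> W N r"
  shows "f (inv_into (carrier (ext_power r)) (phi r) w) = cochain w"
  using assms by (simp add: cochain_def inv_into_phi W_imp_alternating W_tpow)

lemma to_W_W:
  assumes "2 \<le> N" "r' < 2 \<or> N \<le> r'" "w \<in> W N r'"
  shows "to_W w = w"
  using assms by (simp add: to_W_def alternating_eq_ant W_imp_alternating W_tpow)

text \<open>
  Whatever decomposition of \<open>u\<close> is chosen, the sum of its contributions is the value of the linear map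
  \<open>cap_map\<close> at \<open>u\<close>.
\<close>

lemma cap_term_eq_cap_map:
  assumes N: "2 \<le> N" and r: "r = nu N p" and r': "r' = nu N (q - p)"
    and m: "m \<in> carrier M" and u: "u \<in> tpow (i + r + l + r' + j)" "alternating (coef u)"
  shows "cap_term N M P p q (f \<circ> inv_into (carrier (ext_power r)) (phi r)) i l j m u = cap_map i l j m u"
  unfolding cap_term_def r[symmetric] r'[symmetric]
proof (rule the_equality, goal_cases)
  have *: "cap_map i l j m (\<Sum>s<n. a s * w s * b s * w' s * c s) =
      (\<Oplus>\<^bsub>G\<^esub>s\<in>{..<n}. pure_k TA V (pure_A N M P (ract N M (lact N M (c s) m) (a s))
        (ract N P ((f \<circ> inv_into (carrier (ext_power r)) (phi r)) (w s)) (b s))) (w' s))"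
    if *: "\<forall>s<n. a s \<in> tpow i \<and> w s \<in> W N r \<and> b s \<in> tpow l \<and> w' s \<in> W N r' \<and> c s \<in> tpow j"
    for n :: nat and a w b w' c
  proof -
    have "cap_map i l j m (a s * w s * b s * w' s * c s) = pure_k TA V (pure_A N M P (ract N M (lact N M (c s) m) (a s))
        (ract N P ((f \<circ> inv_into (carrier (ext_power r)) (phi r)) (w s)) (b s))) (w' s)" if "s < n" for s
    proof -
      have s: "a s \<in> tpow i" "w s \<in> W N r" "b s \<in> tpow l" "w' s \<in> W N r'" "c s \<in> tpow j"
        using * \<open>s < n\<close> by blast+
      then show ?thesis
        using cap_map_product[OF m s(1) W_tpow[OF s(2)] s(3) W_tpow[OF s(4)] s(5)]
          cochain_W[OF N _ s(2)] to_W_W[OF N _ s(4)] nu_cases[of N p] nu_cases[of N "q - p"]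
        by (simp add: summand_def r[symmetric] r'[symmetric])
    qed
    then show ?thesis
      unfolding cap_map_sum[OF m finite_lessThan]
    proof (intro G.finsum_cong'[symmetric])
      show "(\<lambda>s. cap_map i l j m (a s * w s * b s * w' s * c s)) \<in> {..<n} \<rightarrow> carrier G"
        using m by simp
    qed simp_all
  qed
  case 1
  obtain n a w b w' c where
    "\<forall>s<(n::nat). a s \<in> tpow i \<and> w s \<in> W N r \<and> b s \<in> tpow l \<and> w' s \<in> W N r' \<and> c s \<in> tpow j"
    "u = (\<Sum>s<n. a s * w s * b s * w' s * c s)"
    using split_two_blocks[OF u] .
  then show ?case using * by blast
  case (2 v)
  then show ?case using * by blast
qed

end

section \<open>Arithmetic of \<open>\<nu>\<close> and shuffles\<close>

lemma nu_double: "nu N (2 * a) = N * a" "nu N (2 * a + 1) = N * a + 1"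
  by (simp_all add: nu_def)

lemma nu_diff:
  assumes "p \<le> q" "\<not> (odd p \<and> even q)"
  shows "nu N (q - p) = nu N q - nu N p"
proof -
  obtain k where q: "q = p + k" using assms(1) le_iff_add by blast
  have "nu N (p + k) = nu N p + nu N k"
  proof (cases "even p")
    case True
    then obtain a where p: "p = 2 * a" by (rule evenE)
    have "nu N (2 * a + k) = N * (a + k div 2) + k mod 2"
      unfolding nu_def by simp
    then show ?thesis unfolding p nu_double by (simp add: nu_def distrib_left)
  next
    case False
    then obtain a where p: "p = 2 * a + 1" by (rule oddE)
    have "even k" using False assms(2) q by simp
    then obtain b where k: "k = 2 * b" by (rule evenE)
    have "p + k = 2 * (a + b) + 1" by (simp add: p k)
    then have "nu N (p + k) = N * (a + b) + 1" by (simp only: nu_double)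
    then show ?thesis unfolding p k nu_double by (simp add: distrib_left)
  qed
  then show ?thesis by (simp add: q)
qed

lemma nu_odd_even:
  assumes "odd p" "even q" "p \<le> q" "2 \<le> N" "i + j \<le> N - 2"
  shows "i + nu N p + (N - 2 - (i + j)) + nu N (q - p) + j = nu N q"
proof -
  obtain k where q: "q = p + k" using assms(3) le_iff_add by blast
  obtain a where p: "p = 2 * a + 1" using assms(1) by (rule oddE)
  have "odd k" using assms(1,2) q by simp
  then obtain b where k: "k = 2 * b + 1" by (rule oddE)
  have "q = 2 * (a + b + 1)" by (simp add: p k q)
  then have "nu N q = N * (a + b + 1)" by (simp only: nu_double)
  then have "nu N q = N * a + N * b + N" by (simp add: distrib_left)
  moreover have "nu N p = N * a + 1" "nu N (q - p) = N * b + 1"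
    unfolding p nu_double by (simp_all only: q p k add_diff_cancel_left' nu_double)
  ultimately show ?thesis using assms(4,5) by linarith
qed

lemma sorted_wrt_upt_iff:
  "sorted_wrt Q [a..<b] \<longleftrightarrow> (\<forall>s\<in>{a..<b}. \<forall>t\<in>{a..<b}. s < t \<longrightarrow> Q s t)"
proof (induction b)
  case (Suc b)
  show ?case
  proof (cases "a \<le> b")
    case True
    then have "{a..<Suc b} = insert b {a..<b}" by auto
    then show ?thesis
      using True Suc.IH by (auto simp: sorted_wrt_append)
  qed simp
qed simp

lemma sorted_map_upt_iff:
  fixes c :: "nat \<Rightarrow> 'b::linorder" and \<sigma> :: "nat \<Rightarrow> nat"
  assumes c: "strict_mono_on {1..n} c" and \<sigma>: "\<And>s. s \<in> {1..n} \<Longrightarrow> \<sigma> s \<in> {1..n}" and ab: "1 \<le> a" "b \<le> n"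
  shows "sorted_wrt (<) (map (\<lambda>s. c (\<sigma> s)) [a..<Suc b]) \<longleftrightarrow> strict_mono_on {a..b} \<sigma>"
proof -
  have "c (\<sigma> s) < c (\<sigma> t) \<longleftrightarrow> \<sigma> s < \<sigma> t" if "s \<in> {a..b}" "t \<in> {a..b}" for s t
    using that ab by (intro strict_mono_on_less[OF c] \<sigma>) auto
  then have "strict_mono_on {a..b} \<sigma> \<longleftrightarrow> (\<forall>s\<in>{a..b}. \<forall>t\<in>{a..b}. s < t \<longrightarrow> c (\<sigma> s) < c (\<sigma> t))"
    by (auto simp: strict_mono_on_def)
  also have "\<dots> \<longleftrightarrow> sorted_wrt (\<lambda>s t. c (\<sigma> s) < c (\<sigma> t)) [a..<Suc b]"
    by (simp only: sorted_wrt_upt_iff atLeastLessThanSuc_atLeastAtMost)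
  finally show ?thesis by (simp add: sorted_wrt_map del: upt_Suc)
qed

text \<open>
  Passage from permutations of list positions, counted from 0, to permutations of \<open>{1..n}\<close>.
\<close>

lemma ant_mon_one_based:
  fixes c :: "nat \<Rightarrow> 'b"
  shows "ant n (wmon (map c [1..<Suc n]) 1) =
    (\<Sum>\<sigma> | \<sigma> permutes {1..n}. wmon (map (\<lambda>s. c (\<sigma> s)) [1..<Suc n]) (of_int (sign \<sigma>)))"
proof -
  let ?w = "map c [1..<Suc n]"
  have "ant n (wmon ?w 1) = (\<Sum>\<sigma> | \<sigma> permutes {..<n}. wmon (permute_list \<sigma> ?w) (of_int (sign \<sigma>)))"
    using ant_mon[of ?w 1] by (simp del: upt_Suc)
  also have "\<dots> = (\<Sum>\<sigma> | \<sigma> permutes {1..n}. wmon (map (\<lambda>s. c (\<sigma> s)) [1..<Suc n]) (of_int (sign \<sigma>)))"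
  proof (rule sum.reindex_bij_witness[where i = "map_permutation {1..n} (\<lambda>k. k - 1)"
        and j = "map_permutation {..<n} Suc"])
    have S: "bij_betw Suc {..<n} {1..n}"
      by (rule bij_betw_byWitness[where f' = "\<lambda>k. k - 1"]) auto
    have S': "bij_betw (\<lambda>k. k - 1) {1..n} {..<n}"
      by (rule bij_betw_byWitness[where f' = Suc]) auto
    fix \<sigma>
    show "map_permutation {..<n} Suc (map_permutation {1..n} (\<lambda>k. k - 1) \<sigma>) = \<sigma>"
      "map_permutation {1..n} (\<lambda>k. k - 1) \<sigma> \<in> {\<sigma>. \<sigma> permutes {..<n}}"
      if "\<sigma> \<in> {\<sigma>. \<sigma> permutes {1..n}}"
      using that map_permutation_compose_inv[OF S', of \<sigma> Suc] map_permutation_permutes[OF S', of \<sigma>] by auto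
    assume "\<sigma> \<in> {\<sigma>. \<sigma> permutes {..<n}}"
    then have \<sigma>: "\<sigma> permutes {..<n}" by simp
    show "map_permutation {1..n} (\<lambda>k. k - 1) (map_permutation {..<n} Suc \<sigma>) = \<sigma>"
      "map_permutation {..<n} Suc \<sigma> \<in> {\<sigma>. \<sigma> permutes {1..n}}"
      using map_permutation_compose_inv[OF S \<sigma>, of "\<lambda>k. k - 1"] map_permutation_permutes[OF S \<sigma>] by auto
    have "permute_list \<sigma> ?w = map (\<lambda>s. c (map_permutation {..<n} Suc \<sigma> s)) [1..<Suc n]"
    proof (rule nth_equalityI)
      fix t assume "t < length (permute_list \<sigma> ?w)"
      then have t: "t < n" by (simp del: upt_Suc)
      then have "\<sigma> t < n" using permutes_in_image[OF \<sigma>, of t] by simp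
      then show "permute_list \<sigma> ?w ! t = map (\<lambda>s. c (map_permutation {..<n} Suc \<sigma> s)) [1..<Suc n] ! t"
        using t \<sigma> map_permutation_apply[of Suc "{..<n}" t \<sigma>] by (simp add: permute_list_nth del: upt_Suc)
    qed (simp del: upt_Suc)
    then show "wmon (map (\<lambda>s. c (map_permutation {..<n} Suc \<sigma> s)) [1..<Suc n])
        (of_int (sign (map_permutation {..<n} Suc \<sigma>))) = wmon (permute_list \<sigma> ?w) (of_int (sign \<sigma>))"
      using \<sigma> by (simp add: sign_map_permutation del: upt_Suc)
  qed
  finally show ?thesis .
qed

section \<open>Evaluation of the cap product\<close>

context cap_setting
begin

lemma koszul_cap_pure:
  assumes N: "2 \<le> N" and r: "r = nu N p" and r': "r' = nu N (q - p)"
    and pq: "odd p" "even q" "p \<le> q" and m: "m \<in> carrier M" and u: "u \<in> W N (nu N q)"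
  shows "koszul_cap N M P p q (pure_k (kspace N M) (W_module N (nu N q)) m u)
      (f \<circ> inv_into (carrier (ext_power r)) (phi r)) =
    finsum G (\<lambda>(i, j). cap_map i (N - 2 - (i + j)) j m u) {(i, j). i + j \<le> N - 2}"
proof -
  let ?I = "{(i, j). i + j \<le> N - 2}"
  let ?U = "W_module N (nu N q) :: ('k, ('b, 'k) tensors) module"
  let ?f = "f \<circ> inv_into (carrier (ext_power r)) (phi r)"
  let ?g = "\<lambda>m u. finsum G (\<lambda>(i, j). cap_term N M P p q ?f i (N - 2 - (i + j)) j m u) ?I"
  let ?h = "\<lambda>m u. finsum G (\<lambda>(i, j). cap_map i (N - 2 - (i + j)) j m u) ?I"
  have fin: "finite ?I"
    by (rule finite_subset[of _ "{..N} \<times> {..N}"]) auto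
  interpret KU: kmodule_pair "kspace N M" ?U
    by (intro kmodule_pair.intro M.kmodule_kspace kmodule_W_module)
  have g: "?g m u = ?h m u" if "m \<in> carrier M" "u \<in> W N (nu N q)" for m u
  proof (rule G.finsum_cong')
    fix z assume z: "z \<in> ?I"
    then have "u \<in> tpow (fst z + r + (N - 2 - (fst z + snd z)) + r' + snd z)"
      using W_tpow[OF that(2)] nu_odd_even[OF pq N, of "fst z" "snd z"] by (auto simp: r r')
    moreover have "alternating (coef u)"
      using W_imp_alternating[OF N nu_cases that(2)] .
    ultimately show "(case z of (i, j) \<Rightarrow> cap_term N M P p q ?f i (N - 2 - (i + j)) j m u) =
        (case z of (i, j) \<Rightarrow> cap_map i (N - 2 - (i + j)) j m u)"
      using cap_term_eq_cap_map[OF N r r' that(1)] by (simp add: case_prod_unfold)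
  qed (use that in auto)
  have cl: "(\<lambda>(i, j). cap_map i (N - 2 - (i + j)) j m u) \<in> ?I \<rightarrow> carrier G" if "m \<in> carrier M" for m u
    using that by auto
  have "tensor_k_lift (kspace N M) ?U G ?g (pure_k (kspace N M) ?U m u) = ?g m u"
  proof (rule KU.tensor_k_lift_hom[of G ?g])
    show "abelian_group G" by (rule G.abelian_group_axioms)
    fix x x' s y y'
    assume x: "x \<in> carrier (kspace N M)" and y: "y \<in> carrier ?U"
    then have x1: "x \<in> carrier M" and y1: "y \<in> W N (nu N q)"
      by (simp_all add: M.kspace_simps W_module_simps)
    show "?g x y \<in> carrier G"
      unfolding g[OF x1 y1] by (rule G.finsum_closed[OF cl[OF x1]])
    show "?g (x \<oplus>\<^bsub>kspace N M\<^esub> x') y = ?g x y \<oplus>\<^bsub>G\<^esub> ?g x' y" if "x' \<in> carrier (kspace N M)"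
    proof -
      have x2: "x' \<in> carrier M" using that by (simp add: M.kspace_simps)
      have "?h (x \<oplus>\<^bsub>M\<^esub> x') y = ?h x y \<oplus>\<^bsub>G\<^esub> ?h x' y"
        by (subst G.finsum_addf[symmetric, OF cl[OF x1] cl[OF x2]], rule G.finsum_cong')
          (auto simp: cap_map_add_left x1 x2)
      then show ?thesis by (simp only: M.kspace_simps g x1 x2 y1 M.M.a_closed)
    qed
    show "?g x (y \<oplus>\<^bsub>?U\<^esub> y') = ?g x y \<oplus>\<^bsub>G\<^esub> ?g x y'" if "y' \<in> carrier ?U"
    proof -
      have y2: "y' \<in> W N (nu N q)" using that by (simp add: W_module_simps)
      have "?h x (y + y') = ?h x y \<oplus>\<^bsub>G\<^esub> ?h x y'"
        by (subst G.finsum_addf[symmetric, OF cl[OF x1] cl[OF x1]], rule G.finsum_cong')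
          (auto simp: cap_map_add x1)
      then show ?thesis by (simp only: W_module_simps W_add g x1 y1 y2)
    qed
    show "?g (s \<odot>\<^bsub>kspace N M\<^esub> x) y = ?g x (s \<odot>\<^bsub>?U\<^esub> y)"
    proof -
      have "?h (lact N M (scalar s) x) y = ?h x (tscale s y)"
        by (rule G.finsum_cong') (auto simp: cap_map_smult_left cap_map_tscale x1)
      then show ?thesis by (simp only: M.kspace_simps W_module_simps W_tscale g x1 y1 M.lact_closed)
    qed
  next
    fix h
    assume h: "\<And>x y. \<lbrakk>x \<in> carrier (kspace N M); y \<in> carrier ?U\<rbrakk> \<Longrightarrow> h (pure_k (kspace N M) ?U x y) = ?g x y"
      "\<And>z. z \<in> carrier (tensor_k (kspace N M) ?U) \<Longrightarrow> tensor_k_lift (kspace N M) ?U G ?g z = h z"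
    have mu: "m \<in> carrier (kspace N M)" "u \<in> carrier ?U"
      using m u by (simp_all add: M.kspace_simps W_module_simps)
    then show ?thesis
      using h by (simp add: KU.tensor_k_eq KU.pure_k_eq)
  qed
  moreover have "odd p \<and> odd (q - p)" using pq by simp
  ultimately show ?thesis
    using g[OF m u] by (simp add: koszul_cap_def Let_def r'[symmetric])
qed

text \<open>
  This is where the shuffles come from: the extensions \<open>cochain\<close> and \<open>to_W\<close> kill the words that are not
  increasing.
\<close>

lemma summand_vanish:
  assumes m: "m \<in> carrier M"
    and "length w = r" "length w' = r'" "\<not> (sorted_wrt (<) w \<and> sorted_wrt (<) w')"
  shows "summand m a (wmon w d) b (wmon w' d') c = \<zero>\<^bsub>G\<^esub>"
proof -
  have "summand m a (wmon w d) b (wmon w' d') c =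
      summand m a (increasing_part r (wmon w d)) b (increasing_part r' (wmon w' d')) c"
    using assms by (simp add: summand_def cochain_def to_W_def increasing_part_mon) (simp add: increasing_part_def)?
  moreover have "summand m a 0 b w' c = \<zero>\<^bsub>G\<^esub>" "summand m a w b 0 c = \<zero>\<^bsub>G\<^esub>" for w w'
    using summand_add(2)[OF m, of a 0 0 b w' c] summand_add(4)[OF m, of a w b 0 0 c] m by simp_all
  ultimately show ?thesis
    using assms by (auto simp: increasing_part_mon)
qed

lemma cap_map_ant:
  fixes c :: "nat \<Rightarrow> 'b"
  assumes m: "m \<in> carrier M" and n: "n = i + r + l + r' + j" and c: "strict_mono_on {1..n} c"
  shows "cap_map i l j m (ant n (wmon (map c [1..<Suc n]) 1)) =
    (\<Oplus>\<^bsub>G\<^esub>\<sigma>\<in>{\<sigma>. \<sigma> permutes {1..n} \<and> strict_mono_on {i + 1..i + r} \<sigma> \<and>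
        strict_mono_on {i + r + l + 1..n - j} \<sigma>}.
      of_int (sign \<sigma>) \<odot>\<^bsub>G\<^esub> pure_k TA V (pure_A N M P
        (ract N M (lact N M (wmon (map (\<lambda>s. c (\<sigma> s)) [n - j + 1..<Suc n]) 1) m)
          (wmon (map (\<lambda>s. c (\<sigma> s)) [1..<Suc i]) 1))
        (ract N P (f (ext_class (wmon (map (\<lambda>s. c (\<sigma> s)) [i + 1..<Suc (i + r)]) 1)))
          (wmon (map (\<lambda>s. c (\<sigma> s)) [i + r + 1..<Suc (i + r + l)]) 1)))
        (ant r' (wmon (map (\<lambda>s. c (\<sigma> s)) [i + r + l + 1..<Suc (n - j)]) 1)))"
    (is "_ = finsum G ?t ?S")
proof -
  let ?P = "{\<sigma>. \<sigma> permutes {1..n}}"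
  let ?w = "\<lambda>\<sigma>. map (\<lambda>s. c (\<sigma> s)) [1..<Suc n]"
  define b1 b2 b3 b4 b5 where "b1 \<sigma> = map (\<lambda>s. c (\<sigma> s)) [1..<Suc i]"
    and "b2 \<sigma> = map (\<lambda>s. c (\<sigma> s)) [i + 1..<Suc (i + r)]"
    and "b3 \<sigma> = map (\<lambda>s. c (\<sigma> s)) [i + r + 1..<Suc (i + r + l)]"
    and "b4 \<sigma> = map (\<lambda>s. c (\<sigma> s)) [i + r + l + 1..<Suc (n - j)]"
    and "b5 \<sigma> = map (\<lambda>s. c (\<sigma> s)) [n - j + 1..<Suc n]" for \<sigma> :: "nat \<Rightarrow> nat"
  note b = b1_def b2_def b3_def b4_def b5_def
  have ws: "word_summand i l m (?w \<sigma>) =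
      summand m (wmon (b1 \<sigma>) 1) (wmon (b2 \<sigma>) 1) (wmon (b3 \<sigma>) 1) (wmon (b4 \<sigma>) 1) (wmon (b5 \<sigma>) 1)" for \<sigma>
    by (simp add: word_summand_def b take_map drop_map n del: upt_Suc)
  have len: "length (b2 \<sigma>) = r" "length (b4 \<sigma>) = r'" for \<sigma>
    by (simp_all add: b n del: upt_Suc)
  have sorted: "sorted_wrt (<) (b2 \<sigma>) \<longleftrightarrow> strict_mono_on {i + 1..i + r} \<sigma>"
    "sorted_wrt (<) (b4 \<sigma>) \<longleftrightarrow> strict_mono_on {i + r + l + 1..n - j} \<sigma>" if "\<sigma> \<in> ?P" for \<sigma>
    unfolding b using that permutes_in_image[of \<sigma> "{1..n}"]
    by (intro sorted_map_upt_iff[OF c]; force simp: n)+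
  have fin: "finite ?P" by (simp add: finite_permutations)
  have "cap_map i l j m (ant n (wmon (map c [1..<Suc n]) 1)) =
      (\<Oplus>\<^bsub>G\<^esub>\<sigma>\<in>?P. of_int (sign \<sigma>) \<odot>\<^bsub>G\<^esub> word_summand i l m (?w \<sigma>))"
    unfolding ant_mon_one_based cap_map_sum[OF m fin]
    by (intro G.finsum_cong') (use m n in \<open>auto simp: cap_map_mon simp del: upt_Suc\<close>)
  also have "\<dots> = finsum G ?t ?S"
  proof (rule G.add.finprod_mono_neutral_cong_right[OF fin])
    fix \<sigma> assume "\<sigma> \<in> ?P - ?S"
    then have "\<not> (sorted_wrt (<) (b2 \<sigma>) \<and> sorted_wrt (<) (b4 \<sigma>))"
      using sorted[of \<sigma>] by auto
    then have "word_summand i l m (?w \<sigma>) = \<zero>\<^bsub>G\<^esub>"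
      unfolding ws by (intro summand_vanish m len)
    moreover have "k \<odot>\<^bsub>G\<^esub> \<zero>\<^bsub>G\<^esub> = \<zero>\<^bsub>G\<^esub>" for k
      using G.smult_r_distr[of "\<zero>\<^bsub>G\<^esub>" "\<zero>\<^bsub>G\<^esub>" k] by simp
    ultimately show "of_int (sign \<sigma>) \<odot>\<^bsub>G\<^esub> word_summand i l m (?w \<sigma>) = \<zero>\<^bsub>G\<^esub>"
      by simp
  next
    fix \<sigma> assume \<sigma>: "\<sigma> \<in> ?S"
    then have "sorted_wrt (<) (b2 \<sigma>)" "sorted_wrt (<) (b4 \<sigma>)"
      using sorted[of \<sigma>] by auto
    then have "cochain (wmon (b2 \<sigma>) 1) = f (ext_class (wmon (b2 \<sigma>) 1))"
      "to_W (wmon (b4 \<sigma>) 1) = ant r' (wmon (b4 \<sigma>) 1)"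
      by (simp_all add: cochain_def to_W_def increasing_part_mon len)
    then show "of_int (sign \<sigma>) \<odot>\<^bsub>G\<^esub> word_summand i l m (?w \<sigma>) = ?t \<sigma>"
      unfolding ws summand_def b by simp
  qed (use m in auto)
  finally show ?thesis .
qed

end

theorem mainTheorem6:
  fixes scale :: "'k::field \<Rightarrow> 'v::ab_group_add \<Rightarrow> 'v"
    and e :: "'b::{finite,linorder} \<Rightarrow> 'v"
    and M :: "(('b, 'k) tensors set, 'm) bimodule"
    and P :: "(('b, 'k) tensors set, 'p) bimodule"
    and N p q :: nat
    and f :: "('b, 'k) tensors set \<Rightarrow> 'p"
    and m :: 'm
    and x :: "nat \<Rightarrow> 'v"
    and c :: "nat \<Rightarrow> 'b"
  assumes "based_space scale e"
    and "2 \<le> card (UNIV :: 'b set)" and "2 \<le> N" and "N \<le> card (UNIV :: 'b set)"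
    and "sym_bimodule N M" and "sym_bimodule N P"
    and "p \<le> q" and "nu N (q - p) \<noteq> nu N q - nu N p"
    and "klinear (ext_power (nu N p)) (kspace N P) f"
    and "m \<in> carrier M"
    and "strict_mono_on {1..nu N q} c" and "\<forall>s\<in>{1..nu N q}. x s = e (c s)"
  shows
    "ext_cap N M P p q
       (pure_k (kspace N M) (ext_power (nu N q)) m (wedge scale e (map x [1..<Suc (nu N q)]))) f =
     (let G = tensor_k (tensor_A N M P) (ext_power (nu N (q - p)))
      in finsum G (\<lambda>(i, j). \<Oplus>\<^bsub>G\<^esub>\<sigma>\<in>Sh N p q i j.
           of_int (sign \<sigma>) \<odot>\<^bsub>G\<^esub>
             pure_k (tensor_A N M P) (ext_power (nu N (q - p)))
               (pure_A N M P
                 (ract N M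
                   (lact N M (tens scale e (block x \<sigma> (nu N q - j + 1) (nu N q))) m)
                   (tens scale e (block x \<sigma> 1 i)))
                 (ract N P
                   (f (wedge scale e (block x \<sigma> (i + 1) (i + nu N p))))
                   (tens scale e (block x \<sigma> (i + nu N p + 1) (nu N p + N - j - 2)))))
               (wedge scale e (block x \<sigma> (nu N p + N - j - 1) (nu N q - j))))
         {(i, j). i + j \<le> N - 2})"
proof -
  interpret based_space scale e by fact
  have pq: "odd p" "even q"
    using nu_diff[OF assms(7), of N] assms(8) by auto
  let ?n = "nu N q" and ?r = "nu N p" and ?r' = "nu N (q - p)"
  interpret cap_setting N M P ?r ?r' f
    using assms(5,6,9) by (simp add: cap_setting_def cap_setting_axioms_def bimod_pair_def sym_bimod_def)
  interpret K: id_phi_setting "kspace N M" N ?n "TYPE('b)"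
    by (rule id_phi_setting.intro[OF M.kmodule_kspace])
  interpret T: id_phi_setting TA N ?r' "TYPE('b)"
    by (rule id_phi_setting.intro[OF kmodule_tensor_A])
  let ?E = "ext_power ?r' :: ('k, ('b, 'k) tensors set) module"
  interpret TE: kmodule "tensor_k TA ?E" by (rule T.E.kmodule_tensor_k)
  let ?cw = "map c [1..<Suc ?n]"
  have tens_block: "tens scale e (block x \<sigma> a b) = wmon (map (\<lambda>s. c (\<sigma> s)) [a..<Suc b]) 1"
    if "\<sigma> permutes {1..?n}" "1 \<le> a" "b \<le> ?n" for \<sigma> a b
  proof -
    have "block x \<sigma> a b = map e (map (\<lambda>s. c (\<sigma> s)) [a..<Suc b])"
      using that permutes_in_image[OF that(1)] assms(12) unfolding block_def by (auto simp del: upt_Suc)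
    then show ?thesis by (simp only: tens_basis)
  qed
  have "map x [1..<Suc ?n] = map e ?cw"
    using assms(12) by (auto simp del: upt_Suc)
  then have wedge: "wedge scale e (map x [1..<Suc ?n]) = ext_class (wmon ?cw 1)"
    unfolding wedge_def by (simp only: tens_basis)
  have "id_phi N (kspace N M) ?n
      (pure_k (kspace N M) (ext_power ?n) m (wedge scale e (map x [1..<Suc ?n]))) =
      pure_k (kspace N M) (W_module N ?n) m (ant ?n (wmon ?cw 1))"
    unfolding wedge using assms(10) by (intro K.id_phi_pure tpow_mon) (simp_all add: M.kspace_simps del: upt_Suc)
  then have cap: "koszul_cap N M P p q (id_phi N (kspace N M) ?n
      (pure_k (kspace N M) (ext_power ?n) m (wedge scale e (map x [1..<Suc ?n]))))
      (f \<circ> inv_into (carrier (ext_power ?r)) (phi ?r)) =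
      finsum G (\<lambda>(i, j). cap_map i (N - 2 - (i + j)) j m (ant ?n (wmon ?cw 1))) {(i, j). i + j \<le> N - 2}"
    by (simp only:) (rule koszul_cap_pure[OF assms(3) refl refl pq assms(7,10) ant_W[OF tpow_mon]],
        simp del: upt_Suc)
  let ?t = "\<lambda>i j \<sigma>. of_int (sign \<sigma>) \<odot>\<^bsub>tensor_k TA ?E\<^esub> pure_k TA ?E
               (pure_A N M P
                 (ract N M
                   (lact N M (tens scale e (block x \<sigma> (nu N q - j + 1) (nu N q))) m)
                   (tens scale e (block x \<sigma> 1 i)))
                 (ract N P
                   (f (wedge scale e (block x \<sigma> (i + 1) (i + nu N p))))
                   (tens scale e (block x \<sigma> (i + nu N p + 1) (nu N p + N - j - 2)))))
               (wedge scale e (block x \<sigma> (nu N p + N - j - 1) (nu N q - j)))"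
  have t: "?t i j \<sigma> \<in> carrier (tensor_k TA ?E) \<and>
      id_phi N TA ?r' (?t i j \<sigma>) = of_int (sign \<sigma>) \<odot>\<^bsub>G\<^esub> pure_k TA V (pure_A N M P
        (ract N M (lact N M (wmon (map (\<lambda>s. c (\<sigma> s)) [?n - j + 1..<Suc ?n]) 1) m)
          (wmon (map (\<lambda>s. c (\<sigma> s)) [1..<Suc i]) 1))
        (ract N P (f (ext_class (wmon (map (\<lambda>s. c (\<sigma> s)) [i + 1..<Suc (i + ?r)]) 1)))
          (wmon (map (\<lambda>s. c (\<sigma> s)) [i + ?r + 1..<Suc (i + ?r + (N - 2 - (i + j)))]) 1)))
        (ant ?r' (wmon (map (\<lambda>s. c (\<sigma> s)) [i + ?r + (N - 2 - (i + j)) + 1..<Suc (?n - j)]) 1))"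
    (is "_ \<and> _ = of_int (sign \<sigma>) \<odot>\<^bsub>G\<^esub> pure_k TA V ?y ?z")
    if ij: "i + j \<le> N - 2" and \<sigma>: "\<sigma> permutes {1..?n}" for i j \<sigma>
  proof -
    let ?l = "N - 2 - (i + j)"
    let ?v = "map (\<lambda>s. c (\<sigma> s)) [i + ?r + ?l + 1..<Suc (?n - j)]"
    have n: "?n = i + ?r + ?l + ?r' + j"
      using nu_odd_even[OF pq assms(7,3) ij] by simp
    have idx: "?r + N - j - 2 = i + ?r + ?l" "?r + N - j - 1 = i + ?r + ?l + 1"
      using ij assms(3) by auto
    have len: "length ?v = ?r'" using n by (simp del: upt_Suc)
    have E: "ext_class (wmon ?v 1) \<in> carrier ?E"
      unfolding carrier_ext_power by (rule imageI, rule tpow_mon, rule len)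
    have "f (ext_class (wmon (map (\<lambda>s. c (\<sigma> s)) [i + 1..<Suc (i + ?r)]) 1)) \<in> carrier P"
    proof -
      have "ext_class (wmon (map (\<lambda>s. c (\<sigma> s)) [i + 1..<Suc (i + ?r)]) 1) \<in> carrier (ext_power ?r :: ('k, ('b, 'k) tensors set) module)"
        unfolding carrier_ext_power by (rule imageI, rule tpow_mon) (simp del: upt_Suc)
      then show ?thesis using assms(9) by (auto simp: klinear_def P.kspace_simps)
    qed
    then have y: "?y \<in> carrier TA"
      using assms(10) by simp
    have eq: "?t i j \<sigma> = of_int (sign \<sigma>) \<odot>\<^bsub>tensor_k TA ?E\<^esub> pure_k TA ?E ?y (ext_class (wmon ?v 1))"
    proof -
      have "1 \<le> ?n - j + 1" "1 \<le> i + 1" "1 \<le> i + ?r + 1" "1 \<le> i + ?r + ?l + 1"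
        "i \<le> ?n" "i + ?r \<le> ?n" "i + ?r + ?l \<le> ?n" "?n - j \<le> ?n"
        using n by linarith+
      then show ?thesis
        unfolding idx wedge_def using \<sigma> by (simp only: tens_block order_refl)
    qed
    \<comment> \<open>The sign is moved into the first factor, because \<open>id_phi_pure\<close> evaluates \<open>id_phi\<close> on pure tensors.\<close>
    have "?t i j \<sigma> = pure_k TA ?E (of_int (sign \<sigma>) \<odot>\<^bsub>TA\<^esub> ?y) (ext_class (wmon ?v 1))"
      unfolding eq using y E by (simp only: T.E.pure_k_eq T.E.tensor_k_eq T.E.smult_pt)
    moreover have "id_phi N TA ?r' (pure_k TA ?E (of_int (sign \<sigma>) \<odot>\<^bsub>TA\<^esub> ?y) (ext_class (wmon ?v 1))) =
        pure_k TA V (of_int (sign \<sigma>) \<odot>\<^bsub>TA\<^esub> ?y) ?z"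
      by (rule T.id_phi_pure[OF TA.smult_closed[OF y] tpow_mon[OF len]])
    moreover have "\<dots> = of_int (sign \<sigma>) \<odot>\<^bsub>G\<^esub> pure_k TA V ?y ?z"
      using y by (rule pure_k_smult_left) (simp only: W_module_simps, rule ant_W, rule tpow_mon, rule len)
    moreover have "?t i j \<sigma> \<in> carrier (tensor_k TA ?E)"
      unfolding eq by (rule TE.smult_closed) (use y E in \<open>simp only: T.E.pure_k_eq T.E.tensor_k_eq T.E.pt_closed\<close>)
    ultimately show ?thesis by simp
  qed
  let ?s = "\<lambda>(i, j). finsum (tensor_k TA ?E) (?t i j) (Sh N p q i j)"
  have Sh: "Sh N p q i j = {\<sigma>. \<sigma> permutes {1..?n} \<and> strict_mono_on {i + 1..i + ?r} \<sigma> \<and>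
        strict_mono_on {i + ?r + (N - 2 - (i + j)) + 1..?n - j} \<sigma>}" if "i + j \<le> N - 2" for i j
  proof -
    have "?r + N - j - 1 = i + ?r + (N - 2 - (i + j)) + 1" using that assms(3) by auto
    then show ?thesis unfolding Sh_def by simp
  qed
  have s_closed: "?s (i, j) \<in> carrier (tensor_k TA ?E)" if "i + j \<le> N - 2" for i j
    using t[OF that] unfolding prod.case by (intro TE.finsum_closed) (auto simp: Sh_def)
  have id_phi_s: "id_phi N TA ?r' (?s (i, j)) = cap_map i (N - 2 - (i + j)) j m (ant ?n (wmon ?cw 1))"
    if ij: "i + j \<le> N - 2" for i j
  proof -
    have fin: "finite (Sh N p q i j)"
      by (rule finite_subset[OF _ finite_permutations[of "{1..?n}"]]) (auto simp: Sh_def)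
    have "id_phi N TA ?r' (?s (i, j)) = (\<Oplus>\<^bsub>G\<^esub>\<sigma>\<in>Sh N p q i j. id_phi N TA ?r' (?t i j \<sigma>))"
      unfolding prod.case
      by (rule hom_finsum[OF TE.abelian_group_axioms G.abelian_group_axioms T.id_phi_hom fin])
        (use t[OF ij] in \<open>auto simp: Sh_def\<close>)
    also have "\<dots> = cap_map i (N - 2 - (i + j)) j m (ant ?n (wmon ?cw 1))"
      unfolding cap_map_ant[OF assms(10) nu_odd_even[OF pq assms(7,3) ij, symmetric] assms(11)] Sh[OF ij]
    proof (rule G.finsum_cong'[OF refl], goal_cases)
      case 1
      show ?case
      proof
        fix \<sigma> assume "\<sigma> \<in> {\<sigma>. \<sigma> permutes {1..?n} \<and> strict_mono_on {i + 1..i + ?r} \<sigma> \<and>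
          strict_mono_on {i + ?r + (N - 2 - (i + j)) + 1..?n - j} \<sigma>}"
        then have \<sigma>: "\<sigma> permutes {1..?n}" by simp
        show "of_int (sign \<sigma>) \<odot>\<^bsub>G\<^esub> pure_k TA V (pure_A N M P
          (ract N M (lact N M (wmon (map (\<lambda>s. c (\<sigma> s)) [?n - j + 1..<Suc ?n]) 1) m)
            (wmon (map (\<lambda>s. c (\<sigma> s)) [1..<Suc i]) 1))
          (ract N P (f (ext_class (wmon (map (\<lambda>s. c (\<sigma> s)) [i + 1..<Suc (i + ?r)]) 1)))
            (wmon (map (\<lambda>s. c (\<sigma> s)) [i + ?r + 1..<Suc (i + ?r + (N - 2 - (i + j)))]) 1)))
          (ant ?r' (wmon (map (\<lambda>s. c (\<sigma> s)) [i + ?r + (N - 2 - (i + j)) + 1..<Suc (?n - j)]) 1)) \<in> carrier G"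
          unfolding t[OF ij \<sigma>, THEN conjunct2, symmetric]
          using hom_in_carrier[OF T.id_phi_hom, of "?t i j \<sigma>"] t[OF ij \<sigma>, THEN conjunct1] by simp
      qed
    next
      case (2 \<sigma>)
      then show ?case using t[OF ij] by simp
    qed
    finally show ?thesis .
  qed
  have fin: "finite {(i, j). i + j \<le> N - 2}"
    by (rule finite_subset[of _ "{..N} \<times> {..N}"]) auto
  \<comment> \<open>The claimed right-hand side is shown to be mapped by \<open>id \<otimes> \<phi>\<close> to the cap product.\<close>
  have "id_phi N TA ?r' (finsum (tensor_k TA ?E) ?s {(i, j). i + j \<le> N - 2}) =
      finsum G (\<lambda>z. id_phi N TA ?r' (?s z)) {(i, j). i + j \<le> N - 2}"
    by (rule hom_finsum[OF TE.abelian_group_axioms G.abelian_group_axioms T.id_phi_hom fin])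
      (use s_closed in auto)
  also have "\<dots> = finsum G (\<lambda>(i, j). cap_map i (N - 2 - (i + j)) j m (ant ?n (wmon ?cw 1))) {(i, j). i + j \<le> N - 2}"
  proof (rule G.finsum_cong'[OF refl])
    show "id_phi N TA ?r' (?s z) = (case z of (i, j) \<Rightarrow> cap_map i (N - 2 - (i + j)) j m (ant ?n (wmon ?cw 1)))"
      if "z \<in> {(i, j). i + j \<le> N - 2}" for z
      using that id_phi_s by (cases z) (simp only: mem_Collect_eq prod.case)
  qed (use assms(10) in auto)
  finally have image: "id_phi N TA ?r' (finsum (tensor_k TA ?E) ?s {(i, j). i + j \<le> N - 2}) =
    koszul_cap N M P p q (id_phi N (kspace N M) ?n
      (pure_k (kspace N M) (ext_power ?n) m (wedge scale e (map x [1..<Suc ?n]))))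
      (f \<circ> inv_into (carrier (ext_power ?r)) (phi ?r))"
    unfolding cap .
  have "finsum (tensor_k TA ?E) ?s {(i, j). i + j \<le> N - 2} \<in> carrier (tensor_k TA ?E)"
    using s_closed by (intro TE.finsum_closed) auto
  then have "inv_into (carrier (tensor_k TA ?E)) (id_phi N TA ?r')
      (id_phi N TA ?r' (finsum (tensor_k TA ?E) ?s {(i, j). i + j \<le> N - 2})) =
      finsum (tensor_k TA ?E) ?s {(i, j). i + j \<le> N - 2}"
    by (rule inv_into_f_f[OF T.inj_on_id_phi[OF assms(3) nu_cases]])
  then show ?thesis
    unfolding image by (simp only: ext_cap_def Let_def)
qed

end
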